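(* Let $u:A\to A'$ be a flat morphism of Noetherian local domains of dimension $1$, such that $A\supseteq \mathbb{Q}$ and the maximal ideal $m$ of $A$ generates the maximal ideal of $A'$. Suppose moreover that there exist canonical inclusions $k=A/m\to A$ and $k'=A'/mA'\to A'$ (i.e. coefficient fields) with $u(k)\subseteq k'$. Let $B=A[Y]/I$ with $Y=(Y_1,\ldots,Y_n)$ be a finite type $A$-algebra. Then every $A$-algebra morphism $v:B\to A'$ factors through a standard smooth $A$-algebra $B'$, i.e. $v$ is a composite of $A$-morphisms $B\to B'\to A'$.
   Context: For a system $f=(f_1,\ldots,f_r)$ of polynomials in $I$ with $r\le n$, let $\Delta_f$ denote the ideal generated by all $r\times r$-minors of the Jacobian matrix $(\partial f_i/\partial Y_j)$, and let $((f):I)=\{g\in A[Y]: gI\subseteq (f)\}$. An $A$-algebra $B=A[Y]/I$ is called standard smooth over $A$ if there exists such a system $f$ in $I$ with $1\in ((f):I)\Delta_f B$. *)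

theory Defs
  imports "HOL-Library.Poly_Mapping" "HOL-Library.Extended_Nat" "Jordan_Normal_Form.Determinant"
begin

definition is_ideal :: "'a::comm_ring_1 set \<Rightarrow> 'a set \<Rightarrow> bool" where
  "is_ideal R I \<longleftrightarrow> I \<subseteq> R \<and> 0 \<in> I \<and> (\<forall>x\<in>I. \<forall>y\<in>I. x + y \<in> I) \<and>
     (\<forall>r\<in>R. \<forall>x\<in>I. r * x \<in> I)"

definition gen_ideal :: "'a::comm_ring_1 set \<Rightarrow> 'a set \<Rightarrow> 'a set" where
  "gen_ideal R S = {x. \<exists>(F::nat set) c s. finite F \<and> (\<forall>i\<in>F. c i \<in> R \<and> s i \<in> S) \<and>
      x = (\<Sum>i\<in>F. c i * s i)}"

definition ideal_prod :: "'a::comm_ring_1 set \<Rightarrow> 'a set \<Rightarrow> 'a set \<Rightarrow> 'a set" where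
  "ideal_prod R I J = gen_ideal R {a * b |a b. a \<in> I \<and> b \<in> J}"

definition prime_ideal :: "'a::comm_ring_1 set \<Rightarrow> bool" where
  "prime_ideal P \<longleftrightarrow> is_ideal UNIV P \<and> 1 \<notin> P \<and> (\<forall>x y. x * y \<in> P \<longrightarrow> x \<in> P \<or> y \<in> P)"

definition maximal_ideal :: "'a::comm_ring_1 set \<Rightarrow> bool" where
  "maximal_ideal M \<longleftrightarrow> is_ideal UNIV M \<and> 1 \<notin> M \<and>
     (\<forall>J. is_ideal UNIV J \<and> M \<subseteq> J \<longrightarrow> J = M \<or> 1 \<in> J)"

definition local_ring_max :: "'a::comm_ring_1 set \<Rightarrow> bool" where
  "local_ring_max M \<longleftrightarrow> maximal_ideal M \<and> (\<forall>N. maximal_ideal N \<longrightarrow> N = M)"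

definition noetherian :: "'a::comm_ring_1 itself \<Rightarrow> bool" where
  "noetherian _ \<longleftrightarrow> (\<forall>C :: nat \<Rightarrow> 'a set. (\<forall>i. is_ideal UNIV (C i)) \<and> (\<forall>i. C i \<subseteq> C (Suc i))
      \<longrightarrow> (\<exists>N. \<forall>i\<ge>N. C i = C N))"

definition krull_dim :: "'a::comm_ring_1 itself \<Rightarrow> enat" where
  "krull_dim _ = Sup {enat l |l. \<exists>P :: nat \<Rightarrow> 'a set. (\<forall>i\<le>l. prime_ideal (P i)) \<and>
                                   (\<forall>i<l. P i \<subset> P (Suc i))}"

definition ring_hom :: "('a::comm_ring_1 \<Rightarrow> 'b::comm_ring_1) \<Rightarrow> bool" where
  "ring_hom u \<longleftrightarrow> u 1 = 1 \<and> (\<forall>x y. u (x + y) = u x + u y) \<and> (\<forall>x y. u (x * y) = u x * u y)"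

text \<open>Flatness of the A-algebra A' (via u), by the equational criterion:
  every linear relation with coefficients in A among elements of A' is trivial.\<close>
definition flat_hom :: "('a::comm_ring_1 \<Rightarrow> 'b::comm_ring_1) \<Rightarrow> bool" where
  "flat_hom u \<longleftrightarrow> (\<forall>(r::nat) (a::nat \<Rightarrow> 'a) (x::nat \<Rightarrow> 'b).
      (\<Sum>i<r. u (a i) * x i) = 0 \<longrightarrow>
      (\<exists>(s::nat) (b::nat \<Rightarrow> nat \<Rightarrow> 'a) (y::nat \<Rightarrow> 'b).
         (\<forall>i<r. x i = (\<Sum>j<s. u (b i j) * y j)) \<and>
         (\<forall>j<s. (\<Sum>i<r. a i * b i j) = 0)))"

text \<open>K is a coefficient field of the local ring with maximal ideal M: a subfield K
  such that the composite K \<rightarrow> A \<rightarrow> A/M is bijective.\<close>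
definition coefficient_field :: "'a::comm_ring_1 set \<Rightarrow> 'a set \<Rightarrow> bool" where
  "coefficient_field K M \<longleftrightarrow> 0 \<in> K \<and> 1 \<in> K \<and>
     (\<forall>x\<in>K. \<forall>y\<in>K. x + y \<in> K \<and> x - y \<in> K \<and> x * y \<in> K) \<and>
     (\<forall>x\<in>K. x \<noteq> 0 \<longrightarrow> (\<exists>y\<in>K. x * y = 1)) \<and>
     (\<forall>a. \<exists>!k. k \<in> K \<and> a - k \<in> M)"

type_synonym 'a mpoly = "(nat \<Rightarrow>\<^sub>0 nat) \<Rightarrow>\<^sub>0 'a"

definition polys :: "nat \<Rightarrow> 'a::comm_ring_1 mpoly set" where
  "polys n = {p. \<forall>mo\<in>Poly_Mapping.keys p. Poly_Mapping.keys mo \<subseteq> {..<n}}"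

definition const_poly :: "'a::comm_ring_1 \<Rightarrow> 'a mpoly" where
  "const_poly c = Poly_Mapping.single 0 c"

definition peval :: "('a::comm_ring_1 \<Rightarrow> 'b::comm_ring_1) \<Rightarrow> (nat \<Rightarrow> 'b) \<Rightarrow> 'a mpoly \<Rightarrow> 'b" where
  "peval phi y p = (\<Sum>mo\<in>Poly_Mapping.keys p. phi (Poly_Mapping.lookup p mo) * (\<Prod>i\<in>Poly_Mapping.keys mo. y i ^ Poly_Mapping.lookup mo i))"

definition mpderiv :: "nat \<Rightarrow> 'a::comm_ring_1 mpoly \<Rightarrow> 'a mpoly" where
  "mpderiv k p = (\<Sum>mo\<in>Poly_Mapping.keys p. Poly_Mapping.single (mo - Poly_Mapping.single k 1)
                                 (of_nat (Poly_Mapping.lookup mo k) * Poly_Mapping.lookup p mo))"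

definition jac_ideal :: "nat \<Rightarrow> nat \<Rightarrow> (nat \<Rightarrow> 'a::comm_ring_1 mpoly) \<Rightarrow> 'a mpoly set" where
  "jac_ideal m r f = gen_ideal (polys m)
     {det (mat r r (\<lambda>(i, j). mpderiv (c j) (f i))) |c.
        (\<forall>j<r. c j < m) \<and> strict_mono_on {..<r} c}"

definition colon_ideal :: "nat \<Rightarrow> nat \<Rightarrow> (nat \<Rightarrow> 'a::comm_ring_1 mpoly) \<Rightarrow> 'a mpoly set \<Rightarrow> 'a mpoly set" where
  "colon_ideal m r f J = {g \<in> polys m. \<forall>h\<in>J. g * h \<in> gen_ideal (polys m) (f ` {..<r})}"

text \<open>B' = A[Z_0..Z_{m-1}]/J is standard smooth over A.\<close>
definition standard_smooth :: "nat \<Rightarrow> 'a::comm_ring_1 mpoly set \<Rightarrow> bool" where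
  "standard_smooth m J \<longleftrightarrow> is_ideal (polys m) J \<and>
     (\<exists>r f. r \<le> m \<and> (\<forall>i<r. f i \<in> J) \<and>
        (\<exists>g\<in>ideal_prod (polys m) (colon_ideal m r f J) (jac_ideal m r f). 1 - g \<in> J))"

end

theory Submission
  imports Defs "HOL-Computational_Algebra.Polynomial"
begin

text \<open>
  Every \<open>y\<^sub>j\<close> is either transcendental over \<open>A[y\<^sub>0, \<dots>, y\<^sub>j\<^sub>-\<^sub>1]\<close> or a simple root of a relation
  \<open>F\<^sub>j\<close> of minimal degree over it. Choose \<open>d \<noteq> 0\<close> in the maximal ideal such that \<open>u d\<close> is a multiple of
  the leading coefficients times derivatives of all these relations. Modulo a power of \<open>d\<close> the elements
  of \<open>A'\<close> come from \<open>A \<otimes>\<^sub>K K'\<close>, hence from \<open>A \<otimes>\<^sub>K C\<close> for a standard smooth \<open>K\<close>-subalgebra \<open>C\<close> of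
  \<open>K'\<close>, and by flatness \<open>A \<otimes>\<^sub>K C \<rightarrow> A'\<close> is injective modulo every element of \<open>A\<close>.
  Over this algebra the \<open>y\<^sub>j\<close> are lifted one after the other: a transcendental one by a new free variable,
  an algebraic one by the Newton equation for the correction of its approximation, whose derivative
  is a unit. All these equations keep \<open>d\<close> a nonzerodivisor, which is what makes every
  relation among the \<open>y\<^sub>j\<close> (killed by a power of \<open>d\<close>) hold for the lifts.
\<close>

section \<open>Subrings and ideals\<close>

text \<open>\<open>A'\<close> is not assumed henselian, and no root is constructed: the root of each
  Newton equation is the known element \<open>y j\<close>, rewritten in a new coordinate. The
  difficulty lies in the other direction: every relation among the \<open>y j\<close>, and not only
  the chosen relations \<open>F j\<close>, has to hold for the lifts. A relation becomes a multiple
  of \<open>F j\<close>, up to terms already controlled, only after multiplication by a power of the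
  leading coefficient of \<open>F j\<close>, which is no unit in general. Multiplying further by the
  derivative and by an approximate cofactor \<open>b\<close> turns this power into a power of
  \<open>d\<close> times a unit, and \<open>d\<close> can be cancelled because it is a
  nonzerodivisor. Dimension one enters twice: in \<open>A'\<close> it makes the product of all
  leading coefficients and derivatives divide the image of a nonzero element of the maximal ideal of
  \<open>A\<close>; in \<open>A\<close> it reduces approximation modulo a nonzero element to the
  residue fields.\<close>

definition is_subring :: "'a::comm_ring_1 set \<Rightarrow> bool" where
  "is_subring Q \<longleftrightarrow> 0 \<in> Q \<and> 1 \<in> Q \<and> (\<forall>x\<in>Q. \<forall>y\<in>Q. x + y \<in> Q \<and> x - y \<in> Q \<and> x * y \<in> Q)"

lemma is_subringD:
  assumes "is_subring Q"
  shows "0 \<in> Q" "1 \<in> Q" "\<And>x y. x \<in> Q \<Longrightarrow> y \<in> Q \<Longrightarrow> x + y \<in> Q"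
    "\<And>x y. x \<in> Q \<Longrightarrow> y \<in> Q \<Longrightarrow> x - y \<in> Q" "\<And>x y. x \<in> Q \<Longrightarrow> y \<in> Q \<Longrightarrow> x * y \<in> Q"
    "\<And>x. x \<in> Q \<Longrightarrow> - x \<in> Q"
proof -
  show "0 \<in> Q" "1 \<in> Q" "\<And>x y. x \<in> Q \<Longrightarrow> y \<in> Q \<Longrightarrow> x + y \<in> Q"
    "\<And>x y. x \<in> Q \<Longrightarrow> y \<in> Q \<Longrightarrow> x - y \<in> Q" "\<And>x y. x \<in> Q \<Longrightarrow> y \<in> Q \<Longrightarrow> x * y \<in> Q"
    using assms by (auto simp: is_subring_def)
  then show "\<And>x. x \<in> Q \<Longrightarrow> - x \<in> Q"
    by (metis diff_0)
qed

lemma is_subring_UNIV [simp]: "is_subring UNIV"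
  by (simp add: is_subring_def)

lemma is_subring_sum: "is_subring Q \<Longrightarrow> (\<And>i. i \<in> F \<Longrightarrow> f i \<in> Q) \<Longrightarrow> sum f F \<in> Q"
  by (induction F rule: infinite_finite_induct) (auto simp: is_subringD)

lemma is_subring_prod: "is_subring Q \<Longrightarrow> (\<And>i. i \<in> F \<Longrightarrow> f i \<in> Q) \<Longrightarrow> prod f F \<in> Q"
  by (induction F rule: infinite_finite_induct) (auto simp: is_subringD)

lemma is_subring_power: "is_subring Q \<Longrightarrow> x \<in> Q \<Longrightarrow> x ^ k \<in> Q"
  by (induction k) (auto simp: is_subringD)

lemma is_subring_of_nat: "is_subring Q \<Longrightarrow> of_nat k \<in> Q"
  by (induction k) (auto simp: is_subringD)

lemma is_idealD:
  assumes "is_ideal R I"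
  shows "I \<subseteq> R" "0 \<in> I" "\<And>x y. x \<in> I \<Longrightarrow> y \<in> I \<Longrightarrow> x + y \<in> I"
    "\<And>r x. r \<in> R \<Longrightarrow> x \<in> I \<Longrightarrow> r * x \<in> I" "\<And>r x. r \<in> R \<Longrightarrow> x \<in> I \<Longrightarrow> x * r \<in> I"
  using assms by (auto simp: is_ideal_def mult.commute)

lemma is_ideal_neg:
  assumes "is_subring R" "is_ideal R I" "x \<in> I"
  shows "- x \<in> I"
  using is_idealD(4)[OF assms(2) is_subringD(6)[OF assms(1) is_subringD(2)[OF assms(1)]] assms(3)]
  by simp

lemma is_ideal_diff:
  assumes "is_subring R" "is_ideal R I" "x \<in> I" "y \<in> I"
  shows "x - y \<in> I"
  using is_idealD(3)[OF assms(2) assms(3) is_ideal_neg[OF assms(1,2,4)]] by simp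

lemma is_ideal_sum: "is_ideal R I \<Longrightarrow> (\<And>i. i \<in> F \<Longrightarrow> f i \<in> I) \<Longrightarrow> sum f F \<in> I"
  by (induction F rule: infinite_finite_induct) (auto simp: is_idealD)

text \<open>Lists replace the index sets of naturals in \<open>gen_ideal\<close>, so that the sum of
  two elements is a concatenation and no indices have to be renumbered.\<close>

lemma gen_ideal_iff_list:
  "x \<in> gen_ideal R S \<longleftrightarrow> (\<exists>xs. set xs \<subseteq> R \<times> S \<and> x = sum_list (map (\<lambda>(c, s). c * s) xs))"
proof
  assume "x \<in> gen_ideal R S"
  then obtain F :: "nat set" and c s where F: "finite F" "\<forall>i\<in>F. c i \<in> R \<and> s i \<in> S"
    "x = (\<Sum>i\<in>F. c i * s i)"
    by (auto simp: gen_ideal_def)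
  have "x = sum_list (map (\<lambda>i. c i * s i) (sorted_list_of_set F))"
    using F by (simp add: sum.distinct_set_conv_list[symmetric])
  then have "x = sum_list (map (\<lambda>(c, s). c * s) (map (\<lambda>i. (c i, s i)) (sorted_list_of_set F)))"
    by (simp add: comp_def)
  moreover have "set (map (\<lambda>i. (c i, s i)) (sorted_list_of_set F)) \<subseteq> R \<times> S"
    using F by auto
  ultimately show "\<exists>xs. set xs \<subseteq> R \<times> S \<and> x = sum_list (map (\<lambda>(c, s). c * s) xs)"
    by blast
next
  assume "\<exists>xs. set xs \<subseteq> R \<times> S \<and> x = sum_list (map (\<lambda>(c, s). c * s) xs)"
  then obtain xs where xs: "set xs \<subseteq> R \<times> S" "x = sum_list (map (\<lambda>(c, s). c * s) xs)"
    by blast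
  have "x = (\<Sum>i\<in>{..<length xs}. fst (xs ! i) * snd (xs ! i))"
    unfolding xs(2) sum_list_sum_nth by (auto simp: atLeast0LessThan case_prod_unfold intro!: sum.cong)
  moreover have "\<forall>i\<in>{..<length xs}. fst (xs ! i) \<in> R \<and> snd (xs ! i) \<in> S"
  proof
    fix i assume "i \<in> {..<length xs}"
    then have "xs ! i \<in> R \<times> S"
      using xs(1) by auto
    then show "fst (xs ! i) \<in> R \<and> snd (xs ! i) \<in> S"
      by (simp add: mem_Times_iff)
  qed
  ultimately show "x \<in> gen_ideal R S"
    unfolding gen_ideal_def
    by (intro CollectI exI[of _ "{..<length xs}"] exI[of _ "\<lambda>i. fst (xs ! i)"]
        exI[of _ "\<lambda>i. snd (xs ! i)"]) simp
qed

lemma gen_ideal_is_ideal: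
  assumes "is_subring R" "S \<subseteq> R"
  shows "is_ideal R (gen_ideal R S)"
proof -
  have 1: "x \<in> R" if "x \<in> gen_ideal R S" for x
    using that assms unfolding gen_ideal_def by (auto intro!: is_subring_sum is_subringD)
  have 2: "0 \<in> gen_ideal R S"
    unfolding gen_ideal_iff_list by (rule exI[of _ "[]"]) simp
  have 3: "x + y \<in> gen_ideal R S" if "x \<in> gen_ideal R S" "y \<in> gen_ideal R S" for x y
  proof -
    obtain xs where "set xs \<subseteq> R \<times> S" "x = sum_list (map (\<lambda>(c, s). c * s) xs)"
      using \<open>x \<in> gen_ideal R S\<close> unfolding gen_ideal_iff_list by metis
    moreover obtain ys where "set ys \<subseteq> R \<times> S" "y = sum_list (map (\<lambda>(c, s). c * s) ys)"
      using \<open>y \<in> gen_ideal R S\<close> unfolding gen_ideal_iff_list by metis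
    ultimately show ?thesis
      unfolding gen_ideal_iff_list by (intro exI[of _ "xs @ ys"]) simp
  qed
  have 4: "r * x \<in> gen_ideal R S" if rx: "r \<in> R" "x \<in> gen_ideal R S" for r x
  proof -
    obtain F :: "nat set" and c s where F: "finite F" "\<forall>i\<in>F. c i \<in> R \<and> s i \<in> S"
      "x = (\<Sum>i\<in>F. c i * s i)"
      using rx(2) by (auto simp: gen_ideal_def)
    have "r * x = (\<Sum>i\<in>F. (r * c i) * s i)"
      by (simp add: F(3) sum_distrib_left mult.assoc)
    moreover have "\<forall>i\<in>F. r * c i \<in> R \<and> s i \<in> S"
      using F rx assms by (auto intro: is_subringD)
    ultimately show ?thesis
      unfolding gen_ideal_def using F(1)
      by (intro CollectI exI[of _ F] exI[of _ "\<lambda>i. r * c i"] exI[of _ s]) simp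
  qed
  show ?thesis
    unfolding is_ideal_def using 1 2 3 4 by blast
qed

lemma gen_ideal_mem:
  assumes "is_subring R" "s \<in> S"
  shows "s \<in> gen_ideal R S"
  unfolding gen_ideal_iff_list using assms by (intro exI[of _ "[(1, s)]"]) (auto simp: is_subringD)

lemma gen_ideal_mult_mem:
  assumes "s \<in> S" "r \<in> R"
  shows "r * s \<in> gen_ideal R S"
  unfolding gen_ideal_iff_list using assms by (intro exI[of _ "[(r, s)]"]) auto

lemma gen_ideal_least:
  assumes "is_ideal R I" "S \<subseteq> I"
  shows "gen_ideal R S \<subseteq> I"
  using assms unfolding gen_ideal_def by (auto intro!: is_ideal_sum is_idealD(4))

lemma gen_ideal_mono:
  assumes "R \<subseteq> R'" "S \<subseteq> S'"
  shows "gen_ideal R S \<subseteq> gen_ideal R' S'"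
  using assms unfolding gen_ideal_def by blast

text \<open>Singles out the multiplier of one generator. In a tower that generator is the equation
  of the top variable, and the remaining generators involve fewer variables.\<close>

lemma gen_ideal_insert:
  assumes R: "is_subring R" and S: "insert g S \<subseteq> R"
  shows "x \<in> gen_ideal R (insert g S) \<longleftrightarrow> (\<exists>c\<in>R. x - c * g \<in> gen_ideal R S)"
proof
  have id: "is_ideal R (gen_ideal R S)"
    using gen_ideal_is_ideal[OF R, of S] S by simp
  have idg: "is_ideal R (gen_ideal R (insert g S))"
    using gen_ideal_is_ideal[OF R S] by simp
  let ?I = "{x \<in> R. \<exists>c\<in>R. x - c * g \<in> gen_ideal R S}"
  have "is_ideal R ?I"
    unfolding is_ideal_def
  proof (intro conjI ballI)
    show "0 \<in> ?I"
      using is_idealD(2)[OF id] is_subringD(1)[OF R] by (auto intro!: bexI[of _ 0])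
    fix x y assume xy: "x \<in> ?I" "y \<in> ?I"
    then obtain a b where ab: "a \<in> R" "b \<in> R" "x - a * g \<in> gen_ideal R S" "y - b * g \<in> gen_ideal R S"
      by auto
    have "x + y - (a + b) * g \<in> gen_ideal R S"
      using is_idealD(3)[OF id ab(3,4)] by (simp add: algebra_simps)
    then show "x + y \<in> ?I"
      using xy ab R by (auto intro: is_subringD)
  next
    fix r x assume rx: "r \<in> R" "x \<in> ?I"
    then obtain a where a: "a \<in> R" "x - a * g \<in> gen_ideal R S"
      by auto
    have "r * x - (r * a) * g \<in> gen_ideal R S"
      using is_idealD(4)[OF id rx(1) a(2)] by (simp add: algebra_simps)
    then show "r * x \<in> ?I"
      using rx a R by (auto intro: is_subringD)
  qed auto
  moreover have "insert g S \<subseteq> ?I"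
  proof
    fix s assume s: "s \<in> insert g S"
    show "s \<in> ?I"
    proof (cases "s = g")
      case True
      then show ?thesis
        using is_idealD(2)[OF id] is_subringD(2)[OF R] S by (auto intro!: bexI[of _ 1])
    next
      case False
      then show ?thesis
        using s gen_ideal_mem[OF R, of s S] is_subringD(1)[OF R] S by (auto intro!: bexI[of _ 0])
    qed
  qed
  ultimately show "x \<in> gen_ideal R (insert g S) \<Longrightarrow> \<exists>c\<in>R. x - c * g \<in> gen_ideal R S"
    using gen_ideal_least by blast
  assume "\<exists>c\<in>R. x - c * g \<in> gen_ideal R S"
  then obtain c where c: "c \<in> R" "x - c * g \<in> gen_ideal R S"
    by auto
  then have "x - c * g \<in> gen_ideal R (insert g S)"
    using gen_ideal_mono[of R R S "insert g S"] by blast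
  then have "(x - c * g) + c * g \<in> gen_ideal R (insert g S)"
    using gen_ideal_mult_mem[of g "insert g S" c R] c(1) by (intro is_idealD(3)[OF idg]) simp_all
  then show "x \<in> gen_ideal R (insert g S)"
    by simp
qed

section \<open>One-dimensional Noetherian local domains\<close>

lemma is_ideal_UNIVI:
  assumes "0 \<in> I" "\<And>x y. x \<in> I \<Longrightarrow> y \<in> I \<Longrightarrow> x + y \<in> I" "\<And>r x. x \<in> I \<Longrightarrow> r * x \<in> I"
  shows "is_ideal UNIV I"
  using assms by (auto simp: is_ideal_def)

text \<open>Without a maximal \<open>J\<close>, dependent choice builds a strictly ascending chain.
  \<open>P\<close> is arbitrary because it serves for properness, for avoiding the powers of an
  element, and for the failure of an approximation.\<close>

lemma noetherian_maximal:
  fixes I :: "'a::comm_ring_1 set"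
  assumes "noetherian TYPE('a)" and "is_ideal UNIV I" "P I"
  obtains J where "is_ideal UNIV J" "P J" "I \<subseteq> J"
    "\<And>J'. is_ideal UNIV J' \<Longrightarrow> P J' \<Longrightarrow> J \<subseteq> J' \<Longrightarrow> J' = J"
proof (rule ccontr)
  note witness = that
  assume contra: "\<not> thesis"
  let ?A = "\<lambda>J. is_ideal UNIV J \<and> P J \<and> I \<subseteq> J"
  have step: "\<exists>J'. ?A J' \<and> J \<subset> J'" if A: "?A J" for J
  proof (rule ccontr)
    assume n: "\<not> (\<exists>J'. ?A J' \<and> J \<subset> J')"
    then have "J' = J" if "is_ideal UNIV J'" "P J'" "J \<subseteq> J'" for J'
      using that A by blast
    then show False
      using contra witness[of J] A by blast
  qed
  have "?A I"
    using assms by blast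
  then have "\<exists>C. \<forall>n::nat. ?A (C n) \<and> C n \<subset> C (Suc n)"
    using step by (intro dependent_nat_choice) auto
  then obtain C where C: "\<And>n::nat. ?A (C n)" "\<And>n. C n \<subset> C (Suc n)"
    by blast
  then have "(\<forall>i. is_ideal UNIV (C i)) \<and> (\<forall>i. C i \<subseteq> C (Suc i))"
    by blast
  then obtain N where "\<forall>i\<ge>N. C i = C N"
    using assms(1) unfolding noetherian_def by metis
  then show False
    using C(2)[of N] by (metis le_SucI order_refl psubset_eq)
qed

lemma ideal_add_elem:
  assumes "is_ideal UNIV P"
  shows "is_ideal UNIV {p + r * a |p r. p \<in> P}"
proof (rule is_ideal_UNIVI)
  show "0 \<in> {p + r * a |p r. p \<in> P}"
    using is_idealD(2)[OF assms] by (auto intro!: exI[of _ 0])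
next
  fix x y assume "x \<in> {p + r * a |p r. p \<in> P}" "y \<in> {p + r * a |p r. p \<in> P}"
  then obtain p r q s where "p \<in> P" "q \<in> P" "x = p + r * a" "y = q + s * a"
    by auto
  then show "x + y \<in> {p + r * a |p r. p \<in> P}"
    using is_idealD(3)[OF assms]
    by (intro CollectI exI[of _ "p + q"] exI[of _ "r + s"]) (auto simp: algebra_simps)
next
  fix t x assume "x \<in> {p + r * a |p r. p \<in> P}"
  then obtain p r where "p \<in> P" "x = p + r * a"
    by auto
  then show "t * x \<in> {p + r * a |p r. p \<in> P}"
    using is_idealD(4)[OF assms, of t p]
    by (intro CollectI exI[of _ "t * p"] exI[of _ "t * r"]) (simp add: algebra_simps)
qed

lemma ideal_add_elem_superset:
  assumes "is_ideal UNIV P"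
  shows "P \<subseteq> {p + r * a |p r. p \<in> P}" "a \<in> {p + r * a |p r. p \<in> P}"
proof -
  show "P \<subseteq> {p + r * a |p r. p \<in> P}"
  proof
    fix x assume "x \<in> P"
    then show "x \<in> {p + r * a |p r. p \<in> P}"
      by (intro CollectI exI[of _ x] exI[of _ 0]) simp
  qed
  show "a \<in> {p + r * a |p r. p \<in> P}"
    using is_idealD(2)[OF assms] by (intro CollectI exI[of _ 0] exI[of _ 1]) simp
qed

text \<open>If \<open>a * b\<close> lies in \<open>P\<close> but neither factor does, the ideals
  \<open>P + (a)\<close> and \<open>P + (b)\<close> are strictly larger, hence not bad, and their
  product lies in \<open>P\<close>; so \<open>mult\<close> makes \<open>P\<close> not bad
  either.\<close>

lemma maximal_wrt_property_prime:
  fixes P :: "'a::comm_ring_1 set"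
  assumes P: "is_ideal UNIV P" "bad P" "\<not> bad UNIV"
    and max: "\<And>J'. is_ideal UNIV J' \<Longrightarrow> bad J' \<Longrightarrow> P \<subseteq> J' \<Longrightarrow> J' = P"
    and mult: "\<And>I J. is_ideal UNIV I \<Longrightarrow> is_ideal UNIV J \<Longrightarrow> P \<subseteq> I \<Longrightarrow> P \<subseteq> J \<Longrightarrow> \<not> bad I \<Longrightarrow> \<not> bad J \<Longrightarrow>
        (\<And>a b. a \<in> I \<Longrightarrow> b \<in> J \<Longrightarrow> a * b \<in> P) \<Longrightarrow> \<not> bad P"
  shows "prime_ideal P"
  unfolding prime_ideal_def
proof (intro conjI allI impI)
  show "1 \<notin> P"
  proof
    assume "1 \<in> P"
    then have "x \<in> P" for x
      using is_idealD(4)[OF P(1), of x 1] by simp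
    then have "P = UNIV"
      by auto
    then show False
      using P by simp
  qed
  fix a b assume ab: "a * b \<in> P"
  show "a \<in> P \<or> b \<in> P"
  proof (rule ccontr)
    assume n: "\<not> (a \<in> P \<or> b \<in> P)"
    let ?A = "{p + r * a |p r. p \<in> P}" and ?B = "{p + r * b |p r. p \<in> P}"
    have "\<not> bad ?A" "\<not> bad ?B"
      using max[OF ideal_add_elem[OF P(1)] _ ideal_add_elem_superset(1)[OF P(1)]]
        ideal_add_elem_superset(2)[OF P(1)] n by blast+
    moreover have "x * y \<in> P" if xy: "x \<in> ?A" "y \<in> ?B" for x y
    proof -
      obtain p r where 1: "p \<in> P" "x = p + r * a"
        using xy(1) by auto
      obtain q s where 2: "q \<in> P" "y = q + s * b"
        using xy(2) by auto
      note * = 1(1) 2(1) 1(2) 2(2)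
      have "x * y = p * (q + s * b) + (r * a) * q + (r * s) * (a * b)"
        by (simp add: * algebra_simps)
      moreover have "p * (q + s * b) \<in> P" "r * a * q \<in> P" "r * s * (a * b) \<in> P"
        using is_idealD(4,5)[OF P(1) UNIV_I] *(1,2) ab by blast+
      ultimately show ?thesis
        by (simp add: is_idealD(3)[OF P(1)])
    qed
    ultimately show False
      using mult[OF ideal_add_elem[OF P(1)] ideal_add_elem[OF P(1)]
          ideal_add_elem_superset(1)[OF P(1)] ideal_add_elem_superset(1)[OF P(1)]] P(2) by blast
  qed
qed (rule P)

lemma maximal_ideal_prime:
  fixes M :: "'a::comm_ring_1 set"
  assumes "maximal_ideal M"
  shows "prime_ideal M"
proof (rule maximal_wrt_property_prime[of M "\<lambda>I. 1 \<notin> I"])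
  fix I J assume "is_ideal UNIV I" "is_ideal UNIV J" "M \<subseteq> I" "M \<subseteq> J" "\<not> 1 \<notin> I" "\<not> 1 \<notin> J"
    "\<And>a b. a \<in> I \<Longrightarrow> b \<in> J \<Longrightarrow> a * b \<in> M"
  then show "\<not> 1 \<notin> M"
    by (metis mult_1)
qed (use assms in \<open>auto simp: maximal_ideal_def\<close>)

section \<open>Units, primes and powers in a local domain of dimension one\<close>

context
  fixes M :: "'a::idom set"
  assumes noeth: "noetherian TYPE('a)" and local: "local_ring_max M"
begin

lemma local_max_ideal: "is_ideal UNIV M" and local_one_notin: "1 \<notin> M"
  using local by (auto simp: local_ring_max_def maximal_ideal_def)

lemma proper_ideal_subset_max:
  assumes "is_ideal UNIV I" "1 \<notin> I"
  shows "I \<subseteq> M"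
proof -
  obtain J where J: "is_ideal UNIV J" "1 \<notin> J" "I \<subseteq> J"
    "\<And>J'. is_ideal UNIV J' \<Longrightarrow> 1 \<notin> J' \<Longrightarrow> J \<subseteq> J' \<Longrightarrow> J' = J"
    using noetherian_maximal[OF noeth assms(1), of "\<lambda>J. 1 \<notin> J"] assms(2) by metis
  then have "maximal_ideal J"
    unfolding maximal_ideal_def by blast
  then show ?thesis
    using local J(3) by (auto simp: local_ring_max_def)
qed

lemma notin_max_unit:
  assumes "x \<notin> M"
  shows "x dvd 1"
proof (rule ccontr)
  assume n: "\<not> x dvd 1"
  have id: "is_ideal UNIV {y. x dvd y}"
    by (rule is_ideal_UNIVI) auto
  have "{y. x dvd y} \<subseteq> M"
    by (rule proper_ideal_subset_max[OF id]) (use n in simp)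
  then show False
    using assms by (auto simp: subset_iff)
qed

lemma unit_notin_max:
  assumes "x dvd 1"
  shows "x \<notin> M"
proof
  assume "x \<in> M"
  moreover obtain y where "1 = x * y"
    using assms by auto
  ultimately have "1 \<in> M"
    using is_idealD(5)[OF local_max_ideal, of y x] by simp
  then show False
    using local_one_notin by simp
qed

lemma one_plus_max_unit:
  assumes "x \<in> M"
  shows "1 + x dvd 1"
proof (rule notin_max_unit, rule notI)
  assume "1 + x \<in> M"
  then have "1 + x - x \<in> M"
    using is_ideal_diff[OF is_subring_UNIV local_max_ideal _ assms] by blast
  then show False
    using local_one_notin by simp
qed

lemma zero_prime: "prime_ideal {0::'a}"
  by (auto simp: prime_ideal_def is_ideal_def)

context
  assumes dim: "krull_dim TYPE('a) = 1"
begin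

lemma nonzero_prime_eq_max:
  assumes P: "prime_ideal P" "x \<in> P" "x \<noteq> 0"
  shows "P = M"
proof (rule ccontr)
  assume ne: "P \<noteq> M"
  have "P \<subseteq> M"
    using P(1) by (intro proper_ideal_subset_max) (auto simp: prime_ideal_def)
  then have "P \<subset> M"
    using ne by blast
  moreover have "{0} \<subset> P"
    using P is_idealD(2)[of UNIV P] by (auto simp: prime_ideal_def)
  moreover have "prime_ideal M"
    using local maximal_ideal_prime by (auto simp: local_ring_max_def)
  ultimately have "\<exists>C :: nat \<Rightarrow> 'a set. (\<forall>i\<le>2. prime_ideal (C i)) \<and> (\<forall>i<2. C i \<subset> C (Suc i))"
    using P(1) zero_prime
    by (intro exI[of _ "\<lambda>i. if i = 0 then {0} else if i = 1 then P else M"])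
      (auto simp: less_2_cases_iff)
  then have "enat 2 \<le> krull_dim TYPE('a)"
    unfolding krull_dim_def by (intro Sup_upper) blast
  then show False
    using dim by (simp add: one_enat_def)
qed

lemma max_nonzero: "\<exists>x\<in>M. x \<noteq> 0"
proof (rule ccontr)
  assume n: "\<not> (\<exists>x\<in>M. x \<noteq> 0)"
  have "l = 0" if chain: "\<exists>C :: nat \<Rightarrow> 'a set. (\<forall>i\<le>l. prime_ideal (C i)) \<and> (\<forall>i<l. C i \<subset> C (Suc i))" for l
  proof (rule ccontr)
    assume "l \<noteq> 0"
    moreover obtain C :: "nat \<Rightarrow> 'a set" where "\<forall>i\<le>l. prime_ideal (C i)" "\<forall>i<l. C i \<subset> C (Suc i)"
      using chain by blast
    ultimately have "prime_ideal (C 0)" "prime_ideal (C 1)" "C 0 \<subset> C 1"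
      by auto
    then obtain C0 C1 :: "'a set" where C: "prime_ideal C0" "prime_ideal C1" "C0 \<subset> C1"
      by blast
    then have "C1 \<subseteq> M"
      by (intro proper_ideal_subset_max) (auto simp: prime_ideal_def)
    moreover have "0 \<in> C0"
      using C(1) is_idealD(2)[of UNIV C0] by (auto simp: prime_ideal_def)
    ultimately show False
      using n C(3) by auto
  qed
  then have "krull_dim TYPE('a) \<le> 0"
    unfolding krull_dim_def by (intro Sup_least) (auto simp: zero_enat_def)
  then show False
    using dim by simp
qed

text \<open>An ideal maximal among those that contain \<open>c\<close> and no power of
  \<open>x\<close> would be a nonzero prime, hence equal to \<open>M\<close>, which contains
  \<open>x\<close>.\<close>

lemma nonzero_dvd_power:
  assumes "c \<noteq> 0" "x \<in> M"
  shows "\<exists>k. c dvd x ^ k"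
proof (rule ccontr)
  assume n: "\<nexists>k. c dvd x ^ k"
  let ?bad = "\<lambda>I. c \<in> I \<and> (\<forall>k. x ^ k \<notin> I)"
  have "is_ideal UNIV {y. c dvd y}"
    by (rule is_ideal_UNIVI) auto
  then obtain P where P: "is_ideal UNIV P" "?bad P"
    "\<And>J'. is_ideal UNIV J' \<Longrightarrow> ?bad J' \<Longrightarrow> P \<subseteq> J' \<Longrightarrow> J' = P"
    using noetherian_maximal[OF noeth, of "{y. c dvd y}" ?bad] n by (metis dvd_refl mem_Collect_eq)
  have "prime_ideal P"
  proof (rule maximal_wrt_property_prime[of P ?bad])
    fix I J assume IJ: "P \<subseteq> I" "P \<subseteq> J" "\<not> ?bad I" "\<not> ?bad J"
      "\<And>a b. a \<in> I \<Longrightarrow> b \<in> J \<Longrightarrow> a * b \<in> P"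
    then obtain k l where "x ^ k \<in> I" "x ^ l \<in> J"
      using P(2) by blast
    then have "x ^ (k + l) \<in> P"
      using IJ(5) by (simp add: power_add)
    then show "\<not> ?bad P"
      by blast
  qed (use P in auto)
  then have "P = M"
    using nonzero_prime_eq_max assms(1) P(2) by blast
  then show False
    using P(2) assms(2) by (metis power_one_right)
qed

end
end

section \<open>Ring homomorphisms and univariate evaluation\<close>

lemma ring_hom_simps:
  assumes "ring_hom w"
  shows "w 0 = 0" "w 1 = 1" "w (x + y) = w x + w y" "w (x * y) = w x * w y"
    "w (- x) = - w x" "w (x - y) = w x - w y" "w (x ^ k) = w x ^ k" "w (of_nat j) = of_nat j"
    "w (sum f F) = (\<Sum>i\<in>F. w (f i))" "w (prod f F) = (\<Prod>i\<in>F. w (f i))"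
proof -
  show 1: "w 1 = 1" and 2: "w (x * y) = w x * w y" and 3: "w (x + y) = w x + w y" for x y
    using assms by (auto simp: ring_hom_def)
  have "w 0 + w 0 = w 0"
    using 3[of 0 0] by simp
  then show 4: "w 0 = 0"
    by simp
  have "w (- x) + w x = 0" for x
    using 3[of "- x" x] 4 by simp
  then show 5: "w (- x) = - w x" for x
    by (simp add: eq_neg_iff_add_eq_0)
  show "w (x - y) = w x - w y"
    using 3[of x "- y"] 5[of y] by simp
  show "w (x ^ k) = w x ^ k"
    by (induction k) (simp_all add: 1 2)
  show "w (of_nat j) = of_nat j"
    by (induction j) (simp_all add: 1 3 4)
  show "w (sum f F) = (\<Sum>i\<in>F. w (f i))"
    by (induction F rule: infinite_finite_induct) (simp_all add: 3 4)
  show "w (prod f F) = (\<Prod>i\<in>F. w (f i))"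
    by (induction F rule: infinite_finite_induct) (simp_all add: 1 2)
qed

lemma ring_hom_unit: "ring_hom w \<Longrightarrow> x dvd 1 \<Longrightarrow> w x dvd 1"
  by (metis dvdE dvdI ring_hom_simps(2,4))

definition peva :: "('a::comm_ring_1 \<Rightarrow> 'b::comm_ring_1) \<Rightarrow> 'b \<Rightarrow> 'a poly \<Rightarrow> 'b" where
  "peva w t P = poly (map_poly w P) t"

context
  fixes w :: "'a::comm_ring_1 \<Rightarrow> 'b::comm_ring_1"
  assumes w: "ring_hom w"
begin

lemma peva_0 [simp]: "peva w t 0 = 0"
  by (simp add: peva_def)

lemma peva_pCons [simp]: "peva w t (pCons a P) = w a + t * peva w t P"
  by (simp add: peva_def map_poly_pCons ring_hom_simps(1)[OF w])

lemma peva_1 [simp]: "peva w t 1 = 1"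
  using peva_pCons[of t 1 0] by (simp add: one_pCons ring_hom_simps[OF w])

lemma peva_add: "peva w t (P + Q) = peva w t P + peva w t Q"
  by (induction P Q rule: poly_induct2) (simp_all add: ring_hom_simps[OF w] algebra_simps)

lemma peva_smult: "peva w t (smult a P) = w a * peva w t P"
  by (induction P) (simp_all add: ring_hom_simps[OF w] algebra_simps)

lemma peva_mult: "peva w t (P * Q) = peva w t P * peva w t Q"
  by (induction P) (simp_all add: peva_add peva_smult ring_hom_simps[OF w] algebra_simps)

lemma peva_hom: "ring_hom (peva w t)"
  by (simp add: ring_hom_def peva_add peva_mult)

lemma peva_monom: "peva w t (monom a k) = w a * t ^ k"
  by (induction k) (simp_all add: monom_0 monom_Suc ring_hom_simps[OF w])

lemma hom_poly: "w (poly P x) = peva w (w x) P"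
  by (induction P) (simp_all add: ring_hom_simps[OF w])

lemma peva_altdef: "peva w t P = (\<Sum>i\<le>degree P. w (coeff P i) * t ^ i)"
proof -
  have "peva w t P = peva w t (\<Sum>i\<le>degree P. monom (coeff P i) i)"
    by (simp add: poly_as_sum_of_monoms)
  also have "\<dots> = (\<Sum>i\<le>degree P. w (coeff P i) * t ^ i)"
    by (simp add: ring_hom_simps(9)[OF peva_hom] peva_monom)
  finally show ?thesis .
qed

end

lemma peva_in_ideal:
  assumes w: "ring_hom w" and I: "is_ideal R I" and t: "t \<in> R" and R: "is_subring R"
    and P: "\<And>i. w (coeff P i) \<in> I"
  shows "peva w t P \<in> I"
  unfolding peva_altdef[OF w]
  by (intro is_ideal_sum[OF I] is_idealD(5)[OF I]) (auto intro: is_subring_power R t P)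

lemma poly_in_ideal:
  assumes I: "is_ideal R I" and t: "t \<in> R" and R: "is_subring R"
    and P: "\<And>i. coeff P i \<in> I"
  shows "poly P t \<in> I"
  using peva_in_ideal[of "\<lambda>x. x", OF _ I t R] P by (simp add: peva_def ring_hom_def)

section \<open>Polynomials with coefficients in a subring\<close>

text \<open>Coefficient rings are sets rather than types because the rings \<open>polys m\<close>
  for all \<open>m\<close> live inside one type.\<close>

definition PQ :: "'a::comm_ring_1 set \<Rightarrow> 'a poly set" where
  "PQ Q = {P. \<forall>i. coeff P i \<in> Q}"

lemma PQ_iff: "P \<in> PQ Q \<longleftrightarrow> (\<forall>i. coeff P i \<in> Q)"
  by (simp add: PQ_def)

lemma PQ_subring:
  assumes "is_subring Q"
  shows "is_subring (PQ Q)"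
  unfolding is_subring_def
proof (intro conjI ballI)
  show "1 \<in> PQ Q"
    using is_subringD(1,2)[OF assms] by (auto simp: PQ_iff coeff_1)
next
  fix P R assume "P \<in> PQ Q" "R \<in> PQ Q"
  then show "P * R \<in> PQ Q"
    by (auto simp: PQ_iff coeff_mult intro!: is_subring_sum[OF assms] is_subringD(5)[OF assms])
qed (auto simp: PQ_iff is_subringD[OF assms])

lemma PQ_pCons: "pCons a P \<in> PQ Q \<longleftrightarrow> a \<in> Q \<and> P \<in> PQ Q"
  by (auto simp: PQ_iff coeff_pCons split: nat.splits)

lemma PQ_0: "is_subring Q \<Longrightarrow> 0 \<in> PQ Q"
  by (simp add: PQ_iff is_subringD)

lemma PQ_smult: "is_subring Q \<Longrightarrow> a \<in> Q \<Longrightarrow> P \<in> PQ Q \<Longrightarrow> smult a P \<in> PQ Q"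
  by (simp add: PQ_iff is_subringD)

lemma PQ_monom: "is_subring Q \<Longrightarrow> a \<in> Q \<Longrightarrow> monom a k \<in> PQ Q"
  by (simp add: PQ_iff is_subringD)

lemma PQ_pderiv:
  fixes P :: "'a::idom poly"
  shows "is_subring Q \<Longrightarrow> P \<in> PQ Q \<Longrightarrow> pderiv P \<in> PQ Q"
  unfolding PQ_iff coeff_pderiv by (metis is_subringD(5) is_subring_of_nat)

lemma PQ_poly: "is_subring Q \<Longrightarrow> P \<in> PQ Q \<Longrightarrow> x \<in> Q \<Longrightarrow> poly P x \<in> Q"
  unfolding poly_altdef PQ_iff by (intro is_subring_sum) (auto intro: is_subringD is_subring_power)

lemma PQ_mono: "Q \<subseteq> Q' \<Longrightarrow> PQ Q \<subseteq> PQ Q'"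
  unfolding PQ_def by blast

text \<open>Top terms are cancelled after multiplication by the leading coefficient, which is never
  inverted; this keeps quotient and remainder over \<open>Q\<close>. The exponent \<open>N\<close>
  counts the cancellations.\<close>

lemma subring_pseudo_division:
  assumes Q: "is_subring Q" and F: "F \<in> PQ Q" "degree F > 0" and P: "P \<in> PQ Q"
  shows "\<exists>N. \<exists>q\<in>PQ Q. \<exists>r\<in>PQ Q. smult (lead_coeff F ^ N) P = F * q + r \<and> degree r < degree F"
  using P
proof (induction "degree P" arbitrary: P rule: less_induct)
  case less
  note R = is_subringD[OF PQ_subring[OF Q]]
  show ?case
  proof (cases "degree P < degree F")
    case True
    then show ?thesis
      using less.prems PQ_0[OF Q] by (intro exI[of _ 0] bexI[of _ 0] bexI[of _ P]) auto
  next
    case False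
    define m where "m = monom (lead_coeff P) (degree P - degree F)"
    define P1 where "P1 = smult (lead_coeff F) P - m * F"
    have m: "m \<in> PQ Q"
      using less.prems PQ_monom[OF Q] by (auto simp: m_def PQ_iff)
    have lF: "lead_coeff F \<in> Q"
      using F by (auto simp: PQ_iff)
    have P1: "P1 \<in> PQ Q"
      unfolding P1_def using m F(1) less.prems lF by (intro R PQ_smult[OF Q])
    have "degree P1 \<le> degree P"
    proof -
      have "degree (m * F) \<le> degree P"
        using degree_mult_le[of m F] degree_monom_le[of "lead_coeff P" "degree P - degree F"] False
        unfolding m_def by linarith
      then show ?thesis
        unfolding P1_def by (meson degree_diff_le degree_smult_le)
    qed
    moreover have "coeff P1 (degree P) = 0"
      using False by (simp add: P1_def m_def coeff_monom_mult)
    moreover have "degree P > 0"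
      using False F(2) by simp
    ultimately have "degree P1 < degree P"
      by (metis degree_0 le_neq_implies_less leading_coeff_0_iff)
    from less.hyps[OF this P1] obtain N q r where
      *: "q \<in> PQ Q" "r \<in> PQ Q" "smult (lead_coeff F ^ N) P1 = F * q + r" "degree r < degree F"
      by blast
    have "smult (lead_coeff F ^ Suc N) P = smult (lead_coeff F ^ N) (P1 + m * F)"
      by (simp add: P1_def mult.commute)
    also have "\<dots> = F * (q + smult (lead_coeff F ^ N) m) + r"
      by (simp add: smult_add_right *(3) algebra_simps)
    finally have eq: "smult (lead_coeff F ^ Suc N) P = F * (q + smult (lead_coeff F ^ N) m) + r" .
    have "q + smult (lead_coeff F ^ N) m \<in> PQ Q"
      using * m lF is_subring_power[OF Q] by (intro R PQ_smult[OF Q])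
    with eq * show ?thesis
      by blast
  qed
qed

text \<open>Minimality of the degree and characteristic zero force \<open>F'(t) \<noteq> 0\<close>.\<close>
lemma minimal_relation:
  fixes w :: "'a::idom \<Rightarrow> 'b::idom"
  assumes Q: "is_subring Q" and w: "ring_hom w" and char0: "\<forall>k>0. (of_nat k :: 'b) \<noteq> 0"
  obtains (trans) "\<And>P i. P \<in> PQ Q \<Longrightarrow> peva w t P = 0 \<Longrightarrow> w (coeff P i) = 0"
  | (alg) F where "F \<in> PQ Q" "peva w t F = 0" "w (lead_coeff F) \<noteq> 0" "peva w t (pderiv F) \<noteq> 0"
      "\<And>P. P \<in> PQ Q \<Longrightarrow> peva w t P = 0 \<Longrightarrow> \<exists>N. \<exists>q\<in>PQ Q. \<exists>r\<in>PQ Q.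
          smult (lead_coeff F ^ N) P = F * q + r \<and> (\<forall>i. w (coeff r i) = 0)"
proof (cases "\<exists>P\<in>PQ Q. peva w t P = 0 \<and> (\<exists>i. w (coeff P i) \<noteq> 0)")
  case False
  then show ?thesis
    using trans by blast
next
  case True
  \<comment> \<open>A coefficient killed by \<open>w\<close> counts as zero: the degree is minimised
    over relations whose image under \<open>w\<close> is nonzero.\<close>
  let ?A = "\<lambda>P. P \<in> PQ Q \<and> peva w t P = 0 \<and> (\<exists>i. w (coeff P i) \<noteq> 0)"
  note h = ring_hom_simps[OF w] and R = is_subringD[OF PQ_subring[OF Q]]
  obtain P0 where "?A P0"
    using True by blast
  then obtain F where F: "?A F" and minF: "\<And>P. ?A P \<Longrightarrow> degree F \<le> degree P"
    using ex_has_least_nat[of ?A P0 degree] by metis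
  have min: "w (coeff P i) = 0" if "P \<in> PQ Q" "peva w t P = 0" "degree P < degree F" for P i
    using that minF by (meson not_less)
  \<comment> \<open>Otherwise dropping the top term, which \<open>w\<close> kills, would give a
    relation with the same image and smaller degree.\<close>
  have lc: "w (lead_coeff F) \<noteq> 0"
  proof
    assume l0: "w (lead_coeff F) = 0"
    define G where "G = F - monom (lead_coeff F) (degree F)"
    have G: "G \<in> PQ Q"
      unfolding G_def using F by (intro R PQ_monom[OF Q]) (auto simp: PQ_iff)
    have wG: "w (coeff G i) = w (coeff F i)" for i
      using l0 by (auto simp: G_def h)
    have "peva w t G = 0"
      using F l0 by (simp add: G_def ring_hom_simps[OF peva_hom[OF w]] peva_monom[OF w])
    then have AG: "?A G"
      using G wG F by simp
    have "degree G \<le> degree F" "coeff G (degree F) = 0"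
      by (auto simp: G_def degree_diff_le degree_monom_le)
    moreover have "degree F \<le> degree G"
      using minF[OF AG] .
    ultimately have "lead_coeff G = 0"
      by simp
    then have "G = 0"
      by simp
    then show False
      using AG by (simp add: h)
  qed
  have deg: "degree F > 0"
  proof (rule ccontr)
    assume "\<not> degree F > 0"
    then have "peva w t F = w (lead_coeff F)"
      by (simp add: peva_altdef[OF w])
    then show False
      using F lc by simp
  qed
  have der: "peva w t (pderiv F) \<noteq> 0"
  proof
    assume z: "peva w t (pderiv F) = 0"
    have "degree (pderiv F) \<le> degree F - 1"
      using deg by (intro degree_le) (auto simp: coeff_pderiv intro!: coeff_eq_0)
    then have "degree (pderiv F) < degree F"
      using deg by linarith
    then have "w (coeff (pderiv F) (degree F - 1)) = 0"
      using min[OF PQ_pderiv[OF Q] z] F by blast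
    then have "of_nat (degree F) * w (lead_coeff F) = 0"
      using deg by (simp add: coeff_pderiv h)
    then show False
      using lc char0 deg by simp
  qed
  show ?thesis
  proof (rule alg[of F])
    fix P assume P: "P \<in> PQ Q" "peva w t P = 0"
    obtain N q r where *: "q \<in> PQ Q" "r \<in> PQ Q" "smult (lead_coeff F ^ N) P = F * q + r"
      "degree r < degree F"
      using subring_pseudo_division[OF Q _ deg P(1)] F by blast
    have "peva w t (F * q + r) = 0"
      unfolding *(3)[symmetric] using P by (simp add: peva_smult[OF w])
    then have "peva w t r = 0"
      using F by (simp add: peva_add[OF w] peva_mult[OF w])
    then have "\<forall>i. w (coeff r i) = 0"
      using min * by blast
    then show "\<exists>N. \<exists>q\<in>PQ Q. \<exists>r\<in>PQ Q.
          smult (lead_coeff F ^ N) P = F * q + r \<and> (\<forall>i. w (coeff r i) = 0)"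
      using * by blast
  qed (use F lc der in auto)
qed

section \<open>Multivariate polynomials\<close>

definition Var :: "nat \<Rightarrow> 'a::comm_ring_1 mpoly" where
  "Var i = Poly_Mapping.single (Poly_Mapping.single i 1) 1"

text \<open>Relations between elements of \<open>K'\<close> are taken over the field
  \<open>K\<close> and not over \<open>A\<close>, hence the restriction on the coefficients; with
  \<open>K = UNIV\<close> both settings share their lemmas.\<close>

definition kpolys :: "'a::comm_ring_1 set \<Rightarrow> nat \<Rightarrow> 'a mpoly set" where
  "kpolys K m = {p \<in> polys m. \<forall>mo. Poly_Mapping.lookup p mo \<in> K}"

lemma kpolys_UNIV: "kpolys UNIV m = polys m"
  by (simp add: kpolys_def)

lemma kpolys_subset: "kpolys K m \<subseteq> polys m"
  by (auto simp: kpolys_def)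

lemma mpoly_sum_monomials:
  assumes "finite A" "Poly_Mapping.keys p \<subseteq> A"
  shows "p = (\<Sum>mo\<in>A. Poly_Mapping.single mo (Poly_Mapping.lookup p mo))"
proof (rule poly_mapping_eqI)
  fix mo
  have "Poly_Mapping.lookup (\<Sum>mo\<in>A. Poly_Mapping.single mo (Poly_Mapping.lookup p mo)) mo =
      (\<Sum>x\<in>A. if x = mo then Poly_Mapping.lookup p mo else 0)"
    by (auto simp: lookup_sum lookup_single when_def intro!: sum.cong)
  also have "\<dots> = Poly_Mapping.lookup p mo"
    using assms by (auto simp: in_keys_iff)
  finally show "Poly_Mapping.lookup p mo =
      Poly_Mapping.lookup (\<Sum>mo\<in>A. Poly_Mapping.single mo (Poly_Mapping.lookup p mo)) mo"
    by simp
qed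

lemma mpoly_mult_sum:
  "p * q = (\<Sum>a\<in>Poly_Mapping.keys p. \<Sum>b\<in>Poly_Mapping.keys q.
     Poly_Mapping.single (a + b) (Poly_Mapping.lookup p a * Poly_Mapping.lookup q b))"
  for p q :: "'a::comm_ring_1 mpoly"
proof -
  have "p * q = (\<Sum>a\<in>Poly_Mapping.keys p. Poly_Mapping.single a (Poly_Mapping.lookup p a)) *
      (\<Sum>b\<in>Poly_Mapping.keys q. Poly_Mapping.single b (Poly_Mapping.lookup q b))"
    using mpoly_sum_monomials[of "Poly_Mapping.keys p" p] mpoly_sum_monomials[of "Poly_Mapping.keys q" q]
    by simp
  then show ?thesis
    by (simp add: sum_product mult_single)
qed

lemma Var_power: "Var i ^ k = Poly_Mapping.single (Poly_Mapping.single i k) 1"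
  by (induction k) (simp_all add: Var_def mult_single single_add[symmetric])

lemma monomial_eq_prod_Var:
  "Poly_Mapping.single mo a =
     const_poly a * (\<Prod>i\<in>Poly_Mapping.keys mo. Var i ^ Poly_Mapping.lookup mo i)"
proof -
  have "(\<Prod>i\<in>F. Poly_Mapping.single (f i) (1::'a)) = Poly_Mapping.single (sum f F) 1"
    for F :: "nat set" and f :: "nat \<Rightarrow> nat \<Rightarrow>\<^sub>0 nat"
    by (induction F rule: infinite_finite_induct) (simp_all add: mult_single)
  moreover have "(\<Sum>i\<in>Poly_Mapping.keys mo. Poly_Mapping.single i (Poly_Mapping.lookup mo i)) = mo"
  proof (rule poly_mapping_eqI)
    fix k
    have "Poly_Mapping.lookup (\<Sum>i\<in>Poly_Mapping.keys mo. Poly_Mapping.single i (Poly_Mapping.lookup mo i)) k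
        = (\<Sum>i\<in>Poly_Mapping.keys mo. if i = k then Poly_Mapping.lookup mo k else 0)"
      by (auto simp: lookup_sum lookup_single when_def intro!: sum.cong)
    also have "\<dots> = Poly_Mapping.lookup mo k"
      by (auto simp: in_keys_iff)
    finally show "Poly_Mapping.lookup (\<Sum>i\<in>Poly_Mapping.keys mo.
        Poly_Mapping.single i (Poly_Mapping.lookup mo i)) k = Poly_Mapping.lookup mo k" .
  qed
  ultimately have "(\<Prod>i\<in>Poly_Mapping.keys mo. Var i ^ Poly_Mapping.lookup mo i) = Poly_Mapping.single mo (1::'a)"
    unfolding Var_power by simp
  then show ?thesis
    by (simp add: const_poly_def mult_single)
qed

lemma const_poly_hom: "ring_hom const_poly"
  by (simp add: ring_hom_def const_poly_def single_add mult_single)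

context
  fixes K :: "'a::comm_ring_1 set"
  assumes K: "is_subring K"
begin

lemma single_in_kpolys:
  "Poly_Mapping.keys mo \<subseteq> {..<m} \<Longrightarrow> a \<in> K \<Longrightarrow> Poly_Mapping.single mo a \<in> kpolys K m"
  by (auto simp: kpolys_def polys_def lookup_single when_def is_subringD[OF K] split: if_splits)

lemma const_in_kpolys: "a \<in> K \<Longrightarrow> const_poly a \<in> kpolys K m"
  by (simp add: const_poly_def single_in_kpolys)

lemma Var_in_kpolys: "i < m \<Longrightarrow> Var i \<in> kpolys K m"
  unfolding Var_def by (intro single_in_kpolys) (auto simp: is_subringD[OF K])

lemma kpolys_add: "p \<in> kpolys K m \<Longrightarrow> q \<in> kpolys K m \<Longrightarrow> p + q \<in> kpolys K m"
  using Poly_Mapping.keys_add[of p q]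
  by (auto simp: kpolys_def polys_def lookup_add is_subringD[OF K] subset_iff)

lemma kpolys_sum: "(\<And>i. i \<in> F \<Longrightarrow> f i \<in> kpolys K m) \<Longrightarrow> sum f F \<in> kpolys K m"
proof (induction F rule: infinite_finite_induct)
  case (insert x F)
  then show ?case
    by (simp add: kpolys_add)
qed (auto simp: kpolys_def polys_def is_subringD[OF K])

lemma kpolys_mult:
  assumes "p \<in> kpolys K m" "q \<in> kpolys K m"
  shows "p * q \<in> kpolys K m"
proof -
  have "Poly_Mapping.keys (a + b) \<subseteq> {..<m}" if "a \<in> Poly_Mapping.keys p" "b \<in> Poly_Mapping.keys q" for a b
    using that assms Poly_Mapping.keys_add[of a b] by (auto simp: kpolys_def polys_def subset_iff)
  moreover have "Poly_Mapping.lookup p a \<in> K" "Poly_Mapping.lookup q a \<in> K" for a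
    using assms by (auto simp: kpolys_def)
  ultimately show ?thesis
    unfolding mpoly_mult_sum by (intro kpolys_sum single_in_kpolys is_subringD[OF K])
qed

lemma kpolys_subring: "is_subring (kpolys K m)"
proof -
  have c: "const_poly a \<in> kpolys K m" if "a \<in> K" for a
    using that by (rule const_in_kpolys)
  have "p - q \<in> kpolys K m" if "p \<in> kpolys K m" "q \<in> kpolys K m" for p q
  proof -
    have "p + const_poly (- 1) * q \<in> kpolys K m"
      using that by (intro kpolys_add kpolys_mult c) (auto simp: is_subringD[OF K])
    then show ?thesis
      by (simp add: ring_hom_simps[OF const_poly_hom])
  qed
  moreover have "0 \<in> kpolys K m" "1 \<in> kpolys K m"
    using c[of 0] c[of 1] by (auto simp: ring_hom_simps[OF const_poly_hom] is_subringD[OF K])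
  ultimately show ?thesis
    unfolding is_subring_def by (auto intro: kpolys_add kpolys_mult)
qed

text \<open>Differences are covered because \<open>const_poly (- 1)\<close> is one of the constants;
  thus the polynomials satisfying \<open>P\<close> form a subring, which contains all
  monomials.\<close>

lemma kpolys_induct [consumes 1, case_names const Var add mult]:
  assumes p: "p \<in> kpolys K m"
    and const: "\<And>c. c \<in> K \<Longrightarrow> P (const_poly c)"
    and Var: "\<And>i. i < m \<Longrightarrow> P (Var i)"
    and add: "\<And>p q. p \<in> kpolys K m \<Longrightarrow> q \<in> kpolys K m \<Longrightarrow> P p \<Longrightarrow> P q \<Longrightarrow> P (p + q)"
    and mult: "\<And>p q. p \<in> kpolys K m \<Longrightarrow> q \<in> kpolys K m \<Longrightarrow> P p \<Longrightarrow> P q \<Longrightarrow> P (p * q)"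
  shows "P p"
proof -
  let ?S = "{p \<in> kpolys K m. P p}"
  have c: "const_poly a \<in> ?S" if "a \<in> K" for a
    using that const const_in_kpolys by blast
  have "0 \<in> ?S" "1 \<in> ?S"
    using c[of 0] c[of 1] by (auto simp: ring_hom_simps[OF const_poly_hom] is_subringD[OF K])
  moreover have a: "p + q \<in> ?S" if "p \<in> ?S" "q \<in> ?S" for p q
    using that add kpolys_add by simp
  moreover have m: "p * q \<in> ?S" if "p \<in> ?S" "q \<in> ?S" for p q
    using that mult kpolys_mult by simp
  moreover have "p - q \<in> ?S" if "p \<in> ?S" "q \<in> ?S" for p q
  proof -
    have "p + const_poly (- 1) * q \<in> ?S"
      by (rule a[OF that(1) m[OF c that(2)]]) (intro is_subringD[OF K])
    then show ?thesis
      by (simp add: ring_hom_simps[OF const_poly_hom])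
  qed
  ultimately have S: "is_subring ?S"
    by (simp add: is_subring_def)
  have "Poly_Mapping.single mo (Poly_Mapping.lookup p mo) \<in> ?S" if "mo \<in> Poly_Mapping.keys p" for mo
  proof -
    have "Poly_Mapping.keys mo \<subseteq> {..<m}" "Poly_Mapping.lookup p mo \<in> K"
      using p that by (auto simp: kpolys_def polys_def)
    moreover have "Var i \<in> ?S" if "i < m" for i
      using that Var Var_in_kpolys by simp
    moreover have "Var i ^ k \<in> ?S" if "i < m" for i k
      by (rule is_subring_power[OF S]) (rule calculation(3)[OF that])
    ultimately have "(\<Prod>i\<in>Poly_Mapping.keys mo. Var i ^ Poly_Mapping.lookup mo i) \<in> ?S"
      by (intro is_subring_prod[OF S]) (meson lessThan_iff subsetD)
    then show ?thesis
      unfolding monomial_eq_prod_Var[of mo "Poly_Mapping.lookup p mo"]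
      by (rule is_subringD(5)[OF S c[OF \<open>Poly_Mapping.lookup p mo \<in> K\<close>]])
  qed
  then have "p \<in> ?S"
    by (subst mpoly_sum_monomials[OF finite_keys order_refl]) (rule is_subring_sum[OF S])
  then show ?thesis
    by simp
qed

text \<open>Makes the last variable the indeterminate of a univariate polynomial, so that
  pseudo-division, Taylor expansion and comparison of coefficients act on it.\<close>

lemma kpolys_Suc: "kpolys K (Suc m) = (\<lambda>P. poly P (Var m)) ` PQ (kpolys K m)"
proof
  note S = is_subringD[OF PQ_subring[OF kpolys_subring[of m]]]
  show "kpolys K (Suc m) \<subseteq> (\<lambda>P. poly P (Var m)) ` PQ (kpolys K m)"
  proof
    fix p assume "p \<in> kpolys K (Suc m)"
    then show "p \<in> (\<lambda>P. poly P (Var m)) ` PQ (kpolys K m)"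
    proof (induction rule: kpolys_induct)
      case (const c)
      then show ?case
        by (intro image_eqI[of _ _ "[:const_poly c:]"])
          (auto simp: PQ_pCons const_in_kpolys PQ_0[OF kpolys_subring])
    next
      case (Var i)
      then consider "i < m" | "i = m"
        by linarith
      then show ?case
      proof cases
        case 1
        then show ?thesis
          by (intro image_eqI[of _ _ "[:Var i:]"])
            (auto simp: PQ_pCons Var_in_kpolys PQ_0[OF kpolys_subring])
      next
        case 2
        then show ?thesis
          by (intro image_eqI[of _ _ "[:0, 1:]"])
            (auto simp: PQ_pCons PQ_0[OF kpolys_subring] is_subringD[OF kpolys_subring])
      qed
    next
      case (add p q)
      then show ?case
        by (auto simp flip: poly_add intro!: image_eqI S)
    next
      case (mult p q)
      then show ?case
        by (auto simp flip: poly_mult intro!: image_eqI S)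
    qed
  qed
  have le: "kpolys K m \<subseteq> kpolys K (Suc m)"
    unfolding kpolys_def polys_def by fastforce
  show "(\<lambda>P. poly P (Var m)) ` PQ (kpolys K m) \<subseteq> kpolys K (Suc m)"
    using PQ_mono[OF le] by (auto intro!: PQ_poly[OF kpolys_subring] Var_in_kpolys)
qed

end

lemma kpolys_mono: "m \<le> m' \<Longrightarrow> kpolys K m \<subseteq> kpolys K m'"
  unfolding kpolys_def polys_def by fastforce

lemma polys_mono: "m \<le> m' \<Longrightarrow> polys m \<subseteq> polys m'"
  unfolding polys_def by fastforce

lemmas polys_subring = kpolys_subring[OF is_subring_UNIV, unfolded kpolys_UNIV]
  and polys_Suc = kpolys_Suc[OF is_subring_UNIV, unfolded kpolys_UNIV]
  and const_in_polys [simp] = const_in_kpolys[OF is_subring_UNIV UNIV_I, unfolded kpolys_UNIV]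
  and Var_in_polys = Var_in_kpolys[OF is_subring_UNIV, unfolded kpolys_UNIV]
  and polys_induct [consumes 1, case_names const Var add mult] =
    kpolys_induct[OF is_subring_UNIV, unfolded kpolys_UNIV]

lemma polys_0: "p \<in> polys 0 \<Longrightarrow> \<exists>c. p = const_poly c"
proof (induction rule: polys_induct)
  case (add p q)
  then show ?case
    by (metis ring_hom_simps(3)[OF const_poly_hom])
next
  case (mult p q)
  then show ?case
    by (metis ring_hom_simps(4)[OF const_poly_hom])
qed auto

section \<open>Evaluation\<close>

lemma peval_superset:
  assumes "ring_hom phi" "finite A" "Poly_Mapping.keys p \<subseteq> A"
  shows "peval phi y p = (\<Sum>mo\<in>A. phi (Poly_Mapping.lookup p mo) *
    (\<Prod>i\<in>Poly_Mapping.keys mo. y i ^ Poly_Mapping.lookup mo i))"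
  unfolding peval_def using assms
  by (intro sum.mono_neutral_left) (auto simp: in_keys_iff ring_hom_simps(1))

lemma monomial_value_add:
  fixes y :: "nat \<Rightarrow> 'b::comm_ring_1"
  shows "(\<Prod>i\<in>Poly_Mapping.keys (a + b). y i ^ Poly_Mapping.lookup (a + b) i) =
    (\<Prod>i\<in>Poly_Mapping.keys a. y i ^ Poly_Mapping.lookup a i) *
    (\<Prod>i\<in>Poly_Mapping.keys b. y i ^ Poly_Mapping.lookup b i)"
proof -
  let ?A = "Poly_Mapping.keys a \<union> Poly_Mapping.keys b"
  have *: "(\<Prod>i\<in>Poly_Mapping.keys c. y i ^ Poly_Mapping.lookup c i) =
      (\<Prod>i\<in>?A. y i ^ Poly_Mapping.lookup c i)" if "Poly_Mapping.keys c \<subseteq> ?A" for c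
    using that by (intro prod.mono_neutral_left) (auto simp: in_keys_iff)
  show ?thesis
    using *[of "a + b"] *[of a] *[of b] Poly_Mapping.keys_add[of a b]
    by (simp add: lookup_add power_add prod.distrib)
qed

lemma peval_single:
  assumes "ring_hom phi"
  shows "peval phi y (Poly_Mapping.single mo a) =
    phi a * (\<Prod>i\<in>Poly_Mapping.keys mo. y i ^ Poly_Mapping.lookup mo i)"
  using peval_superset[OF assms, of "{mo}" "Poly_Mapping.single mo a" y] by simp

lemma peval_add:
  assumes "ring_hom phi"
  shows "peval phi y (p + q) = peval phi y p + peval phi y q"
  using peval_superset[OF assms, of "Poly_Mapping.keys p \<union> Poly_Mapping.keys q" _ y]
    Poly_Mapping.keys_add[of p q]
  by (simp add: lookup_add ring_hom_simps[OF assms] algebra_simps sum.distrib)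

lemma peval_hom:
  assumes "ring_hom phi"
  shows "ring_hom (peval phi y)"
proof -
  have sum: "peval phi y (sum f F) = (\<Sum>i\<in>F. peval phi y (f i))" for F :: "(nat \<Rightarrow>\<^sub>0 nat) set" and f
    by (induction F rule: infinite_finite_induct)
      (simp_all add: peval_add[OF assms], simp_all add: peval_def)
  have "peval phi y (p * q) = peval phi y p * peval phi y q" for p q
    unfolding mpoly_mult_sum sum peval_single[OF assms] monomial_value_add ring_hom_simps[OF assms]
    unfolding peval_def sum_product by (intro sum.cong refl) (simp add: ac_simps)
  moreover have "peval phi y 1 = 1"
    using peval_single[OF assms, of y 0 1] by (simp add: ring_hom_simps[OF assms])
  ultimately show ?thesis
    by (simp add: ring_hom_def peval_add[OF assms])
qed

lemma peval_const: "ring_hom phi \<Longrightarrow> peval phi y (const_poly a) = phi a"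
  by (simp add: const_poly_def peval_single)

lemma peval_Var: "ring_hom phi \<Longrightarrow> peval phi y (Var i) = y i"
  by (simp add: Var_def peval_single ring_hom_simps)

lemma peval_cong:
  assumes "p \<in> polys m" "\<And>i. i < m \<Longrightarrow> y i = y' i"
  shows "peval phi y p = peval phi y' p"
  using assms unfolding peval_def polys_def
  by (intro sum.cong refl arg_cong2[where f = "(*)"] prod.cong arg_cong2[where f = "(^)"]) auto

lemma hom_peval:
  assumes "ring_hom w" "ring_hom phi" "p \<in> polys m"
  shows "w (peval phi y p) = peval (\<lambda>c. w (phi c)) (\<lambda>i. w (y i)) p"
proof -
  have wp: "ring_hom (\<lambda>c. w (phi c))"
    using assms(1,2) by (auto simp: ring_hom_def)
  show ?thesis
    using assms(3)
    by (induction rule: polys_induct)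
      (simp_all add: peval_const[OF wp] peval_Var[OF wp] peval_const[OF assms(2)] peval_Var[OF assms(2)]
        ring_hom_simps[OF peval_hom[OF wp]] ring_hom_simps[OF peval_hom[OF assms(2)]]
        ring_hom_simps[OF assms(1)])
qed

lemma peval_peval:
  assumes "ring_hom phi" "p \<in> polys m"
  shows "peval phi y (peval const_poly g p) = peval phi (\<lambda>i. peval phi y (g i)) p"
  using hom_peval[OF peval_hom[OF assms(1)] const_poly_hom assms(2)] by (simp add: peval_const[OF assms(1)])

lemma peval_in_subring:
  assumes "is_subring R" "ring_hom phi" "p \<in> polys m" "\<And>c. phi c \<in> R" "\<And>i. i < m \<Longrightarrow> y i \<in> R"
  shows "peval phi y p \<in> R"
  using assms(3)
  by (induction rule: polys_induct)
    (simp_all add: assms(4,5) peval_const[OF assms(2)] peval_Var[OF assms(2)]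
      ring_hom_simps[OF peval_hom[OF assms(2)]] is_subringD[OF assms(1)])

lemma peval_diff_ideal:
  assumes R: "is_subring R" and I: "is_ideal R I" and phi: "ring_hom phi" "\<And>c. phi c \<in> R"
    and y: "\<And>i. i < m \<Longrightarrow> y i \<in> R" "\<And>i. i < m \<Longrightarrow> y' i \<in> R" "\<And>i. i < m \<Longrightarrow> y i - y' i \<in> I"
    and p: "p \<in> polys m"
  shows "peval phi y p - peval phi y' p \<in> I"
  using p
proof (induction rule: polys_induct)
  case (mult p q)
  note h = ring_hom_simps[OF peval_hom[OF phi(1)]]
  have "peval phi y p * (peval phi y q - peval phi y' q) + (peval phi y p - peval phi y' p) * peval phi y' q \<in> I"
    using mult peval_in_subring[OF R phi(1) _ phi(2), of _ m] y
    by (intro is_idealD(3,4,5)[OF I]) auto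
  then show ?case
    by (simp add: h algebra_simps)
next
  case (add p q)
  then have "(peval phi y p - peval phi y' p) + (peval phi y q - peval phi y' q) \<in> I"
    by (intro is_idealD(3)[OF I])
  then show ?case
    by (simp add: ring_hom_simps[OF peval_hom[OF phi(1)]] algebra_simps)
qed (use y in \<open>auto simp: peval_const[OF phi(1)] peval_Var[OF phi(1)] is_idealD(2)[OF I]\<close>)

text \<open>A left inverse of evaluation at \<open>Var m\<close>. It witnesses that
  \<open>Var m\<close> is an indeterminate over \<open>polys m\<close>, so that coefficients with
  respect to it are well defined.\<close>

definition unpoly :: "nat \<Rightarrow> 'a::comm_ring_1 mpoly \<Rightarrow> 'a mpoly poly" where
  "unpoly m = peval (\<lambda>c. [:const_poly c:]) (\<lambda>i. if i = m then [:0, 1:] else [:Var i:])"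

lemma unpoly_poly:
  assumes "P \<in> PQ (polys m)"
  shows "unpoly m (poly P (Var m)) = P"
proof -
  have hc: "ring_hom (\<lambda>c::'a. [:const_poly c:])"
    by (simp add: ring_hom_def ring_hom_simps[OF const_poly_hom] one_pCons)
  have h: "ring_hom (unpoly m :: 'a mpoly \<Rightarrow> _)"
    unfolding unpoly_def by (rule peval_hom[OF hc])
  have c: "unpoly m p = [:p:]" if "p \<in> polys m" for p :: "'a mpoly"
    using that
    by (induction rule: polys_induct)
      (simp_all add: ring_hom_simps[OF h], simp_all add: unpoly_def peval_const[OF hc] peval_Var[OF hc])
  have v: "unpoly m (Var m :: 'a mpoly) = [:0, 1:]"
    by (simp add: unpoly_def peval_Var[OF hc])
  show ?thesis
    using assms
  proof (induction P)
    case 0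
    then show ?case
      by (simp add: ring_hom_simps[OF h])
  next
    case (pCons a P)
    then show ?case
      by (simp add: ring_hom_simps[OF h] v c PQ_pCons)
  qed
qed

lemma poly_Var_inj:
  assumes "P \<in> PQ (polys m)" "Q \<in> PQ (polys m)" "poly P (Var m) = poly Q (Var m)"
  shows "P = Q"
  using assms unpoly_poly by metis

section \<open>Partial derivatives\<close>

lemma mpderiv_superset:
  assumes "finite A" "Poly_Mapping.keys p \<subseteq> A"
  shows "mpderiv k p = (\<Sum>mo\<in>A. Poly_Mapping.single (mo - Poly_Mapping.single k 1)
    (of_nat (Poly_Mapping.lookup mo k) * Poly_Mapping.lookup p mo))"
  unfolding mpderiv_def using assms
  by (intro sum.mono_neutral_left) (auto simp: in_keys_iff)

lemma mpderiv_single: "mpderiv k (Poly_Mapping.single mo a) =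
    Poly_Mapping.single (mo - Poly_Mapping.single k 1) (of_nat (Poly_Mapping.lookup mo k) * a)"
  using mpderiv_superset[of "{mo}" "Poly_Mapping.single mo a" k] by simp

lemma mpderiv_add: "mpderiv k (p + q) = mpderiv k p + mpderiv k q"
  using mpderiv_superset[of "Poly_Mapping.keys p \<union> Poly_Mapping.keys q" p k]
    mpderiv_superset[of "Poly_Mapping.keys p \<union> Poly_Mapping.keys q" q k]
    mpderiv_superset[of "Poly_Mapping.keys p \<union> Poly_Mapping.keys q" "p + q" k]
    Poly_Mapping.keys_add[of p q]
  by (simp add: lookup_add distrib_left sum.distrib single_add)

lemma mpderiv_sum: "mpderiv k (sum f F) = (\<Sum>i\<in>F. mpderiv k (f i))"
  by (induction F rule: infinite_finite_induct)
    (simp_all add: mpderiv_add, simp_all add: mpderiv_def)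

lemma mpderiv_single_mult:
  "Poly_Mapping.single (a + b - Poly_Mapping.single k 1)
     (of_nat (Poly_Mapping.lookup (a + b) k) * (c * d)) =
   mpderiv k (Poly_Mapping.single a c) * Poly_Mapping.single b d +
   Poly_Mapping.single a c * mpderiv k (Poly_Mapping.single b d)"
proof -
  have 1: "a - Poly_Mapping.single k 1 + b = a + b - Poly_Mapping.single k 1"
    if "Poly_Mapping.lookup a k > 0" for a b :: "nat \<Rightarrow>\<^sub>0 nat"
    using that by (intro poly_mapping_eqI) (auto simp: lookup_add lookup_minus lookup_single when_def)
  \<comment> \<open>If the exponent of \<open>k\<close> is zero, the truncated subtraction may give
    two different monomials, but then the coefficient is zero.\<close>
  have 2: "Poly_Mapping.single (a - Poly_Mapping.single k 1 + b) (of_nat (Poly_Mapping.lookup a k) * e) =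
      Poly_Mapping.single (a + b - Poly_Mapping.single k 1) (of_nat (Poly_Mapping.lookup a k) * e)"
    for a b and e :: 'a
    using 1[of a b] by (cases "Poly_Mapping.lookup a k = 0") auto
  show ?thesis
    using 2[of a b "c * d"] 2[of b a "c * d"]
    by (simp add: mpderiv_single mult_single lookup_add ac_simps distrib_right distrib_left single_add)
qed

lemma mpderiv_mult: "mpderiv k (p * q) = mpderiv k p * q + p * mpderiv k q"
proof -
  let ?s = "\<lambda>p a. Poly_Mapping.single a (Poly_Mapping.lookup p a)"
  have *: "p = (\<Sum>a\<in>Poly_Mapping.keys p. ?s p a)" for p :: "'a mpoly"
    by (rule mpoly_sum_monomials) auto
  have "mpderiv k (p * q) = (\<Sum>a\<in>Poly_Mapping.keys p. \<Sum>b\<in>Poly_Mapping.keys q.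
      mpderiv k (?s p a) * ?s q b + ?s p a * mpderiv k (?s q b))"
    unfolding mpoly_mult_sum mpderiv_sum mpderiv_single[of k "_ + _"] mpderiv_single_mult ..
  also have "\<dots> = mpderiv k (\<Sum>a\<in>Poly_Mapping.keys p. ?s p a) * (\<Sum>b\<in>Poly_Mapping.keys q. ?s q b)
     + (\<Sum>a\<in>Poly_Mapping.keys p. ?s p a) * mpderiv k (\<Sum>b\<in>Poly_Mapping.keys q. ?s q b)"
    by (simp add: sum.distrib sum_product mpderiv_sum)
  also have "\<dots> = mpderiv k p * q + p * mpderiv k q"
    by (simp add: *[symmetric])
  finally show ?thesis .
qed

lemma mpderiv_const: "mpderiv k (const_poly c) = 0"
  by (simp add: const_poly_def mpderiv_single)

lemma mpderiv_Var: "mpderiv k (Var i) = (if i = k then 1 else 0)"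
  by (auto simp: Var_def mpderiv_single lookup_single when_def single_one)

lemma mpderiv_polys_0:
  assumes "p \<in> polys m" "m \<le> k"
  shows "mpderiv k p = 0"
  using assms(1)
  by (induction rule: polys_induct)
    (use assms(2) in \<open>simp_all add: mpderiv_const mpderiv_add mpderiv_mult mpderiv_Var\<close>)

lemma mpderiv_in_polys:
  assumes "p \<in> polys m"
  shows "mpderiv k p \<in> polys m"
  using assms
  by (induction rule: polys_induct)
    (simp_all add: mpderiv_const mpderiv_add mpderiv_mult mpderiv_Var is_subringD[OF polys_subring])

lemma mpderiv_poly_Var:
  fixes P :: "'a::idom mpoly poly"
  assumes "P \<in> PQ (polys m)"
  shows "mpderiv m (poly P (Var m)) = poly (pderiv P) (Var m)"
  using assms
proof (induction P)
  case 0
  then show ?case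
    by (simp add: mpderiv_def)
next
  case (pCons a P)
  then have "a \<in> polys m" "P \<in> PQ (polys m)"
    by (simp_all add: PQ_pCons)
  then show ?case
    using pCons by (simp add: mpderiv_add mpderiv_mult mpderiv_Var mpderiv_polys_0[of a m] pderiv_pCons)
qed

section \<open>Towers of free variables and equations with invertible derivative\<close>

text \<open>A pair \<open>(c, f)\<close> in \<open>L\<close> is an equation \<open>f\<close> in the variables up to \<open>Var c\<close> that is
  of invertible derivative with respect to \<open>Var c\<close> at the point \<open>z\<close>; the variables that do not occur as a \<open>c\<close> are free.\<close>
definition tower :: "('a::idom \<Rightarrow> 'b::idom) \<Rightarrow> nat \<Rightarrow> (nat \<times> 'a mpoly) list \<Rightarrow> (nat \<Rightarrow> 'b) \<Rightarrow> bool" where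
  "tower u m L z \<longleftrightarrow> sorted_wrt (<) (map fst L) \<and> (\<forall>(c, f)\<in>set L. c < m \<and> f \<in> polys (Suc c) \<and>
     peval u z f = 0 \<and> peval u z (mpderiv c f) dvd 1)"

definition tower_ideal :: "nat \<Rightarrow> (nat \<times> 'a::idom mpoly) list \<Rightarrow> 'a mpoly set" where
  "tower_ideal m L = gen_ideal (polys m) (snd ` set L)"

definition nonzerodivisor_mod :: "'a::idom \<Rightarrow> nat \<Rightarrow> 'a mpoly set \<Rightarrow> bool" where
  "nonzerodivisor_mod d m J \<longleftrightarrow> (\<forall>x\<in>polys m. const_poly d * x \<in> J \<longrightarrow> x \<in> J)"

text \<open>The ideal \<open>J + (d)\<close>, written so that the cofactor of \<open>d\<close> can
  be extracted.\<close>

definition ideal_mod :: "'a::idom \<Rightarrow> nat \<Rightarrow> 'a mpoly set \<Rightarrow> 'a mpoly set" where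
  "ideal_mod d m J = {x \<in> polys m. \<exists>y\<in>polys m. x - const_poly d * y \<in> J}"

lemma tower_ideal_mono:
  assumes "m \<le> m'" "set L \<subseteq> set L'"
  shows "tower_ideal m L \<subseteq> tower_ideal m' L'"
  unfolding tower_ideal_def using assms by (intro gen_ideal_mono polys_mono) auto

text \<open>The polynomials in \<open>Var m\<close> with all coefficients in the small ideal already
  form an ideal that contains \<open>S\<close>; since coefficients are unique, nothing else is
  generated.\<close>

lemma free_extension_iff:
  fixes P :: "'a::comm_ring_1 mpoly poly"
  assumes S: "S \<subseteq> polys m" and P: "P \<in> PQ (polys m)"
  shows "poly P (Var m) \<in> gen_ideal (polys (Suc m)) S \<longleftrightarrow> (\<forall>i. coeff P i \<in> gen_ideal (polys m) S)"
proof
  note Q = polys_subring and R = PQ_subring[OF polys_subring]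
  have J: "is_ideal (polys m) (gen_ideal (polys m) S)"
    using gen_ideal_is_ideal[OF Q S] .
  let ?I = "(\<lambda>P. poly P (Var m)) ` {P \<in> PQ (polys m). \<forall>i. coeff P i \<in> gen_ideal (polys m) S}"
  have I: "is_ideal (polys (Suc m)) ?I"
    unfolding is_ideal_def
  proof (intro conjI ballI)
    show "?I \<subseteq> polys (Suc m)"
      unfolding polys_Suc by blast
    show "0 \<in> ?I"
      using PQ_0[OF Q] is_idealD(2)[OF J] by (intro image_eqI[of _ _ 0]) auto
  next
    fix x y assume "x \<in> ?I" "y \<in> ?I"
    then show "x + y \<in> ?I"
      using is_subringD(3)[OF R] is_idealD(3)[OF J] by (auto simp flip: poly_add intro!: image_eqI)
  next
    fix r x :: "'a mpoly" assume r: "r \<in> polys (Suc m)" and x: "x \<in> ?I"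
    obtain T where T: "T \<in> PQ (polys m)" "r = poly T (Var m)"
      using r unfolding polys_Suc by auto
    obtain X where X: "X \<in> PQ (polys m)" "\<And>i. coeff X i \<in> gen_ideal (polys m) S" "x = poly X (Var m)"
      using x by auto
    have "coeff (T * X) i \<in> gen_ideal (polys m) S" for i
      unfolding coeff_mult using T X by (intro is_ideal_sum[OF J] is_idealD(4)[OF J]) (auto simp: PQ_iff)
    then show "r * x \<in> ?I"
      using T X is_subringD(5)[OF R] by (intro image_eqI[of _ _ "T * X"]) auto
  qed
  have "S \<subseteq> ?I"
  proof
    fix s assume s: "s \<in> S"
    then have "coeff [:s:] i \<in> gen_ideal (polys m) S" for i
      using gen_ideal_mem[OF Q] is_idealD(2)[OF J] by (auto simp: coeff_pCons split: nat.splits)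
    then show "s \<in> ?I"
      using s S PQ_0[OF Q] by (intro image_eqI[of _ _ "[:s:]"]) (auto simp: PQ_pCons)
  qed
  with I have sub: "gen_ideal (polys (Suc m)) S \<subseteq> ?I"
    by (rule gen_ideal_least)
  assume "poly P (Var m) \<in> gen_ideal (polys (Suc m)) S"
  then obtain P' where "P' \<in> PQ (polys m)" "\<forall>i. coeff P' i \<in> gen_ideal (polys m) S"
    "poly P (Var m) = poly P' (Var m)"
    using sub by auto
  then show "\<forall>i. coeff P i \<in> gen_ideal (polys m) S"
    using poly_Var_inj[OF P] by metis
next
  have le: "polys m \<subseteq> (polys (Suc m) :: 'a mpoly set)"
    by (rule polys_mono) simp
  assume "\<forall>i. coeff P i \<in> gen_ideal (polys m) S"
  then have "coeff P i \<in> gen_ideal (polys (Suc m)) S" for i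
    using gen_ideal_mono[OF le order_refl] by blast
  then show "poly P (Var m) \<in> gen_ideal (polys (Suc m)) S"
    using S le
    by (intro poly_in_ideal[OF gen_ideal_is_ideal[OF polys_subring] _ polys_subring] Var_in_polys) auto
qed

section \<open>Regularity of \<open>d\<close> under free variables and new equations\<close>

lemma ideal_mod_is_ideal:
  assumes J: "is_ideal (polys m) J"
  shows "is_ideal (polys m) (ideal_mod d m J)"
  unfolding is_ideal_def
proof (intro conjI ballI)
  note R = is_subringD[OF polys_subring]
  show "0 \<in> ideal_mod d m J"
    unfolding ideal_mod_def using R(1) is_idealD(2)[OF J] by (auto intro!: bexI[of _ 0])
  fix x y assume "x \<in> ideal_mod d m J" "y \<in> ideal_mod d m J"
  then obtain a b where *: "x \<in> polys m" "y \<in> polys m" "a \<in> polys m" "b \<in> polys m"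
    "x - const_poly d * a \<in> J" "y - const_poly d * b \<in> J"
    by (auto simp: ideal_mod_def)
  have "x + y - const_poly d * (a + b) \<in> J"
    using is_idealD(3)[OF J *(5,6)] by (simp add: algebra_simps)
  then show "x + y \<in> ideal_mod d m J"
    using * R by (auto simp: ideal_mod_def intro!: bexI[of _ "a + b"])
next
  note R = is_subringD[OF polys_subring]
  fix r x :: "'a mpoly" assume "r \<in> polys m" "x \<in> ideal_mod d m J"
  then obtain a where *: "r \<in> polys m" "x \<in> polys m" "a \<in> polys m" "x - const_poly d * a \<in> J"
    by (auto simp: ideal_mod_def)
  have "r * x - const_poly d * (r * a) \<in> J"
    using is_idealD(4)[OF J *(1,4)] by (simp add: algebra_simps)
  then show "r * x \<in> ideal_mod d m J"
    using * R by (auto simp: ideal_mod_def intro!: bexI[of _ "r * a"])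
qed (auto simp: ideal_mod_def)

lemma ideal_mod_mult: "is_ideal (polys m) J \<Longrightarrow> y \<in> polys m \<Longrightarrow> const_poly d * y \<in> ideal_mod d m J"
  using is_subringD(5)[OF polys_subring const_in_polys] is_idealD(2)
  by (auto simp: ideal_mod_def intro!: bexI[of _ y])

lemma nonzerodivisor_mod_free:
  assumes S: "S \<subseteq> polys m" and d: "nonzerodivisor_mod d m (gen_ideal (polys m) S)"
  shows "nonzerodivisor_mod d (Suc m) (gen_ideal (polys (Suc m)) S)"
  unfolding nonzerodivisor_mod_def
proof (intro ballI impI)
  fix x assume x: "x \<in> polys (Suc m)" and dx: "const_poly d * x \<in> gen_ideal (polys (Suc m)) S"
  obtain X where X: "X \<in> PQ (polys m)" "x = poly X (Var m)"
    using x unfolding polys_Suc by auto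
  have "poly (smult (const_poly d) X) (Var m) \<in> gen_ideal (polys (Suc m)) S"
    using dx X by simp
  then have "\<forall>i. const_poly d * coeff X i \<in> gen_ideal (polys m) S"
    using free_extension_iff[OF S PQ_smult[OF polys_subring const_in_polys X(1)]] by simp
  then have "\<forall>i. coeff X i \<in> gen_ideal (polys m) S"
    using d X(1) by (auto simp: nonzerodivisor_mod_def PQ_iff)
  then show "x \<in> gen_ideal (polys (Suc m)) S"
    using free_extension_iff[OF S X(1)] X(2) by simp
qed

text \<open>Here \<open>cancel\<close> says that \<open>g\<close> is a nonzerodivisor modulo
  \<open>d\<close>. If \<open>d * X = C * g\<close> modulo the old ideal, then \<open>C * g\<close>
  vanishes modulo \<open>d\<close>, so \<open>C = d * C'\<close>, and regularity of \<open>d\<close>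
  on the old quotient gives \<open>X = C' * g\<close>. This is the exchange of two terms of a
  regular sequence.\<close>

lemma nonzerodivisor_mod_eq:
  assumes S: "S \<subseteq> polys m" and d: "nonzerodivisor_mod d m (gen_ideal (polys m) S)"
    and g: "g \<in> PQ (polys m)"
    and cancel: "\<And>C. C \<in> PQ (polys m) \<Longrightarrow>
        (\<And>i. coeff (C * g) i \<in> ideal_mod d m (gen_ideal (polys m) S)) \<Longrightarrow>
        (\<And>i. coeff C i \<in> ideal_mod d m (gen_ideal (polys m) S))"
  shows "nonzerodivisor_mod d (Suc m) (gen_ideal (polys (Suc m)) (insert (poly g (Var m)) S))"
  unfolding nonzerodivisor_mod_def
proof (intro ballI impI)
  let ?J = "gen_ideal (polys m) S"
  note R = is_subringD[OF PQ_subring[OF polys_subring]]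
  note J = gen_ideal_is_ideal[OF polys_subring S]
  have SS: "insert (poly g (Var m)) S \<subseteq> polys (Suc m)"
    using S polys_mono[of m "Suc m"] g by (auto simp: polys_Suc)
  fix x assume x: "x \<in> polys (Suc m)"
    and dx: "const_poly d * x \<in> gen_ideal (polys (Suc m)) (insert (poly g (Var m)) S)"
  obtain X where X: "X \<in> PQ (polys m)" "x = poly X (Var m)"
    using x unfolding polys_Suc by auto
  obtain C where C: "C \<in> PQ (polys m)"
    "const_poly d * x - poly C (Var m) * poly g (Var m) \<in> gen_ideal (polys (Suc m)) S"
    using dx gen_ideal_insert[OF polys_subring SS] unfolding polys_Suc by auto
  let ?D = "smult (const_poly d) X - C * g"
  have Cg: "C * g \<in> PQ (polys m)"
    using C g R by blast
  have DQ: "?D \<in> PQ (polys m)"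
    by (intro R Cg PQ_smult[OF polys_subring] X const_in_polys)
  have D: "coeff ?D i \<in> ?J" for i
    using free_extension_iff[OF S DQ] C(2) X(2) by simp
  have "coeff (C * g) i \<in> ideal_mod d m ?J" for i
    using is_ideal_neg[OF polys_subring J D, of i] X(1) Cg unfolding ideal_mod_def
    by (intro CollectI conjI bexI[of _ "coeff X i"]) (auto simp: PQ_iff)
  then have "\<And>i. coeff C i \<in> ideal_mod d m ?J"
    using cancel[OF C(1)] by blast
  then obtain y where y: "\<And>i. y i \<in> polys m" "\<And>i. coeff C i - const_poly d * y i \<in> ?J"
    unfolding ideal_mod_def by simp metis
  \<comment> \<open>The chosen cofactors \<open>y i\<close> need not vanish beyond the degree of
    \<open>C\<close>; cutting them off there yields a polynomial.\<close>
  define C' where "C' = (\<Sum>i\<le>degree C. monom (y i) i)"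
  have C': "C' \<in> PQ (polys m)"
    unfolding C'_def by (intro is_subring_sum[OF PQ_subring[OF polys_subring]] PQ_monom[OF polys_subring] y)
  have cC': "coeff C' i = (if i \<le> degree C then y i else 0)" for i
    by (simp add: C'_def coeff_sum)
  have CC': "coeff (C - smult (const_poly d) C') i \<in> ?J" for i
    using y(2)[of i] is_idealD(2)[OF J] by (auto simp: cC' coeff_eq_0)
  have "coeff ((C - smult (const_poly d) C') * g) i \<in> ?J" for i
    unfolding coeff_mult using CC' g by (intro is_ideal_sum[OF J] is_idealD(5)[OF J]) (auto simp: PQ_iff)
  then have "coeff (?D + (C - smult (const_poly d) C') * g) i \<in> ?J" for i
    using is_idealD(3)[OF J D, of _ i] by simp
  moreover have "?D + (C - smult (const_poly d) C') * g = smult (const_poly d) (X - C' * g)"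
    by (simp add: algebra_simps smult_diff_right)
  ultimately have "const_poly d * coeff (X - C' * g) i \<in> ?J" for i
    by (metis coeff_smult)
  moreover have XC: "X - C' * g \<in> PQ (polys m)"
    by (intro R X C' g)
  ultimately have "\<forall>i. coeff (X - C' * g) i \<in> ?J"
    using d by (auto simp: nonzerodivisor_mod_def PQ_iff)
  then have "x - poly C' (Var m) * poly g (Var m) \<in> gen_ideal (polys (Suc m)) S"
    using free_extension_iff[OF S XC] X(2) by simp
  then show "x \<in> gen_ideal (polys (Suc m)) (insert (poly g (Var m)) S)"
    using gen_ideal_insert[OF polys_subring SS] C' unfolding polys_Suc by blast
qed

text \<open>The constant term of the factor is the unit \<open>- 1\<close>, so the coefficients of
  \<open>C\<close> are recovered from the bottom upwards.\<close>

lemma cancel_inverse: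
  assumes I: "is_ideal (polys m) I" and h: "h \<in> polys m"
    and Cg: "\<And>i. coeff (C * [:- 1, h:]) i \<in> I"
  shows "coeff C i \<in> I"
proof (induction i)
  case 0
  show ?case
    using is_ideal_neg[OF polys_subring I Cg[of 0]] by simp
next
  case (Suc i)
  have "h * coeff C i - coeff (C * [:- 1, h:]) (Suc i) \<in> I"
    by (intro is_ideal_diff[OF polys_subring I] Cg is_idealD(4)[OF I h] Suc)
  then show ?case
    by simp
qed

text \<open>The factor is monic, so the coefficients of \<open>C\<close> are recovered from the top
  downwards, starting beyond the degree where they vanish.\<close>

lemma cancel_linear:
  assumes I: "is_ideal (polys m) I" and a: "a \<in> polys m"
    and Cg: "\<And>i. coeff (C * [:a, 1:]) i \<in> I"
  shows "coeff C i \<in> I"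
proof (cases "i \<le> Suc (degree C)")
  case True
  then show ?thesis
  proof (induction rule: inc_induct)
    case base
    show ?case
      using is_idealD(2)[OF I] by (simp add: coeff_eq_0)
  next
    case (step i)
    have "coeff (C * [:a, 1:]) (Suc i) - a * coeff C (Suc i) \<in> I"
      by (intro is_ideal_diff[OF polys_subring I] Cg is_idealD(4)[OF I a] step)
    then show ?case
      by simp
  qed
next
  case False
  then show ?thesis
    using is_idealD(2)[OF I] by (simp add: coeff_eq_0)
qed

section \<open>Building towers and inverting elements in them\<close>

context
  fixes u :: "'a::idom \<Rightarrow> 'b::idom"
  assumes u: "ring_hom u"
begin

lemma peval_upd [simp]: "x \<in> polys m \<Longrightarrow> peval u (z(m := t)) x = peval u z x"
  by (rule peval_cong) auto

lemma peval_poly_Var: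
  assumes P: "P \<in> PQ (polys m)"
  shows "peval u (z(m := t)) (poly P (Var m)) = peva (peval u z) t P"
proof -
  have "peval u (z(m := t)) (poly P (Var m)) = peva (peval u (z(m := t))) t P"
    by (simp add: hom_poly[OF peval_hom[OF u]] peval_Var[OF u])
  also have "\<dots> = peva (peval u z) t P"
    using P by (simp add: peva_altdef[OF peval_hom[OF u]] PQ_iff)
  finally show ?thesis .
qed

lemma tower_equations:
  assumes "tower u m L z"
  shows "snd ` set L \<subseteq> polys m"
proof
  fix f assume "f \<in> snd ` set L"
  then obtain c where "(c, f) \<in> set L"
    by force
  then have "Suc c \<le> m" "f \<in> polys (Suc c)"
    using assms by (auto simp: tower_def)
  then show "f \<in> polys m"
    using polys_mono by blast
qed

lemma tower_ideal_is_ideal: "tower u m L z \<Longrightarrow> is_ideal (polys m) (tower_ideal m L)"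
  unfolding tower_ideal_def by (rule gen_ideal_is_ideal[OF polys_subring tower_equations])

lemma tower_ideal_zero:
  assumes "tower u m L z" "x \<in> tower_ideal m L"
  shows "peval u z x = 0"
proof -
  have "is_ideal (polys m) {x \<in> polys m. peval u z x = 0}"
    by (auto simp: is_ideal_def ring_hom_simps[OF peval_hom[OF u]] is_subringD[OF polys_subring])
  moreover have "snd ` set L \<subseteq> {x \<in> polys m. peval u z x = 0}"
    using tower_equations[OF assms(1)] assms(1) by (auto simp: tower_def)
  ultimately show ?thesis
    using assms(2) gen_ideal_least unfolding tower_ideal_def by blast
qed

lemma tower_0: "tower u 0 [] z"
  by (simp add: tower_def)

lemma tower_upd:
  assumes "tower u m L z" "(c, f) \<in> set L"
  shows "c < m" "f \<in> polys (Suc c)" "peval u (z(m := t)) f = 0" "peval u (z(m := t)) (mpderiv c f) dvd 1"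
proof -
  show *: "c < m" "f \<in> polys (Suc c)"
    using assms by (auto simp: tower_def)
  have "f \<in> polys m"
    using * polys_mono[of "Suc c" m] by auto
  then show "peval u (z(m := t)) f = 0" "peval u (z(m := t)) (mpderiv c f) dvd 1"
    using assms mpderiv_in_polys[of f m c] by (auto simp: tower_def)
qed

lemma tower_free:
  assumes "tower u m L z"
  shows "tower u (Suc m) L (z(m := t))"
  unfolding tower_def
proof (intro conjI ballI)
  show "sorted_wrt (<) (map fst L)"
    using assms by (simp add: tower_def)
  fix cf assume "cf \<in> set L"
  then show "case cf of (c, f) \<Rightarrow> c < Suc m \<and> f \<in> polys (Suc c) \<and> peval u (z(m := t)) f = 0 \<and>
      peval u (z(m := t)) (mpderiv c f) dvd 1"
    using tower_upd[OF assms, of "fst cf" "snd cf"] by (auto simp: case_prod_unfold)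
qed

lemma tower_eq:
  assumes T: "tower u m L z" and g: "g \<in> PQ (polys m)" "peva (peval u z) t g = 0"
    "peva (peval u z) t (pderiv g) dvd 1"
  shows "tower u (Suc m) (L @ [(m, poly g (Var m))]) (z(m := t))"
  unfolding tower_def
proof (intro conjI ballI)
  show "sorted_wrt (<) (map fst (L @ [(m, poly g (Var m))]))"
    using T by (auto simp: tower_def sorted_wrt_append)
  fix cf assume cf: "cf \<in> set (L @ [(m, poly g (Var m))])"
  show "case cf of (c, f) \<Rightarrow> c < Suc m \<and> f \<in> polys (Suc c) \<and> peval u (z(m := t)) f = 0 \<and>
      peval u (z(m := t)) (mpderiv c f) dvd 1"
  proof (cases "cf \<in> set L")
    case True
    then show ?thesis
      using tower_upd[OF T, of "fst cf" "snd cf"] by (auto simp: case_prod_unfold)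
  next
    case False
    then show ?thesis
      using cf g PQ_pderiv[OF polys_subring g(1)]
      by (auto simp: mpderiv_poly_Var peval_poly_Var polys_Suc)
  qed
qed

lemma tower_ideal_snoc:
  assumes "tower u m L z" "g \<in> PQ (polys m)"
  shows "tower_ideal (Suc m) (L @ [(m, poly g (Var m))]) =
      gen_ideal (polys (Suc m)) (insert (poly g (Var m)) (snd ` set L))"
  by (simp add: tower_ideal_def)

lemma tower_inverse:
  assumes T: "tower u m L z" and h: "h \<in> polys m" "peval u z h * t = 1"
  shows "tower u (Suc m) (L @ [(m, poly [:- 1, h:] (Var m))]) (z(m := t))"
    "h * Var m - 1 \<in> tower_ideal (Suc m) (L @ [(m, poly [:- 1, h:] (Var m))])"
    "nonzerodivisor_mod d m (tower_ideal m L) \<Longrightarrow>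
      nonzerodivisor_mod d (Suc m) (tower_ideal (Suc m) (L @ [(m, poly [:- 1, h:] (Var m))]))"
proof -
  have g: "[:- 1, h:] \<in> PQ (polys m)"
    using h by (auto simp: PQ_pCons PQ_0[OF polys_subring] is_subringD[OF polys_subring])
  have "peval u z h dvd 1"
    using h(2) by (metis dvd_triv_left)
  then show "tower u (Suc m) (L @ [(m, poly [:- 1, h:] (Var m))]) (z(m := t))"
    using h(2)
    by (intro tower_eq[OF T g])
      (auto simp: peva_pCons[OF peval_hom[OF u]] peva_0[OF peval_hom[OF u]] pderiv_pCons
        ring_hom_simps[OF peval_hom[OF u]] mult.commute)
  show "h * Var m - 1 \<in> tower_ideal (Suc m) (L @ [(m, poly [:- 1, h:] (Var m))])"
    unfolding tower_ideal_def
    by (rule gen_ideal_mem[OF polys_subring]) (simp add: mult.commute)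
  assume d: "nonzerodivisor_mod d m (tower_ideal m L)"
  show "nonzerodivisor_mod d (Suc m) (tower_ideal (Suc m) (L @ [(m, poly [:- 1, h:] (Var m))]))"
    unfolding tower_ideal_snoc[OF T g]
    using d[unfolded tower_ideal_def] cancel_inverse[OF ideal_mod_is_ideal h(1)]
      gen_ideal_is_ideal[OF polys_subring tower_equations[OF T]]
    by (intro nonzerodivisor_mod_eq[OF tower_equations[OF T] _ g]) blast+
qed

text \<open>Modulo \<open>d\<close> the equation reads \<open>X + a = 0\<close>, so the new variable
  changes nothing there, and regularity of \<open>d\<close> only tests \<open>g\<close> modulo
  \<open>d\<close>. The terms in \<open>R\<close> may therefore have any degree.\<close>

lemma tower_linear:
  assumes T: "tower u m L z" and d: "nonzerodivisor_mod d m (tower_ideal m L)"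
    and a: "a \<in> polys m" and R: "R \<in> PQ (polys m)" and g: "g = [:a, 1:] + smult (const_poly d) R"
    and t: "peva (peval u z) t g = 0" "peva (peval u z) t (pderiv g) dvd 1"
  shows "tower u (Suc m) (L @ [(m, poly g (Var m))]) (z(m := t))"
    "nonzerodivisor_mod d (Suc m) (tower_ideal (Suc m) (L @ [(m, poly g (Var m))]))"
proof -
  note P = is_subringD[OF PQ_subring[OF polys_subring]]
  have gQ: "g \<in> PQ (polys m)"
    unfolding g using a R
    by (intro P PQ_smult[OF polys_subring]) (auto simp: PQ_pCons PQ_0[OF polys_subring] is_subringD[OF polys_subring])
  show "tower u (Suc m) (L @ [(m, poly g (Var m))]) (z(m := t))"
    by (rule tower_eq[OF T gQ t])
  let ?J = "gen_ideal (polys m) (snd ` set L)"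
  have J: "is_ideal (polys m) ?J"
    by (rule gen_ideal_is_ideal[OF polys_subring tower_equations[OF T]])
  note I = ideal_mod_is_ideal[OF J, of d]
  show "nonzerodivisor_mod d (Suc m) (tower_ideal (Suc m) (L @ [(m, poly g (Var m))]))"
    unfolding tower_ideal_snoc[OF T gQ]
  proof (rule nonzerodivisor_mod_eq[OF tower_equations[OF T] d[unfolded tower_ideal_def] gQ])
    fix C i assume C: "C \<in> PQ (polys m)" and Cg: "\<And>i. coeff (C * g) i \<in> ideal_mod d m ?J"
    have "coeff (C * [:a, 1:]) i \<in> ideal_mod d m ?J" for i
    proof -
      have "coeff (C * R) i \<in> polys m"
        using P(5)[OF C R] by (simp add: PQ_iff)
      then have "coeff (C * g) i - const_poly d * coeff (C * R) i \<in> ideal_mod d m ?J"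
        using Cg by (intro is_ideal_diff[OF polys_subring I] ideal_mod_mult[OF J])
      then show ?thesis
        by (simp add: g distrib_left)
    qed
    then show "coeff C i \<in> ideal_mod d m ?J"
      by (rule cancel_linear[OF I a])
  qed
qed

text \<open>One more variable inverts the product of the diagonal of the triangular Jacobian matrix.\<close>
lemma tower_standard_smooth:
  assumes T: "tower u m L z"
  obtains L' z' where "tower u (Suc m) L' z'" "standard_smooth (Suc m) (tower_ideal (Suc m) L')"
    "tower_ideal m L \<subseteq> tower_ideal (Suc m) L'" "\<And>i. i < m \<Longrightarrow> z' i = z i"
proof -
  define D :: "(nat \<times> 'a mpoly) list \<Rightarrow> 'a mpoly" where
    "D L = (\<Prod>(c, f)\<leftarrow>L. mpderiv c f)" for L
  note h = ring_hom_simps[OF peval_hom[OF u]]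
  have "mpderiv (fst cf) (snd cf) \<in> polys m \<and> peval u z (mpderiv (fst cf) (snd cf)) dvd 1"
    if "cf \<in> set L" for cf
    using tower_equations[OF T] that T by (auto simp: tower_def intro!: mpderiv_in_polys)
  then have "D L \<in> polys m \<and> peval u z (D L) dvd 1"
    unfolding D_def
    by (induction L) (auto simp: h is_subringD[OF polys_subring] case_prod_unfold)
  then obtain t where D: "D L \<in> polys m" "peval u z (D L) * t = 1"
    by (metis dvdE)
  define L' where "L' = L @ [(m, poly [:- 1, D L:] (Var m))]"
  define J where "J = tower_ideal (Suc m) L'"
  define r where "r = length L'"
  define f where "f i = snd (L' ! i)" for i
  define c where "c i = fst (L' ! i)" for i
  have T': "tower u (Suc m) L' (z(m := t))" and inv: "D L * Var m - 1 \<in> J"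
    unfolding L'_def J_def using tower_inverse[OF T D] by auto
  note R = is_subringD[OF polys_subring[of "Suc m"]]
  have DL: "D L \<in> polys (Suc m)" "Var m \<in> polys (Suc m)"
    using D(1) polys_mono[of m "Suc m"] Var_in_polys[of m "Suc m"] by auto
  have idJ: "is_ideal (polys (Suc m)) J"
    unfolding J_def by (rule tower_ideal_is_ideal[OF T'])
  have mem: "(c i, f i) \<in> set L'" if "i < r" for i
    using that by (simp add: c_def f_def r_def)
  have f': "f i \<in> polys (Suc (c i))" "c i < Suc m" if "i < r" for i
    using mem[OF that] T' by (auto simp: tower_def)
  have mono: "c i < c j" if "i < j" "j < r" for i j
    using T' that by (auto simp: tower_def c_def r_def sorted_wrt_iff_nth_less)
  have fimg: "f ` {..<r} = snd ` set L'"
    by (auto simp: f_def r_def set_conv_nth image_iff)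
  \<comment> \<open>Only the columns of the variables \<open>c j\<close> are used. As
    \<open>f i\<close> involves no variable beyond \<open>c i\<close> and \<open>c\<close>
    increases, the entries to the right of the diagonal vanish.\<close>
  define A where "A = mat r r (\<lambda>(i, j). mpderiv (c j) (f i))"
  have detA: "det A = D L'"
  proof -
    have "det A = prod_list (diag_mat A)"
    proof (rule det_lower_triangular)
      show "A \<in> carrier_mat r r"
        by (simp add: A_def)
      fix i j assume ij: "i < j" "j < r"
      then show "A $$ (i, j) = 0"
        using mpderiv_polys_0[OF f'(1), of i "c j"] mono[OF ij] by (simp add: A_def)
    qed
    also have "diag_mat A = map (\<lambda>(c, f). mpderiv c f) L'"
      by (rule nth_equalityI) (auto simp: diag_mat_def A_def c_def f_def r_def case_prod_unfold)
    finally show ?thesis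
      by (simp add: D_def)
  qed
  have "mpderiv m (poly [:- 1, D L:] (Var m)) = D L"
    using D(1) by (subst mpderiv_poly_Var)
      (auto simp: PQ_pCons PQ_0[OF polys_subring] is_subringD[OF polys_subring] pderiv_pCons)
  \<comment> \<open>The inverting equation contributes its own derivative \<open>D L\<close>, so the
    determinant is a square, and two factors \<open>Var m\<close> are needed to invert it.\<close>
  then have DL': "D L' = D L * D L"
    by (simp add: D_def L'_def)
  have "strict_mono_on {..<r} c"
    using mono by (auto simp: strict_mono_on_def)
  then have "det A \<in> jac_ideal (Suc m) r f"
    unfolding jac_ideal_def A_def using f'(2) by (intro gen_ideal_mem[OF polys_subring]) blast
  \<comment> \<open>The equations generate all of \<open>J\<close>, so the colon ideal is the unit
    ideal.\<close>
  moreover have "1 \<in> colon_ideal (Suc m) r f J"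
    unfolding colon_ideal_def fimg J_def tower_ideal_def using R(2) by auto
  ultimately have "Var m ^ 2 * (1 * det A) \<in>
      ideal_prod (polys (Suc m)) (colon_ideal (Suc m) r f J) (jac_ideal (Suc m) r f)"
    unfolding ideal_prod_def
    by (intro gen_ideal_mult_mem is_subring_power[OF polys_subring] DL(2)) blast
  moreover have "1 - Var m ^ 2 * (1 * det A) \<in> J"
  proof -
    have "(- 1 - D L * Var m) * (D L * Var m - 1) \<in> J"
      by (rule is_idealD(4)[OF idJ _ inv]) (intro R DL)
    then show ?thesis
      by (simp add: detA DL' algebra_simps power2_eq_square)
  qed
  moreover have "r \<le> Suc m"
  proof -
    have "distinct (map fst L')"
      using T' by (auto simp: tower_def strict_sorted_iff)
    moreover have "set (map fst L') \<subseteq> {..<Suc m}"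
      using T' by (auto simp: tower_def)
    ultimately show ?thesis
      unfolding r_def using card_mono[of "{..<Suc m}" "set (map fst L')"]
      by (metis card_lessThan distinct_card finite_lessThan length_map)
  qed
  moreover have "\<forall>i<r. f i \<in> J"
    unfolding J_def tower_ideal_def using gen_ideal_mem[OF polys_subring] fimg by blast
  ultimately have "standard_smooth (Suc m) J"
    unfolding standard_smooth_def using idJ by blast
  moreover have "tower_ideal m L \<subseteq> J"
    unfolding J_def by (rule tower_ideal_mono) (auto simp: L'_def)
  ultimately show thesis
    using that[OF T'] unfolding J_def by simp
qed

end

section \<open>Coefficient fields and flatness\<close>

locale flat_local_extension =
  fixes u :: "'a::idom \<Rightarrow> 'b::idom"
    and M :: "'a set" and M' :: "'b set"
    and K :: "'a set" and K' :: "'b set"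
  assumes hom: "ring_hom u" and flat: "flat_hom u"
    and noethA: "noetherian TYPE('a)" and noethA': "noetherian TYPE('b)"
    and localA: "local_ring_max M" and localA': "local_ring_max M'"
    and dimA: "krull_dim TYPE('a) = 1" and dimA': "krull_dim TYPE('b) = 1"
    and rat: "\<forall>k::nat. k > 0 \<longrightarrow> (of_nat k :: 'a) dvd 1"
    and gen: "gen_ideal UNIV (u ` M) = M'"
    and coefK: "coefficient_field K M" and coefK': "coefficient_field K' M'"
    and uK: "u ` K \<subseteq> K'"
begin

lemmas u_simps = ring_hom_simps[OF hom]
lemmas M_ideal = local_max_ideal[OF noethA localA]
lemmas M'_ideal = local_max_ideal[OF noethA' localA']
lemmas ev_hom = peval_hom[OF hom]
lemmas ev_simps = ring_hom_simps[OF peval_hom[OF hom]]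

lemma u_in_M': "a \<in> M \<Longrightarrow> u a \<in> M'"
  using gen_ideal_mem[OF is_subring_UNIV, of "u a" "u ` M"] gen by auto

text \<open>Flatness trivialises the relation \<open>u a * 1 = 0\<close>: the element
  \<open>1\<close> is a combination of images of elements annihilated by \<open>a\<close>, and in a
  domain these are zero if \<open>a\<close> is not.\<close>

lemma u_eq_0_iff: "u a = 0 \<longleftrightarrow> a = 0"
proof
  assume ua: "u a = 0"
  then have "(\<Sum>i<1::nat. u ((\<lambda>_. a) i) * (\<lambda>_. 1) i) = 0"
    by simp
  then obtain s b y where *: "\<forall>i<1::nat. (1::'b) = (\<Sum>j<s::nat. u (b i j) * y j)"
    "\<forall>j<s. (\<Sum>i<1::nat. a * b i j) = 0"
    using flat[unfolded flat_hom_def, rule_format, where r = 1 and a = "\<lambda>_. a" and x = "\<lambda>_. 1"] by blast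
  show "a = 0"
  proof (rule ccontr)
    assume "a \<noteq> 0"
    then have "b 0 j = 0" if "j < s" for j
      using *(2) that by simp
    then have "(\<Sum>j<s. u (b 0 j) * y j) = 0"
      by (intro sum.neutral) (auto simp: u_simps)
    then show False
      using *(1) by simp
  qed
qed (simp add: u_simps)

lemma char0: "\<forall>k>0. (of_nat k :: 'b) \<noteq> 0"
proof (intro allI impI)
  fix k :: nat assume "k > 0"
  then show "(of_nat k :: 'b) \<noteq> 0"
    using ring_hom_unit[OF hom rat[rule_format, of k]] by (auto simp: u_simps)
qed

section \<open>Linear independence over the coefficient field and divisibility\<close>

lemma K_subring: "is_subring K" and K'_subring: "is_subring K'"
  using coefK coefK' by (auto simp: coefficient_field_def is_subring_def)

lemma K'_inverse: "x \<in> K' \<Longrightarrow> x \<noteq> 0 \<Longrightarrow> \<exists>y\<in>K'. x * y = 1"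
  and K_inverse: "c \<in> K \<Longrightarrow> c \<noteq> 0 \<Longrightarrow> \<exists>k\<in>K. c * k = 1"
  using coefK coefK' by (auto simp: coefficient_field_def)

lemma K'_M': "x \<in> K' \<Longrightarrow> x \<in> M' \<Longrightarrow> x = 0"
  using K'_inverse[of x] is_idealD(5)[OF M'_ideal UNIV_I] local_one_notin[OF noethA' localA'] by metis

lemma ex_residue: "\<exists>k\<in>K. a - k \<in> M" and ex_residue': "\<exists>k\<in>K'. b - k \<in> M'"
  using coefK coefK' by (auto simp: coefficient_field_def)

text \<open>The equational criterion makes some coefficient of the last element \<open>x r\<close> invertible, so that
  \<open>a r\<close> can be eliminated.\<close>
lemma residually_independent_dvd:
  assumes "\<And>c. (\<Sum>i<r. u (c i) * x i) \<in> M' \<Longrightarrow> \<forall>i<r. c i \<in> M"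
    and "(\<Sum>i<r. u (a i) * x i) = u D * w"
  shows "\<forall>i<r::nat. D dvd a i"
  using assms
proof (induction r arbitrary: x w)
  case (Suc r)
  \<comment> \<open>Adjoining \<open>w\<close> with coefficient \<open>- D\<close> turns the
    hypothesis into a linear relation, to which the equational criterion applies.\<close>
  let ?a = "\<lambda>i. if i < Suc r then a i else - D" and ?x = "\<lambda>i. if i < Suc r then x i else w"
  have "(\<Sum>i<Suc (Suc r). u (?a i) * ?x i) = 0"
    using Suc.prems(2) by (simp add: u_simps)
  then obtain s b y where b: "\<forall>i<Suc (Suc r). ?x i = (\<Sum>j<s::nat. u (b i j) * y j)"
    "\<forall>j<s. (\<Sum>i<Suc (Suc r). ?a i * b i j) = 0"
    using flat[unfolded flat_hom_def, rule_format, where r = "Suc (Suc r)" and a = ?a and x = ?x] by blast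
  have xr: "x r = (\<Sum>j<s. u (b r j) * y j)"
    using b(1)[rule_format, of r] by simp
  have "x r \<notin> M'"
  proof
    assume "x r \<in> M'"
    then have "(\<Sum>i<Suc r. u ((\<lambda>i. if i = r then 1 else 0) i) * x i) \<in> M'"
      by (simp add: u_simps)
    then have "1 \<in> M"
      using Suc.prems(1)[of "\<lambda>i. if i = r then 1 else 0"] by auto
    then show False
      using local_one_notin[OF noethA localA] by simp
  qed
  moreover have "x r \<in> M'" if "\<And>j. j < s \<Longrightarrow> b r j \<in> M"
    unfolding xr by (intro is_ideal_sum[OF M'_ideal] is_idealD(5)[OF M'_ideal UNIV_I] u_in_M' that) simp
  ultimately obtain j where j: "j < s" "b r j \<notin> M"
    by blast
  then obtain \<gamma> where \<gamma>: "1 = b r j * \<gamma>"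
    using notin_max_unit[OF noethA localA] by (metis dvdE)
  define S where "S = (\<Sum>i<r. a i * b i j)"
  have "S + a r * b r j = D * b (Suc r) j"
    using b(2)[rule_format, OF j(1)] by (simp add: S_def)
  then have "(S + a r * b r j) * \<gamma> = D * b (Suc r) j * \<gamma>"
    by simp
  moreover have "(S + a r * b r j) * \<gamma> = S * \<gamma> + a r * (b r j * \<gamma>)"
    by (simp add: algebra_simps)
  ultimately have "S * \<gamma> + a r = D * b (Suc r) j * \<gamma>"
    by (simp add: \<gamma>[symmetric])
  then have ar: "a r = D * (b (Suc r) j * \<gamma>) - S * \<gamma>"
    by (simp add: algebra_simps)
  \<comment> \<open>Substituting the expression for \<open>a r\<close> changes the remaining
    elements by multiples of \<open>x r\<close>. A residual relation between the new elements is one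
    between all the old ones, so independence is inherited.\<close>
  define x2 where "x2 i = x i - u (b i j * \<gamma>) * x r" for i
  have sumx2: "(\<Sum>i<r. u (c i) * x2 i) = (\<Sum>i<r. u (c i) * x i) - u ((\<Sum>i<r. c i * b i j) * \<gamma>) * x r" for c
    by (simp add: x2_def right_diff_distrib sum_subtractf u_simps sum_distrib_left sum_distrib_right mult.assoc)
  have "\<forall>i<r. D dvd a i"
  proof (rule Suc.IH)
    fix c assume c: "(\<Sum>i<r. u (c i) * x2 i) \<in> M'"
    define c' where "c' i = (if i < r then c i else - ((\<Sum>i<r. c i * b i j) * \<gamma>))" for i
    have "(\<Sum>i<Suc r. u (c' i) * x i) = (\<Sum>i<r. u (c i) * x2 i)"
      unfolding sumx2 by (simp add: c'_def u_simps)
    then have "\<forall>i<Suc r. c' i \<in> M"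
      using Suc.prems(1)[of c'] c by simp
    then show "\<forall>i<r. c i \<in> M"
      by (metis c'_def less_SucI)
  next
    have "(\<Sum>i<r. u (a i) * x2 i) = u D * w - u (a r) * x r - u (S * \<gamma>) * x r"
      unfolding sumx2 S_def using Suc.prems(2) by (simp add: algebra_simps)
    also have "\<dots> = u D * (w - u (b (Suc r) j * \<gamma>) * x r)"
      unfolding ar by (simp add: u_simps algebra_simps)
    finally show "(\<Sum>i<r. u (a i) * x2 i) = u D * (w - u (b (Suc r) j * \<gamma>) * x r)" .
  qed
  moreover from this have "D dvd S"
    unfolding S_def by (intro dvd_sum) auto
  then have "D dvd a r"
    unfolding ar by (intro dvd_diff) auto
  ultimately show ?case
    by (auto simp: less_Suc_eq)
qed simp

text \<open>Independence over \<open>K\<close> inside \<open>K'\<close> amounts to independence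
  modulo \<open>M'\<close>: coefficients may be replaced by their residues in \<open>K\<close>, and
  the resulting sum lies both in \<open>K'\<close> and in \<open>M'\<close>, hence is zero.\<close>

lemma K_independent_dvd:
  assumes S: "finite S" and x: "\<And>i. i \<in> S \<Longrightarrow> x i \<in> K'"
    and indep: "\<And>c. (\<And>i. i \<in> S \<Longrightarrow> c i \<in> K) \<Longrightarrow> (\<Sum>i\<in>S. u (c i) * x i) = 0 \<Longrightarrow> \<forall>i\<in>S. c i = 0"
    and sum: "(\<Sum>i\<in>S. u (a i) * x i) = u D * w"
  shows "\<forall>i\<in>S. D dvd a i"
proof -
  obtain h where h: "bij_betw h {..<card S} S"
    using ex_bij_betw_nat_finite[OF S] by (auto simp: atLeast0LessThan)
  then have hS: "h i \<in> S" if "i < card S" for i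
    using that by (auto simp: bij_betw_def)
  have re: "(\<Sum>i<card S. f (h i)) = sum f S" for f :: "_ \<Rightarrow> 'b"
    by (rule sum.reindex_bij_betw[OF h])
  have "\<forall>i<card S. D dvd a (h i)"
  proof (rule residually_independent_dvd[where x = "\<lambda>i. x (h i)"])
    show "(\<Sum>i<card S. u (a (h i)) * x (h i)) = u D * w"
      using re[of "\<lambda>i. u (a i) * x i"] sum by simp
    fix c assume c: "(\<Sum>i<card S. u (c i) * x (h i)) \<in> M'"
    have "\<forall>i. \<exists>k. k \<in> K \<and> c i - k \<in> M"
      using ex_residue by blast
    then obtain k where k: "\<And>i. k i \<in> K" "\<And>i. c i - k i \<in> M"
      by metis
    have "(\<Sum>i<card S. u (c i) * x (h i)) - (\<Sum>i<card S. u (c i - k i) * x (h i)) \<in> M'"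
      by (intro is_ideal_diff[OF is_subring_UNIV M'_ideal] c is_ideal_sum[OF M'_ideal]
          is_idealD(5)[OF M'_ideal UNIV_I] u_in_M' k(2))
    moreover have "(\<Sum>i<card S. u (c i) * x (h i)) - (\<Sum>i<card S. u (c i - k i) * x (h i)) =
        (\<Sum>i<card S. u (k i) * x (h i))"
      by (simp add: u_simps sum_subtractf[symmetric] algebra_simps)
    moreover have "(\<Sum>i<card S. u (k i) * x (h i)) \<in> K'"
      using k(1) uK x hS by (intro is_subring_sum[OF K'_subring] is_subringD[OF K'_subring]) auto
    ultimately have z: "(\<Sum>i<card S. u (k i) * x (h i)) = 0"
      using K'_M' by metis
    define k' where "k' s = k (inv_into {..<card S} h s)" for s
    have kk': "k' (h i) = k i" if "i < card S" for i
      using that h by (simp add: k'_def bij_betw_def inv_into_f_f)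
    have "(\<Sum>i\<in>S. u (k' i) * x i) = 0"
    proof -
      have "(\<Sum>i<card S. u (k' (h i)) * x (h i)) = (\<Sum>i<card S. u (k i) * x (h i))"
        by (intro sum.cong) (auto simp: kk')
      then show ?thesis
        using z re[of "\<lambda>i. u (k' i) * x i"] by simp
    qed
    then have "\<forall>i\<in>S. k' i = 0"
      using indep[of k'] k(1) by (simp add: k'_def)
    then show "\<forall>i<card S. c i \<in> M"
      using k(2) kk' hS by (metis diff_zero)
  qed
  moreover have "h ` {..<card S} = S"
    using h by (simp add: bij_betw_def)
  ultimately show ?thesis
    by (metis imageE lessThan_iff)
qed

text \<open>This is injectivity of the tower modulo \<open>D\<close>. An element is a combination of
  polynomials over \<open>K\<close> with coefficients in \<open>A\<close>; the number of summands is
  reduced until their values are independent over \<open>K\<close>, and then \<open>D\<close>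
  divides every coefficient. For \<open>D = 0\<close> it says that \<open>J\<close> contains every
  element of \<open>polys m\<close> vanishing at \<open>z\<close>.\<close>

lemma reduce_mod:
  assumes J: "is_ideal (polys m) J" "\<And>x. x \<in> J \<Longrightarrow> peval u z x = 0"
    and ker: "\<And>p. p \<in> kpolys K m \<Longrightarrow> peval u z p = 0 \<Longrightarrow> p \<in> J"
    and val: "\<And>p. p \<in> kpolys K m \<Longrightarrow> peval u z p \<in> K'"
    and x: "x \<in> polys m" "peval u z x = u D * w"
  shows "x \<in> ideal_mod D m J"
proof -
  note R = is_subringD[OF polys_subring]
  have main: "x \<in> ideal_mod D m J"
    if "finite S" "\<And>i. i \<in> S \<Longrightarrow> k i \<in> kpolys K m" "x - (\<Sum>i\<in>S. const_poly (a i) * k i) \<in> J"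
    for S :: "(nat \<Rightarrow>\<^sub>0 nat) set" and a k
    using that
  proof (induction "card S" arbitrary: S a rule: less_induct)
    case less
    have ev0: "peval u z (\<Sum>i\<in>S. const_poly (c i) * k i) = (\<Sum>i\<in>S. u (c i) * peval u z (k i))" for c
      by (simp add: ev_simps peval_const[OF hom])
    show ?case
    proof (cases "\<forall>c. (\<forall>i\<in>S. c i \<in> K) \<and> (\<Sum>i\<in>S. u (c i) * peval u z (k i)) = 0 \<longrightarrow> (\<forall>i\<in>S. c i = 0)")
      case True
      have "(\<Sum>i\<in>S. u (a i) * peval u z (k i)) = u D * w"
        using J(2)[OF less.prems(3)] x(2) ev0[of a] by (simp add: ev_simps)
      then have "\<forall>i\<in>S. D dvd a i"
        using True less.prems(1,2) val by (intro K_independent_dvd[where x = "\<lambda>i. peval u z (k i)"]) auto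
      then obtain b where b: "\<And>i. i \<in> S \<Longrightarrow> a i = D * b i"
        unfolding dvd_def by metis
      have "(\<Sum>i\<in>S. const_poly (a i) * k i) = const_poly D * (\<Sum>i\<in>S. const_poly (b i) * k i)"
        unfolding sum_distrib_left
        by (intro sum.cong) (auto simp: b ring_hom_simps[OF const_poly_hom] mult.assoc)
      moreover have "(\<Sum>i\<in>S. const_poly (b i) * k i) \<in> polys m"
        using less.prems(2) kpolys_subset by (intro is_subring_sum[OF polys_subring] R) auto
      ultimately show ?thesis
        using less.prems(3) x(1) unfolding ideal_mod_def by auto
    next
      case False
      then obtain c i0 where c: "\<And>i. i \<in> S \<Longrightarrow> c i \<in> K" "(\<Sum>i\<in>S. u (c i) * peval u z (k i)) = 0"
        "i0 \<in> S" "c i0 \<noteq> 0"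
        by blast
      then obtain e where e: "c i0 * e = 1"
        using K_inverse by blast
      have "(\<Sum>i\<in>S. const_poly (c i) * k i) \<in> kpolys K m"
        using c less.prems(2) by (intro is_subring_sum[OF kpolys_subring[OF K_subring]]
            is_subringD[OF kpolys_subring[OF K_subring]] const_in_kpolys[OF K_subring]) auto
      then have cJ: "(\<Sum>i\<in>S. const_poly (c i) * k i) \<in> J"
        using ker ev0 c(2) by simp
      \<comment> \<open>A dependence between the values is a polynomial over \<open>K\<close> that
        vanishes at \<open>z\<close>, so it lies in \<open>J\<close> by \<open>ker\<close>; a
        suitable multiple of it removes the summand \<open>i0\<close>.\<close>
      define a' where "a' i = a i - a i0 * e * c i" for i
      have "a' i0 = 0"
        using e by (simp add: a'_def mult.assoc mult.commute[of e])
      then have "(\<Sum>i\<in>S - {i0}. const_poly (a' i) * k i) = (\<Sum>i\<in>S. const_poly (a' i) * k i)"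
        using less.prems(1) c(3) by (simp add: sum.remove[of S i0] ring_hom_simps[OF const_poly_hom])
      also have "\<dots> = (\<Sum>i\<in>S. const_poly (a i) * k i) -
          const_poly (a i0 * e) * (\<Sum>i\<in>S. const_poly (c i) * k i)"
        by (simp add: a'_def ring_hom_simps[OF const_poly_hom] left_diff_distrib sum_subtractf
            sum_distrib_left mult.assoc)
      finally have eq: "x - (\<Sum>i\<in>S - {i0}. const_poly (a' i) * k i) =
          (x - (\<Sum>i\<in>S. const_poly (a i) * k i)) + const_poly (a i0 * e) * (\<Sum>i\<in>S. const_poly (c i) * k i)"
        by simp
      have "x - (\<Sum>i\<in>S - {i0}. const_poly (a' i) * k i) \<in> J"
        unfolding eq by (intro is_idealD(3,4)[OF J(1)] less.prems(3) cJ const_in_polys)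
      moreover have "card (S - {i0}) < card S"
        using less.prems(1) c(3) by (rule card_Diff1_less)
      ultimately show ?thesis
        using less.hyps[of "S - {i0}" a'] less.prems(1,2) by simp
    qed
  qed
  have "x = (\<Sum>mo\<in>Poly_Mapping.keys x. const_poly (Poly_Mapping.lookup x mo) * Poly_Mapping.single mo 1)"
    using mpoly_sum_monomials[OF finite_keys order_refl, of x] by (simp add: const_poly_def mult_single)
  moreover have "Poly_Mapping.single mo 1 \<in> kpolys K m" if "mo \<in> Poly_Mapping.keys x" for mo
    using x(1) that by (intro single_in_kpolys[OF K_subring]) (auto simp: polys_def is_subringD[OF K_subring])
  ultimately show ?thesis
    using is_idealD(2)[OF J(1)]
    by (intro main[OF finite_keys[of x], of "\<lambda>mo. Poly_Mapping.single mo 1" "Poly_Mapping.lookup x"]) simp_all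
qed

section \<open>Towers that reach prescribed elements of \<open>K'\<close>\<close>

lemma inverse_cancel:
  assumes R: "is_subring R" and J: "is_ideal R J" and hV: "h \<in> R" "V \<in> R" "h * V - 1 \<in> J"
  shows "(h * V) ^ k - 1 \<in> J" and "x \<in> R \<Longrightarrow> h ^ k * x \<in> J \<Longrightarrow> x \<in> J"
proof -
  show *: "(h * V) ^ k - 1 \<in> J"
  proof (induction k)
    case 0
    then show ?case
      using is_idealD(2)[OF J] by simp
  next
    case (Suc k)
    have "(h * V) * ((h * V) ^ k - 1) + (h * V - 1) \<in> J"
      using hV by (intro is_idealD(3,4)[OF J] Suc is_subringD[OF R]) auto
    then show ?case
      by (simp add: algebra_simps)
  qed
  assume x: "x \<in> R" "h ^ k * x \<in> J"
  have "V ^ k * (h ^ k * x) - ((h * V) ^ k - 1) * x \<in> J"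
    by (rule is_ideal_diff[OF R J is_idealD(4)[OF J is_subring_power[OF R hV(2)] x(2)]
          is_idealD(5)[OF J x(1) *]])
  then show "x \<in> J"
    by (simp add: algebra_simps power_mult_distrib)
qed

lemma ev_in_K':
  assumes "p \<in> kpolys K m" "\<And>i. i < m \<Longrightarrow> z i \<in> K'"
  shows "peval u z p \<in> K'"
  using assms(1)
  by (induction rule: kpolys_induct[OF K_subring, consumes 1, case_names const Var add mult])
    (use assms(2) uK in \<open>auto simp: peval_const[OF hom] peval_Var[OF hom] ev_simps is_subringD[OF K'_subring]\<close>)

text \<open>A transcendental \<open>b\<close> becomes a free variable. For an algebraic
  \<open>b\<close>, pseudo-division by the minimal relation \<open>F\<close> puts a relation into
  the ideal only up to powers of the leading coefficient, so one more variable inverts that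
  coefficient. Its value and that of the derivative are nonzero elements of the field
  \<open>K'\<close>, hence units.\<close>

lemma tower_unit_step:
  assumes T: "tower u m L z" and z: "\<And>i. i < m \<Longrightarrow> z i \<in> K'"
    and ker: "\<And>p. p \<in> kpolys K m \<Longrightarrow> peval u z p = 0 \<Longrightarrow> p \<in> tower_ideal m L" and b: "b \<in> K'"
  shows "\<exists>m' L' z'. m < m' \<and> tower u m' L' z' \<and> (\<forall>i<m'. z' i \<in> K') \<and> (\<forall>i<m. z' i = z i) \<and> z' m = b \<and>
    (\<forall>p\<in>kpolys K m'. peval u z' p = 0 \<longrightarrow> p \<in> tower_ideal m' L')"
proof (cases rule: minimal_relation[OF kpolys_subring[OF K_subring] ev_hom char0, of m z b, case_names trans alg])
  case trans
  have T1: "tower u (Suc m) L (z(m := b))"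
    by (rule tower_free[OF hom T])
  have le: "tower_ideal m L \<subseteq> tower_ideal (Suc m) L"
    by (rule tower_ideal_mono) auto
  have "p \<in> tower_ideal (Suc m) L" if p: "p \<in> kpolys K (Suc m)" "peval u (z(m := b)) p = 0" for p
  proof -
    obtain P where P: "P \<in> PQ (kpolys K m)" "p = poly P (Var m)"
      using p(1) unfolding kpolys_Suc[OF K_subring] by auto
    have PQ: "P \<in> PQ (polys m)"
      using P(1) PQ_mono[OF kpolys_subset] by blast
    have "peva (peval u z) b P = 0"
      using p(2) P(2) peval_poly_Var[OF hom PQ] by simp
    then have "coeff P i \<in> tower_ideal m L" for i
      using trans[OF P(1)] ker P(1) by (simp add: PQ_iff)
    then show ?thesis
      unfolding P(2) using le
      by (intro poly_in_ideal[OF tower_ideal_is_ideal[OF hom T1] _ polys_subring] Var_in_polys) auto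
  qed
  then show ?thesis
    using T1 z b
    by (intro exI[of _ "Suc m"] exI[of _ L] exI[of _ "z(m := b)"]) (auto simp: less_Suc_eq)
next
  case (alg F)
  have F: "F \<in> PQ (polys m)"
    using alg(1) PQ_mono[OF kpolys_subset] by blast
  define h where "h = lead_coeff F"
  have h: "h \<in> kpolys K m"
    using alg(1) by (simp add: h_def PQ_iff)
  define z1 where "z1 = z(m := b)"
  define L1 where "L1 = L @ [(m, poly F (Var m))]"
  have z1: "z1 i \<in> K'" if "i < Suc m" for i
    using z b that by (auto simp: z1_def less_Suc_eq)
  have "poly (pderiv F) (Var m) \<in> kpolys K (Suc m)"
    using PQ_pderiv[OF kpolys_subring[OF K_subring] alg(1)] by (simp add: kpolys_Suc[OF K_subring])
  then have "peval u z1 (poly (pderiv F) (Var m)) \<in> K'"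
    by (rule ev_in_K') (rule z1)
  then have "peva (peval u z) b (pderiv F) \<in> K'"
    unfolding z1_def peval_poly_Var[OF hom PQ_pderiv[OF polys_subring F]] .
  then have "peva (peval u z) b (pderiv F) dvd 1"
    using K'_inverse alg(4) by (metis dvd_triv_left)
  then have T1: "tower u (Suc m) L1 z1"
    unfolding L1_def z1_def by (intro tower_eq[OF hom T F]) (use alg in auto)
  have hm: "h \<in> polys m" and h1: "h \<in> kpolys K (Suc m)" and hS: "h \<in> polys (Suc m)"
    using h kpolys_subset kpolys_mono[of m "Suc m" K] by auto
  have hev: "peval u z1 h = peval u z h"
    unfolding z1_def by (rule peval_upd[OF hom hm])
  have "peval u z h \<in> K'"
    by (rule ev_in_K'[OF h]) (rule z)
  moreover have "peval u z h \<noteq> 0"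
    using alg(3) by (simp add: h_def)
  ultimately obtain t where t: "t \<in> K'" "peval u z1 h * t = 1"
    using K'_inverse[of "peval u z h"] unfolding hev by blast
  define L2 where "L2 = L1 @ [(Suc m, poly [:- 1, h:] (Var (Suc m)))]"
  define z2 where "z2 = z1(Suc m := t)"
  let ?J = "tower_ideal (Suc (Suc m)) L2"
  have T2: "tower u (Suc (Suc m)) L2 z2" and inv: "h * Var (Suc m) - 1 \<in> ?J"
    unfolding L2_def z2_def using tower_inverse[OF hom T1 hS t(2)] by auto
  have J: "is_ideal (polys (Suc (Suc m))) ?J"
    by (rule tower_ideal_is_ideal[OF hom T2])
  have le: "tower_ideal m L \<subseteq> tower_ideal (Suc m) L1" "tower_ideal (Suc m) L1 \<subseteq> ?J"
    by (rule tower_ideal_mono; auto simp: L1_def L2_def)+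
  have FJ: "poly F (Var m) \<in> tower_ideal (Suc m) L1"
    unfolding tower_ideal_def by (rule gen_ideal_mem[OF polys_subring]) (simp add: L1_def)
  have J1: "is_ideal (polys (Suc m)) (tower_ideal (Suc m) L1)"
    by (rule tower_ideal_is_ideal[OF hom T1])
  have sub: "polys m \<subseteq> (polys (Suc m) :: 'a mpoly set)"
    "polys (Suc m) \<subseteq> (polys (Suc (Suc m)) :: 'a mpoly set)"
    by (rule polys_mono; simp)+
  note canc = inverse_cancel[OF polys_subring J _ _ inv]
  have hSS: "h \<in> polys (Suc (Suc m))" "Var (Suc m) \<in> (polys (Suc (Suc m)) :: 'a mpoly set)"
    using hS sub(2) by (blast, intro Var_in_polys) simp
  have ker1: "p \<in> ?J" if p: "p \<in> kpolys K (Suc m)" "peval u z1 p = 0" for p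
  proof -
    obtain P where P: "P \<in> PQ (kpolys K m)" "p = poly P (Var m)"
      using p(1) unfolding kpolys_Suc[OF K_subring] by auto
    have PQ: "P \<in> PQ (polys m)"
      using P(1) PQ_mono[OF kpolys_subset] by blast
    have "peva (peval u z) b P = 0"
      using p(2) P(2) peval_poly_Var[OF hom PQ] by (simp add: z1_def)
    then obtain N q r where *: "q \<in> PQ (kpolys K m)" "r \<in> PQ (kpolys K m)"
      "smult (h ^ N) P = F * q + r" "\<forall>i. peval u z (coeff r i) = 0"
      using alg(5)[OF P(1)] unfolding h_def by blast
    have "coeff r i \<in> tower_ideal m L" for i
      using * ker by (simp add: PQ_iff)
    then have "poly r (Var m) \<in> tower_ideal (Suc m) L1"
      using le by (intro poly_in_ideal[OF J1 _ polys_subring] Var_in_polys) auto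
    moreover have "poly q (Var m) \<in> polys (Suc m)"
      using *(1) PQ_mono[OF kpolys_subset] unfolding polys_Suc by blast
    ultimately have "poly F (Var m) * poly q (Var m) + poly r (Var m) \<in> tower_ideal (Suc m) L1"
      by (intro is_idealD(3,5)[OF J1] FJ)
    moreover have "poly F (Var m) * poly q (Var m) + poly r (Var m) = h ^ N * p"
      using arg_cong[OF *(3), of "\<lambda>P. poly P (Var m)"] by (simp add: P(2))
    ultimately have "h ^ N * p \<in> ?J"
      using le by auto
    moreover have "p \<in> polys (Suc (Suc m))"
      using p(1) kpolys_subset sub by blast
    ultimately show ?thesis
      using canc(2) hSS by blast
  qed
  have ker2: "p \<in> ?J" if p: "p \<in> kpolys K (Suc (Suc m))" "peval u z2 p = 0" for p
  proof -
    let ?V = "Var (Suc m) :: 'a mpoly"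
    obtain P where P: "P \<in> PQ (kpolys K (Suc m))" "p = poly P ?V"
      using p(1) unfolding kpolys_Suc[OF K_subring] by auto
    have PQ: "P \<in> PQ (polys (Suc m))"
      using P(1) PQ_mono[OF kpolys_subset] by blast
    define N where "N = degree P"
    \<comment> \<open>Denominators are cleared: the second new variable stands for the inverse of
      \<open>h\<close>, so \<open>h ^ N * p\<close> reduces to \<open>p'\<close>, in which that
      variable no longer occurs.\<close>
    define p' where "p' = (\<Sum>i\<le>N. coeff P i * h ^ (N - i))"
    have "p' \<in> kpolys K (Suc m)"
      unfolding p'_def using P(1) h1
      by (intro is_subring_sum[OF kpolys_subring[OF K_subring]] is_subringD(5)[OF kpolys_subring[OF K_subring]]
          is_subring_power[OF kpolys_subring[OF K_subring]]) (auto simp: PQ_iff)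
    moreover have "peval u z1 p' = 0"
    proof -
      have "peval u z1 p' = (\<Sum>i\<le>N. peval u z1 (coeff P i) * peval u z1 h ^ (N - i))"
        by (simp add: p'_def ev_simps)
      also have "\<dots> = (\<Sum>i\<le>N. peval u z1 h ^ N * (peval u z1 (coeff P i) * t ^ i))"
      proof (intro sum.cong refl)
        fix i assume "i \<in> {..N}"
        then have "peval u z1 h ^ N * t ^ i = peval u z1 h ^ (N - i) * (peval u z1 h * t) ^ i"
          by (simp add: power_mult_distrib power_add[symmetric] mult.assoc[symmetric])
        then have "peval u z1 h ^ N * t ^ i = peval u z1 h ^ (N - i)"
          by (simp add: t(2))
        then show "peval u z1 (coeff P i) * peval u z1 h ^ (N - i) =
            peval u z1 h ^ N * (peval u z1 (coeff P i) * t ^ i)"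
          by (metis mult.left_commute)
      qed
      also have "\<dots> = peval u z1 h ^ N * peva (peval u z1) t P"
        by (simp add: peva_altdef[OF ev_hom] sum_distrib_left N_def)
      also have "peva (peval u z1) t P = 0"
        using p(2) peval_poly_Var[OF hom PQ] by (simp add: P(2) z2_def)
      finally show ?thesis
        by simp
    qed
    ultimately have p'J: "p' \<in> ?J"
      by (rule ker1)
    have "h ^ N * p - p' = (\<Sum>i\<le>N. (coeff P i * h ^ (N - i)) * ((h * ?V) ^ i - 1))"
    proof -
      have "h ^ N * p = (\<Sum>i\<le>N. coeff P i * h ^ (N - i) * (h * ?V) ^ i)"
        unfolding P(2) poly_altdef sum_distrib_left N_def[symmetric]
      proof (intro sum.cong refl)
        fix i assume "i \<in> {..N}"
        then have "h ^ N = h ^ (N - i) * h ^ i"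
          by (simp add: power_add[symmetric])
        then show "h ^ N * (coeff P i * ?V ^ i) = coeff P i * h ^ (N - i) * (h * ?V) ^ i"
          by (simp add: power_mult_distrib mult_ac)
      qed
      then show ?thesis
        by (simp add: p'_def sum_subtractf right_diff_distrib)
    qed
    also have "\<dots> \<in> ?J"
    proof (intro is_ideal_sum[OF J] is_idealD(4)[OF J] canc(1)[OF hSS])
      fix i
      have "coeff P i * h ^ (N - i) \<in> polys (Suc m)"
        using PQ hS by (intro is_subringD(5)[OF polys_subring] is_subring_power[OF polys_subring])
          (auto simp: PQ_iff)
      then show "coeff P i * h ^ (N - i) \<in> polys (Suc (Suc m))"
        using sub by blast
    qed
    finally have "h ^ N * p \<in> ?J"
      using is_idealD(3)[OF J _ p'J] by fastforce
    moreover have "p \<in> polys (Suc (Suc m))"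
      using p(1) kpolys_subset by blast
    ultimately show ?thesis
      using canc(2) hSS by blast
  qed
  show ?thesis
  proof (intro exI[of _ "Suc (Suc m)"] exI[of _ L2] exI[of _ z2] conjI)
    show "\<forall>i<Suc (Suc m). z2 i \<in> K'"
      using z1 t(1) by (simp add: z2_def less_Suc_eq)
    show "\<forall>i<m. z2 i = z i" "z2 m = b"
      by (simp_all add: z2_def z1_def)
  qed (use T2 ker2 in auto)
qed

lemma coefficient_tower:
  assumes "finite B" "B \<subseteq> K'"
  shows "\<exists>m L z. tower u m L z \<and> (\<forall>i<m. z i \<in> K') \<and>
    (\<forall>p\<in>kpolys K m. peval u z p = 0 \<longrightarrow> p \<in> tower_ideal m L) \<and> B \<subseteq> peval u z ` polys m"
  using assms
proof (induction B rule: finite_induct)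
  case empty
  have "p \<in> tower_ideal 0 []" if p: "p \<in> kpolys K 0" "peval u z p = 0" for p and z :: "nat \<Rightarrow> 'b"
  proof -
    obtain c where c: "p = const_poly c"
      using polys_0 kpolys_subset p(1) by blast
    then have "p = 0"
      using p(2) by (simp add: peval_const[OF hom] u_eq_0_iff ring_hom_simps[OF const_poly_hom])
    then show ?thesis
      using is_idealD(2)[OF tower_ideal_is_ideal[OF hom tower_0[OF hom]]] by simp
  qed
  then show ?case
    using tower_0[OF hom] by (intro exI[of _ 0] exI[of _ "[]"]) auto
next
  case (insert b B)
  then have "b \<in> K'" "B \<subseteq> K'"
    by auto
  obtain m L z where T: "tower u m L z" "\<forall>i<m. z i \<in> K'"
    "\<forall>p\<in>kpolys K m. peval u z p = 0 \<longrightarrow> p \<in> tower_ideal m L" "B \<subseteq> peval u z ` polys m"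
    using insert.IH[OF \<open>B \<subseteq> K'\<close>] by blast
  obtain m' L' z' where T': "m < m'" "tower u m' L' z'" "\<forall>i<m'. z' i \<in> K'" "\<forall>i<m. z' i = z i" "z' m = b"
    "\<forall>p\<in>kpolys K m'. peval u z' p = 0 \<longrightarrow> p \<in> tower_ideal m' L'"
    using tower_unit_step[OF T(1) T(2)[rule_format] T(3)[rule_format] \<open>b \<in> K'\<close>] by blast
  have "peval u z' x = peval u z x" if "x \<in> polys m" for x
    using T'(4) by (intro peval_cong[OF that]) auto
  then have "peval u z ` polys m \<subseteq> peval u z' ` polys m"
    by auto
  moreover have "peval u z' ` polys m \<subseteq> peval u z' ` polys m'"
    by (intro image_mono polys_mono less_imp_le T'(1))
  ultimately have "B \<subseteq> peval u z' ` polys m'"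
    using T(4) by blast
  moreover have "b \<in> peval u z' ` polys m'"
    using T'(1,5) Var_in_polys[of m m'] by (intro image_eqI[of _ _ "Var m"]) (auto simp: peval_Var[OF hom])
  ultimately show ?case
    using T' by blast
qed

end

section \<open>Approximation by the coefficient tower\<close>

context flat_local_extension
begin

text \<open>The image in \<open>A'\<close> of the tensor product of \<open>A\<close> and
  \<open>K'\<close> over \<open>K\<close>.\<close>

definition kspan :: "'b set" where
  "kspan = {sum_list (map (\<lambda>(a, k). u a * k) xs) |xs. set xs \<subseteq> UNIV \<times> K'}"

lemma kspan_0: "0 \<in> kspan"
  unfolding kspan_def by (intro CollectI exI[of _ "[]"]) simp

lemma kspan_K': "k \<in> K' \<Longrightarrow> k \<in> kspan"
  unfolding kspan_def by (intro CollectI exI[of _ "[(1, k)]"]) (simp add: u_simps)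

lemma kspan_add:
  assumes "x \<in> kspan" "y \<in> kspan"
  shows "x + y \<in> kspan"
proof -
  obtain xs where "set xs \<subseteq> UNIV \<times> K'" "x = sum_list (map (\<lambda>(a, k). u a * k) xs)"
    using assms(1) unfolding kspan_def by blast
  moreover obtain ys where "set ys \<subseteq> UNIV \<times> K'" "y = sum_list (map (\<lambda>(a, k). u a * k) ys)"
    using assms(2) unfolding kspan_def by blast
  ultimately show ?thesis
    unfolding kspan_def by (intro CollectI exI[of _ "xs @ ys"]) simp
qed

lemma kspan_scale:
  assumes "x \<in> kspan"
  shows "u c * x \<in> kspan"
proof -
  obtain xs where xs: "set xs \<subseteq> UNIV \<times> K'" "x = sum_list (map (\<lambda>(a, k). u a * k) xs)"
    using assms unfolding kspan_def by blast
  have "u c * sum_list (map (\<lambda>(a, k). u a * k) xs) =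
      sum_list (map (\<lambda>(a, k). u a * k) (map (\<lambda>(a, k). (c * a, k)) xs))"
    by (induction xs) (auto simp: u_simps algebra_simps)
  moreover have "set (map (\<lambda>(a, k). (c * a, k)) xs) \<subseteq> UNIV \<times> K'"
    using xs(1) by auto
  ultimately show ?thesis
    unfolding xs(2) kspan_def by blast
qed

text \<open>In other words \<open>A' = kspan + I A'\<close>. The set \<open>I\<close> is arbitrary,
  and not just the multiples of some \<open>D\<close>, so that a maximal counterexample can be
  taken.\<close>

definition approximable :: "'a set \<Rightarrow> bool" where
  "approximable I \<longleftrightarrow> (\<forall>y. \<exists>s\<in>kspan. y - s \<in> gen_ideal UNIV (u ` I))"

lemma ext_ideal: "is_ideal UNIV (gen_ideal UNIV (u ` I))"
  by (rule gen_ideal_is_ideal) auto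

text \<open>After an approximation modulo \<open>I\<close> the error is a sum of terms
  \<open>c * u a\<close> with \<open>a\<close> in \<open>I\<close>; approximating each
  \<open>c\<close> modulo \<open>J\<close> leaves an error generated by products.\<close>

lemma approximable_mult:
  assumes I: "approximable I" and J: "approximable J" and P: "\<And>a b. a \<in> I \<Longrightarrow> b \<in> J \<Longrightarrow> a * b \<in> P"
  shows "approximable P"
  unfolding approximable_def
proof
  fix y
  let ?T = "{x. \<exists>s\<in>kspan. x - s \<in> gen_ideal UNIV (u ` P)}"
  have add: "x + x' \<in> ?T" if "x \<in> ?T" "x' \<in> ?T" for x x'
  proof -
    obtain s s' where s: "s \<in> kspan" "s' \<in> kspan" "x - s \<in> gen_ideal UNIV (u ` P)"
      "x' - s' \<in> gen_ideal UNIV (u ` P)"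
      using \<open>x \<in> ?T\<close> \<open>x' \<in> ?T\<close> by blast
    have "x + x' - (s + s') \<in> gen_ideal UNIV (u ` P)"
      using is_idealD(3)[OF ext_ideal s(3,4)] by (simp add: algebra_simps)
    then show ?thesis
      using kspan_add[OF s(1,2)] by blast
  qed
  have T0: "x \<in> ?T" if "x \<in> kspan" for x
    using that is_idealD(2)[OF ext_ideal] by (intro CollectI bexI[of _ x]) simp_all
  have mult: "c * u a \<in> ?T" if a: "a \<in> I" for c a
  proof -
    obtain s where s: "s \<in> kspan" "c - s \<in> gen_ideal UNIV (u ` J)"
      using J unfolding approximable_def by blast
    have "is_ideal UNIV {t. u a * t \<in> gen_ideal UNIV (u ` P)}"
      using is_idealD(2,3)[OF ext_ideal[of P]] is_idealD(4)[OF ext_ideal[of P] UNIV_I]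
      by (intro is_ideal_UNIVI) (auto simp: distrib_left mult.left_commute)
    moreover have "u ` J \<subseteq> {t. u a * t \<in> gen_ideal UNIV (u ` P)}"
    proof (intro image_subsetI CollectI)
      fix b assume "b \<in> J"
      then have "u (a * b) \<in> gen_ideal UNIV (u ` P)"
        by (intro gen_ideal_mem[OF is_subring_UNIV] imageI P a)
      then show "u a * u b \<in> gen_ideal UNIV (u ` P)"
        by (simp add: u_simps)
    qed
    ultimately have "u a * (c - s) \<in> gen_ideal UNIV (u ` P)"
      using gen_ideal_least s(2) by blast
    then have "c * u a - u a * s \<in> gen_ideal UNIV (u ` P)"
      by (simp add: algebra_simps)
    then show ?thesis
      using kspan_scale[OF s(1)] by blast
  qed
  obtain s where s: "s \<in> kspan" "y - s \<in> gen_ideal UNIV (u ` I)"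
    using I unfolding approximable_def by blast
  obtain F :: "nat set" and c t where F: "finite F" "\<forall>i\<in>F. t i \<in> u ` I" "y - s = (\<Sum>i\<in>F. c i * t i)"
    using s(2) unfolding gen_ideal_def by blast
  have "(\<Sum>i\<in>F. c i * t i) \<in> ?T"
    using F(1,2)
  proof (induction F rule: finite_induct)
    case empty
    then show ?case
      using T0[OF kspan_0] by simp
  next
    case (insert i F)
    obtain a where "a \<in> I" "t i = u a"
      using insert.prems by blast
    then have "c i * t i \<in> ?T"
      using mult by simp
    then have "c i * t i + (\<Sum>i\<in>F. c i * t i) \<in> ?T"
      using insert.IH insert.prems by (intro add) simp_all
    then show ?case
      using insert.hyps by simp
  qed
  then have "(y - s) + s \<in> ?T"
    unfolding F(3)[symmetric] by (rule add[OF _ T0[OF s(1)]])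
  then show "\<exists>s\<in>kspan. y - s \<in> gen_ideal UNIV (u ` P)"
    by simp
qed

text \<open>An ideal maximal among those that contain the multiples of \<open>D\<close> and are not
  approximable would be prime and nonzero, hence \<open>M\<close>. But \<open>M\<close> is
  approximable, because its image generates \<open>M'\<close> and \<open>K'\<close> maps onto the
  residue field.\<close>

lemma approximation:
  assumes "D \<noteq> 0"
  shows "\<exists>s\<in>kspan. \<exists>w. y - s = u D * w"
proof -
  let ?bad = "\<lambda>I. \<not> approximable I"
  have id: "is_ideal UNIV {x. D dvd x}"
    by (rule is_ideal_UNIVI) auto
  have "approximable {x. D dvd x}"
  proof (rule ccontr)
    assume "?bad {x. D dvd x}"
    then obtain P where P: "is_ideal UNIV P" "?bad P" "{x. D dvd x} \<subseteq> P"
      "\<And>J'. is_ideal UNIV J' \<Longrightarrow> ?bad J' \<Longrightarrow> P \<subseteq> J' \<Longrightarrow> J' = P"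
      using noetherian_maximal[OF noethA id, of ?bad] by metis
    have U: "\<not> ?bad UNIV"
    proof -
      have "u 1 \<in> gen_ideal UNIV (u ` UNIV)"
        by (rule gen_ideal_mem[OF is_subring_UNIV]) blast
      then have "1 \<in> gen_ideal UNIV (u ` UNIV)"
        by (simp add: u_simps(2))
      then have "x \<in> gen_ideal UNIV (u ` UNIV)" for x
        using is_idealD(4)[OF ext_ideal UNIV_I, of 1 UNIV x] by simp
      then show ?thesis
        using kspan_0 unfolding approximable_def by blast
    qed
    have "prime_ideal P"
    proof (rule maximal_wrt_property_prime[of P ?bad, OF P(1,2) U])
      show "J' = P" if "is_ideal UNIV J'" "?bad J'" "P \<subseteq> J'" for J'
        by (rule P(4)[OF that])
      show "\<not> ?bad P" if "\<not> ?bad I" "\<not> ?bad J" "\<And>a b. a \<in> I \<Longrightarrow> b \<in> J \<Longrightarrow> a * b \<in> P" for I J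
        using approximable_mult[of I J P, OF _ _ that(3)] that(1,2) by blast
    qed
    moreover have "D \<in> P"
      by (rule subsetD[OF P(3)]) simp
    ultimately have "P = M"
      using nonzero_prime_eq_max[OF noethA localA dimA _ _ assms] by blast
    moreover have "approximable M"
      unfolding approximable_def gen using ex_residue' kspan_K' by blast
    ultimately show False
      using P(2) by simp
  qed
  then obtain s where s: "s \<in> kspan" "y - s \<in> gen_ideal UNIV (u ` {x. D dvd x})"
    unfolding approximable_def by blast
  have "is_ideal UNIV {x. u D dvd x}"
    by (rule is_ideal_UNIVI) auto
  moreover have "u ` {x. D dvd x} \<subseteq> {x. u D dvd x}"
    by (auto simp: u_simps elim!: dvdE)
  ultimately have "u D dvd y - s"
    using gen_ideal_least s(2) by blast
  then show ?thesis
    using s(1) by (auto elim!: dvdE)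
qed

text \<open>Only finitely many elements of \<open>K'\<close> occur in approximations of the elements
  of \<open>E\<close>, so one tower reaches them all. The modulus \<open>D'\<close> of the second
  property is independent of \<open>D\<close>, as it is applied with zero too.\<close>

lemma approximation_tower:
  assumes E: "finite E" and D: "D \<noteq> 0"
  obtains m L z where "tower u m L z"
    "\<And>x D' w. x \<in> polys m \<Longrightarrow> peval u z x = u D' * w \<Longrightarrow> x \<in> ideal_mod D' m (tower_ideal m L)"
    "\<And>y. y \<in> E \<Longrightarrow> \<exists>x\<in>polys m. \<exists>w. y - peval u z x = u D * w"
proof -
  have "\<forall>y. \<exists>xs. set xs \<subseteq> UNIV \<times> K' \<and> (\<exists>w. y - sum_list (map (\<lambda>(a, k). u a * k) xs) = u D * w)"
    using approximation[OF D] unfolding kspan_def by blast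
  then obtain X where X: "\<And>y. set (X y) \<subseteq> UNIV \<times> K'"
    "\<And>y. \<exists>w. y - sum_list (map (\<lambda>(a, k). u a * k) (X y)) = u D * w"
    by metis
  define B where "B = (\<Union>y\<in>E. snd ` set (X y))"
  have "snd ` set (X y) \<subseteq> K'" for y
    using image_mono[OF X(1)[of y], of snd] by auto
  then have sub: "B \<subseteq> K'"
    unfolding B_def by blast
  have fin: "finite B"
    using E by (simp add: B_def)
  obtain m L z where T: "tower u m L z" "\<forall>i<m. z i \<in> K'"
    "\<forall>p\<in>kpolys K m. peval u z p = 0 \<longrightarrow> p \<in> tower_ideal m L" "B \<subseteq> peval u z ` polys m"
    using coefficient_tower[OF fin sub] by blast
  show thesis
  proof (rule that[OF T(1)])
    fix x D' w assume x: "x \<in> polys m" "peval u z x = u D' * w"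
    show "x \<in> ideal_mod D' m (tower_ideal m L)"
    proof (rule reduce_mod[OF tower_ideal_is_ideal[OF hom T(1)] _ _ _ x])
      show "peval u z x = 0" if "x \<in> tower_ideal m L" for x
        using tower_ideal_zero[OF hom T(1) that] .
      show "peval u z p \<in> K'" if "p \<in> kpolys K m" for p
        using ev_in_K'[OF that] T(2) by blast
    qed (use T(3) in blast)
  next
    fix y assume y: "y \<in> E"
    have "\<exists>x\<in>polys m. peval u z x = sum_list (map (\<lambda>(a, k). u a * k) xs)" if "snd ` set xs \<subseteq> B" for xs
      using that
    proof (induction xs)
      case Nil
      then show ?case
        using is_subringD(1)[OF polys_subring] by (intro bexI[of _ 0]) (auto simp: ev_simps)
    next
      case (Cons ak xs)
      then obtain x where x: "x \<in> polys m" "peval u z x = sum_list (map (\<lambda>(a, k). u a * k) xs)"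
        by auto
      obtain x' where x': "x' \<in> polys m" "peval u z x' = snd ak"
        using Cons.prems T(4) by (auto simp: image_iff subset_iff)
      have "const_poly (fst ak) * x' + x \<in> polys m"
        using x x' by (intro is_subringD[OF polys_subring] const_in_polys)
      moreover have "peval u z (const_poly (fst ak) * x' + x) = sum_list (map (\<lambda>(a, k). u a * k) (ak # xs))"
        using x x' by (simp add: ev_simps peval_const[OF hom] case_prod_unfold)
      ultimately show ?case
        by blast
    qed
    moreover have "snd ` set (X y) \<subseteq> B"
      using y by (auto simp: B_def)
    ultimately show "\<exists>x\<in>polys m. \<exists>w. y - peval u z x = u D * w"
      using X(2)[of y] by metis
  qed
qed

section \<open>Newton lifting along triangular relations\<close>

lemma ideal_mod_mono:
  assumes "m \<le> m'" "J \<subseteq> J'"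
  shows "ideal_mod (D * D') m J \<subseteq> ideal_mod D m' J'"
proof
  fix x assume "x \<in> ideal_mod (D * D') m J"
  then obtain y where "x \<in> polys m" "y \<in> polys m" "x - const_poly (D * D') * y \<in> J"
    by (auto simp: ideal_mod_def)
  then show "x \<in> ideal_mod D m' J'"
    using assms polys_mono[OF assms(1)] is_subringD(5)[OF polys_subring const_in_polys, of y m' D']
    by (auto simp: ideal_mod_def ring_hom_simps[OF const_poly_hom] mult.assoc
        intro!: bexI[of _ "const_poly D' * y"])
qed

lemma dvd_ideal: "is_ideal (polys m) {const_poly D * x |x. x \<in> polys m}"
  for D :: 'a
proof -
  have "is_ideal (polys m) (ideal_mod D m {0})"
    by (rule ideal_mod_is_ideal) (auto simp: is_ideal_def is_subringD[OF polys_subring])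
  moreover have "ideal_mod D m {0} = {const_poly D * x |x. x \<in> polys m}"
    by (auto simp: ideal_mod_def intro: is_subringD(5)[OF polys_subring const_in_polys])
  ultimately show ?thesis
    by simp
qed

lemma ideal_power_diff:
  assumes R: "is_subring R" and J: "is_ideal R J" and ab: "a \<in> R" "b \<in> R" "a - b \<in> J"
  shows "a ^ k - b ^ k \<in> J"
proof (induction k)
  case 0
  then show ?case
    using is_idealD(2)[OF J] by simp
next
  case (Suc k)
  have "a * (a ^ k - b ^ k) + (a - b) * b ^ k \<in> J"
    by (intro is_idealD(3)[OF J] is_idealD(4)[OF J ab(1) Suc]
        is_idealD(5)[OF J is_subring_power[OF R ab(2)] ab(3)])
  then show ?case
    by (simp add: algebra_simps)
qed

text \<open>The composition is \<open>P (x + e * T)\<close>, expanded to second order in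
  \<open>e\<close>. The induction on \<open>P\<close> introduces no factorials, so the remainder
  \<open>R\<close> stays over \<open>Q\<close>.\<close>

lemma taylor_expansion:
  fixes P :: "'c::idom poly"
  assumes Q: "is_subring Q" and x: "x \<in> Q" and e: "e \<in> Q" and P: "P \<in> PQ Q"
  shows "\<exists>R\<in>PQ Q. pcompose P [:x, e:] = [:poly P x, poly (pderiv P) x * e:] + smult (e ^ 2) R"
  using P
proof (induction P)
  case 0
  then show ?case
    using PQ_0[OF Q] by (intro bexI[of _ 0]) auto
next
  case (pCons a P)
  then have P: "P \<in> PQ Q" "a \<in> Q"
    by (simp_all add: PQ_pCons)
  then obtain R where R: "R \<in> PQ Q"
    "pcompose P [:x, e:] = [:poly P x, poly (pderiv P) x * e:] + smult (e ^ 2) R"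
    using pCons.IH by blast
  let ?R = "[:0, 0, poly (pderiv P) x:] + [:x, e:] * R"
  have "poly (pderiv P) x \<in> Q"
    by (intro PQ_poly[OF Q] PQ_pderiv[OF Q] P x)
  then have "?R \<in> PQ Q"
    using x e R(1) is_subringD(1)[OF Q]
    by (intro is_subringD[OF PQ_subring[OF Q]]) (auto simp: PQ_pCons PQ_0[OF Q])
  moreover have "pcompose (pCons a P) [:x, e:] =
      [:poly (pCons a P) x, poly (pderiv (pCons a P)) x * e:] + smult (e ^ 2) ?R"
    by (simp add: pcompose_pCons R(2) pderiv_pCons algebra_simps power2_eq_square smult_add_right)
  ultimately show ?case
    by blast
qed

lemma map_poly_pderiv:
  fixes w :: "'c::idom \<Rightarrow> 'd::idom"
  assumes w: "ring_hom w"
  shows "map_poly w (pderiv P) = pderiv (map_poly w P)"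
  by (rule poly_eqI) (simp add: coeff_map_poly coeff_pderiv ring_hom_simps[OF w] ring_hom_simps(1)[OF w])

text \<open>Here \<open>y'\<close> are approximations of \<open>y\<close> in the coefficient tower and \<open>Y\<close> exact lifts of \<open>y\<close>.\<close>
definition lift_state ::
  "'a \<Rightarrow> (nat \<Rightarrow> 'b) \<Rightarrow> (nat \<Rightarrow> 'a mpoly) \<Rightarrow> nat \<Rightarrow> nat \<Rightarrow> nat \<Rightarrow> (nat \<times> 'a mpoly) list \<Rightarrow> (nat \<Rightarrow> 'b) \<Rightarrow>
    (nat \<Rightarrow> 'a mpoly) \<Rightarrow> bool" where
  "lift_state d y y' j e m L z Y \<longleftrightarrow> tower u m L z \<and> nonzerodivisor_mod d m (tower_ideal m L) \<and>
    (\<forall>i<j. Y i \<in> polys m \<and> peval u z (Y i) = y i \<and> (\<exists>x\<in>polys m. Y i - y' i = const_poly (d ^ e) * x)) \<and>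
    (\<forall>p\<in>polys j. peval u y p = 0 \<longrightarrow> peval const_poly Y p \<in> tower_ideal m L)"

lemma peval_fun_upd_Suc:
  assumes "ring_hom phi" "P \<in> PQ (polys j)"
  shows "peval phi (Y(j := x)) (poly P (Var j)) = peva (peval phi Y) x P"
proof -
  have "peval phi (Y(j := x)) (poly P (Var j)) = peva (peval phi (Y(j := x))) x P"
    by (simp add: hom_poly[OF peval_hom[OF assms(1)]] peval_Var[OF assms(1)])
  also have "\<dots> = peva (peval phi Y) x P"
    unfolding peva_altdef[OF peval_hom[OF assms(1)]] using assms(2)
    by (intro sum.cong refl arg_cong2[where f = "(*)"] peval_cong[of _ j]) (auto simp: PQ_iff)
  finally show ?thesis .
qed

text \<open>All coefficients of a relation of \<open>y 0\<close>, ..., \<open>y j\<close> are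
  relations of the earlier elements, and those are already in the ideal; so the lift of
  \<open>y j\<close> may vary freely near \<open>y' j\<close>. The precision drops to
  \<open>e\<close> in order to match the algebraic case.\<close>

lemma lift_transcendental:
  assumes S: "lift_state d y y' j (Suc e) m L z Y"
    and trans: "\<And>P i. P \<in> PQ (polys j) \<Longrightarrow> peva (peval u y) (y j) P = 0 \<Longrightarrow> peval u y (coeff P i) = 0"
    and y': "y' j \<in> polys m" and w: "y j - peval u z (y' j) = u (d ^ e) * w"
  shows "lift_state d y y' (Suc j) e (Suc m) L (z(m := w)) (Y(j := y' j + const_poly (d ^ e) * Var m))"
proof -
  define z1 where "z1 = z(m := w)"
  define Yj where "Yj = y' j + const_poly (d ^ e) * Var m"
  define Y1 where "Y1 = Y(j := Yj)"
  have T: "tower u m L z" and nz: "nonzerodivisor_mod d m (tower_ideal m L)"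
    and Y: "\<And>i. i < j \<Longrightarrow> Y i \<in> polys m" "\<And>i. i < j \<Longrightarrow> peval u z (Y i) = y i"
      "\<And>i. i < j \<Longrightarrow> \<exists>x\<in>polys m. Y i - y' i = const_poly (d ^ Suc e) * x"
    and ker: "\<And>p. p \<in> polys j \<Longrightarrow> peval u y p = 0 \<Longrightarrow> peval const_poly Y p \<in> tower_ideal m L"
    using S by (auto simp: lift_state_def)
  have T1: "tower u (Suc m) L z1"
    unfolding z1_def by (rule tower_free[OF hom T])
  have sub: "polys m \<subseteq> (polys (Suc m) :: 'a mpoly set)"
    by (rule polys_mono) simp
  have nz1: "nonzerodivisor_mod d (Suc m) (tower_ideal (Suc m) L)"
    using nonzerodivisor_mod_free[OF tower_equations[OF hom T]] nz by (simp add: tower_ideal_def)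
  have J1: "is_ideal (polys (Suc m)) (tower_ideal (Suc m) L)"
    by (rule tower_ideal_is_ideal[OF hom T1])
  have le: "tower_ideal m L \<subseteq> tower_ideal (Suc m) L"
    by (rule tower_ideal_mono) auto
  note R = is_subringD[OF polys_subring[of "Suc m"]]
  have V: "Var m \<in> (polys (Suc m) :: 'a mpoly set)"
    by (rule Var_in_polys) simp
  have Yj: "Yj \<in> polys (Suc m)"
    unfolding Yj_def using y' sub V by (intro R const_in_polys) auto
  have evYj: "peval u z1 Yj = y j"
    unfolding Yj_def z1_def using w y' 
    by (simp add: ev_simps peval_const[OF hom] peval_Var[OF hom] peval_upd[OF hom y'] u_simps algebra_simps)
  have "Y1 i \<in> polys (Suc m) \<and> peval u z1 (Y1 i) = y i \<and>
      (\<exists>x\<in>polys (Suc m). Y1 i - y' i = const_poly (d ^ e) * x)" if "i < Suc j" for i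
  proof (cases "i = j")
    case True
    then show ?thesis
      using Yj evYj V by (auto simp: Y1_def Yj_def)
  next
    case False
    then have i: "i < j"
      using that by simp
    obtain x where x: "x \<in> polys m" "Y i - y' i = const_poly (d ^ Suc e) * x"
      using Y(3)[OF i] by blast
    have "const_poly d * x \<in> polys (Suc m)"
      using x(1) sub by (intro R const_in_polys) auto
    moreover have "Y1 i - y' i = const_poly (d ^ e) * (const_poly d * x)"
      using False x(2) by (simp add: Y1_def ring_hom_simps[OF const_poly_hom] mult_ac)
    ultimately show ?thesis
      using False i Y(1,2)[OF i] sub by (auto simp: Y1_def z1_def peval_upd[OF hom])
  qed
  moreover have "peval const_poly Y1 p \<in> tower_ideal (Suc m) L"
    if p: "p \<in> polys (Suc j)" "peval u y p = 0" for p
  proof -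
    obtain P where P: "P \<in> PQ (polys j)" "p = poly P (Var j)"
      using p(1) unfolding polys_Suc by auto
    have "peva (peval u y) (y j) P = 0"
      using p(2) peval_fun_upd_Suc[OF hom P(1), of y "y j"] by (simp add: P(2))
    then have "peval const_poly Y (coeff P i) \<in> tower_ideal (Suc m) L" for i
      using trans[OF P(1)] ker P(1) le by (auto simp: PQ_iff)
    then have "peva (peval const_poly Y) Yj P \<in> tower_ideal (Suc m) L"
      by (intro peva_in_ideal[OF peval_hom[OF const_poly_hom] J1 Yj polys_subring])
    then show ?thesis
      unfolding P(2) Y1_def peval_fun_upd_Suc[OF const_poly_hom P(1)] .
  qed
  ultimately show ?thesis
    unfolding lift_state_def z1_def[symmetric] Y1_def[symmetric] Yj_def[symmetric] using T1 nz1 by blast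
qed

text \<open>Newton's method: over the tower, \<open>F (y' j + d ^ e * q * T) = d ^ Suc e * g T\<close> where \<open>g\<close> is
  linear with leading coefficient \<open>1\<close> modulo \<open>d\<close>, so that \<open>g\<close> has unit derivative
  and \<open>d\<close> stays a nonzerodivisor.\<close>
lemma lift_algebraic:
  assumes S: "lift_state d y y' j (Suc e) m L z Y" and d: "d \<in> M" "d \<noteq> 0" and e: "e \<ge> 2"
    and F: "F \<in> PQ (polys j)" "peva (peval u y) (y j) F = 0"
    and divide: "\<And>P. P \<in> PQ (polys j) \<Longrightarrow> peva (peval u y) (y j) P = 0 \<Longrightarrow>
      \<exists>N. \<exists>q\<in>PQ (polys j). \<exists>r\<in>PQ (polys j). smult (lead_coeff F ^ N) P = F * q + r \<and>
        (\<forall>i. peval u y (coeff r i) = 0)"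
    and y': "\<And>i. i \<le> j \<Longrightarrow> y' i \<in> polys m" and b: "b \<in> polys m"
    and w: "y j - peval u z (y' j) = u (d ^ Suc e) * w"
    and h1: "peval const_poly y' (lead_coeff F * poly (pderiv F) (Var j)) * b - const_poly d
        \<in> ideal_mod (d ^ 2) m (tower_ideal m L)"
    and h2: "peval const_poly y' (poly F (Var j)) \<in> ideal_mod (d ^ Suc e) m (tower_ideal m L)"
  shows "\<exists>L' z' Y'. set L \<subseteq> set L' \<and> (\<forall>i<m. z' i = z i) \<and>
      lift_state d y y' (Suc j) e (Suc (Suc m)) L' z' Y'"
proof -
  have T: "tower u m L z" and nz: "nonzerodivisor_mod d m (tower_ideal m L)"
    and Y: "\<And>i. i < j \<Longrightarrow> Y i \<in> polys m" "\<And>i. i < j \<Longrightarrow> peval u z (Y i) = y i"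
      "\<And>i. i < j \<Longrightarrow> \<exists>x\<in>polys m. Y i - y' i = const_poly (d ^ Suc e) * x"
    and ker: "\<And>p. p \<in> polys j \<Longrightarrow> peval u y p = 0 \<Longrightarrow> peval const_poly Y p \<in> tower_ideal m L"
    using S by (auto simp: lift_state_def)
  let ?J = "tower_ideal m L"
  let ?c = "const_poly :: 'a \<Rightarrow> 'a mpoly"
  note c_simps = ring_hom_simps[OF const_poly_hom]
  note R = is_subringD[OF polys_subring]
  have J: "is_ideal (polys m) ?J"
    by (rule tower_ideal_is_ideal[OF hom T])
  define \<eta> where "\<eta> = peval ?c Y"
  have \<eta>: "ring_hom \<eta>"
    unfolding \<eta>_def by (rule peval_hom[OF const_poly_hom])
  have \<eta>m: "\<eta> p \<in> polys m" if "p \<in> polys j" for p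
    unfolding \<eta>_def using Y(1) by (intro peval_in_subring[OF polys_subring const_poly_hom that]) auto
  define \<Phi> where "\<Phi> = map_poly \<eta> F"
  have \<Phi>: "\<Phi> \<in> PQ (polys m)"
    using F(1) \<eta>m by (simp add: PQ_iff \<Phi>_def coeff_map_poly ring_hom_simps(1)[OF \<eta>])
  define A0 where "A0 = poly \<Phi> (y' j)"
  define A1 where "A1 = poly (pderiv \<Phi>) (y' j)"
  define l where "l = \<eta> (lead_coeff F)"
  have F': "pderiv F \<in> PQ (polys j)" and lF: "lead_coeff F \<in> polys j"
    using F(1) PQ_pderiv[OF polys_subring] by (auto simp: PQ_iff)
  have A: "A0 \<in> polys m" "A1 \<in> polys m" "l \<in> polys m"
    unfolding A0_def A1_def l_def using \<Phi> y'
    by (auto intro!: PQ_poly[OF polys_subring] PQ_pderiv[OF polys_subring] \<eta>m lF)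
  \<comment> \<open>Exact lifts below \<open>j\<close> and the approximation at \<open>j\<close>:
    this point is congruent to \<open>y'\<close> modulo \<open>d ^ Suc e\<close>, so
    \<open>h1\<close> and \<open>h2\<close> carry over to the polynomial \<Phi> with lifted
    coefficients.\<close>
  let ?Y0 = "Y(j := y' j)"
  have diff: "peval ?c ?Y0 p - peval ?c y' p \<in> {?c (d ^ Suc e) * x |x. x \<in> polys m}"
    if "p \<in> polys (Suc j)" for p
  proof (rule peval_diff_ideal[OF polys_subring dvd_ideal const_poly_hom _ _ _ _ that])
    fix i assume "i < Suc j"
    then show "?Y0 i \<in> polys m" "y' i \<in> polys m"
      using y' Y(1) by auto
    show "?Y0 i - y' i \<in> {?c (d ^ Suc e) * x |x. x \<in> polys m}"
      using \<open>i < Suc j\<close> Y(3)[of i] is_idealD(2)[OF dvd_ideal] by (cases "i = j") auto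
  qed simp
  have pF: "poly F (Var j) \<in> polys (Suc j)"
    using F(1) unfolding polys_Suc by blast
  have "poly (pderiv F) (Var j) \<in> polys (Suc j)"
    using F' unfolding polys_Suc by blast
  moreover have "lead_coeff F \<in> polys (Suc j)"
    using lF polys_mono[of j "Suc j"] by auto
  ultimately have pG: "lead_coeff F * poly (pderiv F) (Var j) \<in> polys (Suc j)"
    by (intro R)
  have e0: "peval ?c ?Y0 (poly F (Var j)) = A0"
    unfolding peval_fun_upd_Suc[OF const_poly_hom F(1)] by (simp add: A0_def \<Phi>_def \<eta>_def peva_def)
  have e1: "peval ?c ?Y0 (lead_coeff F * poly (pderiv F) (Var j)) = l * A1"
    unfolding ring_hom_simps[OF peval_hom[OF const_poly_hom]] peval_fun_upd_Suc[OF const_poly_hom F']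
    using peval_cong[OF lF, of ?Y0 Y ?c]
    by (simp add: A1_def \<Phi>_def \<eta>_def[symmetric] peva_def map_poly_pderiv[OF \<eta>] l_def)
  obtain x0 where x0: "x0 \<in> polys m" "A0 - peval ?c y' (poly F (Var j)) = ?c (d ^ Suc e) * x0"
    using diff[OF pF] unfolding e0 by blast
  obtain a1 where a1: "a1 \<in> polys m" "peval ?c y' (poly F (Var j)) - ?c (d ^ Suc e) * a1 \<in> ?J"
    using h2 by (auto simp: ideal_mod_def)
  define a where "a = x0 + a1"
  define j0 where "j0 = A0 - ?c (d ^ Suc e) * a"
  have a: "a \<in> polys m"
    unfolding a_def by (intro R x0 a1)
  have j0: "j0 \<in> ?J"
    using a1(2) x0(2) by (simp add: j0_def a_def algebra_simps)
  obtain x1 where x1: "x1 \<in> polys m"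
    "l * A1 - peval ?c y' (lead_coeff F * poly (pderiv F) (Var j)) = ?c (d ^ Suc e) * x1"
    using diff[OF pG] unfolding e1 by blast
  obtain s2 where s2: "s2 \<in> polys m"
    "peval ?c y' (lead_coeff F * poly (pderiv F) (Var j)) * b - ?c d - ?c (d ^ 2) * s2 \<in> ?J"
    using h1 by (auto simp: ideal_mod_def)
  \<comment> \<open>The second-order term has the factor
    \<open>(d ^ e) ^ 2 = d ^ Suc e * d * d ^ f\<close>; this is where \<open>e \<ge> 2\<close> is
    used.\<close>
  define f where "f = e - 2"
  have ef: "e = Suc (Suc f)"
    using e by (simp add: f_def)
  \<comment> \<open>Chosen so that \<open>l * A1 * b\<close> equals \<open>d * s\<close> modulo the
    ideal, where \<open>s\<close> is congruent to \<open>1\<close> modulo \<open>d\<close> and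
    therefore has a unit as value.\<close>
  define s1 where "s1 = ?c (d ^ Suc f) * x1 * b + s2"
  define s where "s = 1 + ?c d * s1"
  define j1 where "j1 = l * A1 * b - ?c d * s"
  have s1: "s1 \<in> polys m"
    unfolding s1_def by (intro R x1 s2 b const_in_polys)
  have s: "s \<in> polys m"
    unfolding s_def by (intro R s1 const_in_polys)
  have "j1 = peval ?c y' (lead_coeff F * poly (pderiv F) (Var j)) * b - ?c d - ?c (d ^ 2) * s2"
  proof -
    have "l * A1 = peval ?c y' (lead_coeff F * poly (pderiv F) (Var j)) + ?c (d ^ Suc e) * x1"
      using x1(2) by (simp add: algebra_simps)
    then show ?thesis
      by (simp add: j1_def s_def s1_def ef c_simps algebra_simps power2_eq_square)
  qed
  then have j1: "j1 \<in> ?J"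
    using s2(2) by simp
  have evJ: "peval u z x = 0" if "x \<in> ?J" for x
    using tower_ideal_zero[OF hom T that] .
  have ud: "u d \<in> M'"
    using d u_in_M' by blast
  have "peval u z s = 1 + u d * peval u z s1"
    by (simp add: s_def ev_simps peval_const[OF hom])
  then have "peval u z s dvd 1"
    using one_plus_max_unit[OF noethA' localA' is_idealD(5)[OF M'_ideal UNIV_I ud]] by simp
  then obtain t1 where t1: "peval u z s * t1 = 1"
    by (metis dvdE)
  define m1 where "m1 = Suc m"
  \<comment> \<open>So far only the value of \<open>s\<close> is a unit; the new variable makes
    \<open>s\<close> invertible in the quotient, for the cancellation in the kernel
    argument.\<close>
  define L1 where "L1 = L @ [(m, poly [:- 1, s:] (Var m))]"
  define z1 where "z1 = z(m := t1)"
  have T1: "tower u m1 L1 z1" and inv: "s * Var m - 1 \<in> tower_ideal m1 L1"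
    and nz1: "nonzerodivisor_mod d m1 (tower_ideal m1 L1)"
    unfolding L1_def m1_def z1_def using tower_inverse[OF hom T s t1] nz by auto
  have sub1: "polys m \<subseteq> (polys m1 :: 'a mpoly set)" and sub2: "polys m1 \<subseteq> (polys (Suc m1) :: 'a mpoly set)"
    unfolding m1_def by (rule polys_mono; simp)+
  have ev1: "peval u z1 x = peval u z x" if "x \<in> polys m" for x
    unfolding z1_def by (rule peval_upd[OF hom that])
  \<comment> \<open>Since \<open>l * A1 * b = d * s\<close> modulo the ideal, the correction
    \<open>d ^ e * q * T\<close> has linear coefficient
    \<open>A1 * d ^ e * q = d ^ Suc e * s\<close>: dividing by the derivative costs one factor
    \<open>d\<close>.\<close>
  define q where "q = l * b"
  define \<delta> where "\<delta> = ?c (d ^ e) * q"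
  have q: "q \<in> polys m" and \<delta>: "\<delta> \<in> polys m"
    unfolding q_def \<delta>_def by (intro R A b const_in_polys)+
  obtain R1 where R1: "R1 \<in> PQ (polys m)"
    "pcompose \<Phi> [:y' j, \<delta>:] = [:A0, A1 * \<delta>:] + smult (\<delta> ^ 2) R1"
    using taylor_expansion[OF polys_subring _ \<delta> \<Phi>, of "y' j"] y' unfolding A0_def A1_def by auto
  define R2 where "R2 = [:0, s1:] + smult (?c (d ^ f) * q ^ 2) R1"
  define g where "g = [:a, 1:] + smult (?c d) R2"
  have R2: "R2 \<in> PQ (polys m)"
    unfolding R2_def using s1 R1 q
    by (intro is_subringD[OF PQ_subring[OF polys_subring]] PQ_smult[OF polys_subring] R
        is_subring_power[OF polys_subring] const_in_polys)
      (auto simp: PQ_pCons PQ_0[OF polys_subring] R)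
  have comp: "pcompose \<Phi> [:y' j, \<delta>:] = smult (?c (d ^ Suc e)) g + [:j0, ?c (d ^ e) * j1:]"
  proof -
    have "A1 * \<delta> = ?c (d ^ Suc e) * s + ?c (d ^ e) * j1"
      by (simp add: \<delta>_def q_def j1_def c_simps algebra_simps)
    moreover have "A0 = ?c (d ^ Suc e) * a + j0"
      by (simp add: j0_def)
    moreover have "\<delta> ^ 2 = ?c (d ^ Suc e) * (?c d * (?c (d ^ f) * q ^ 2))"
      by (simp add: \<delta>_def ef c_simps power2_eq_square mult_ac)
    ultimately show ?thesis
      unfolding R1(2) by (simp add: g_def R2_def s_def smult_add_right algebra_simps)
  qed
  \<comment> \<open>The coordinate of \<open>y j\<close>: the values satisfy
    \<open>q * A1 = d * s\<close> and \<open>s * t1 = 1\<close>, so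
    \<open>d ^ e * q * t = d ^ Suc e * w\<close> is the required correction. The root is thus known
    in advance.\<close>
  define t where "t = peval u z A1 * t1 * w"
  define z2 where "z2 = z1(m1 := t)"
  define Yj where "Yj = y' j + \<delta> * Var m1"
  define Y1 where "Y1 = Y(j := Yj)"
  have V1: "Var m1 \<in> (polys (Suc m1) :: 'a mpoly set)"
    by (rule Var_in_polys) simp
  have Yj: "Yj \<in> polys (Suc m1)"
    unfolding Yj_def using y'[of j] \<delta> sub1 sub2 V1 by (intro R) auto
  have ev2: "peval u z2 x = peval u z x" if "x \<in> polys m" for x
    unfolding z2_def using peval_upd[OF hom, of x m1] sub1 that ev1 by auto
  have evYj: "peval u z2 Yj = y j"
  proof -
    have "peval u z (l * A1 * b) = u d * peval u z s"
      using evJ[OF j1] by (simp add: j1_def ev_simps peval_const[OF hom])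
    then have "peval u z (l * A1 * b) * t1 = u d"
      using t1 by (simp add: mult.assoc)
    then have "u (d ^ e) * peval u z q * t = u (d ^ Suc e) * w"
      by (simp add: q_def t_def ev_simps u_simps mult_ac)
    moreover have "peval u z2 Yj = peval u z (y' j) + u (d ^ e) * peval u z q * t"
      using y'[of j] \<delta> ev2
      by (simp add: Yj_def ev_simps peval_Var[OF hom] z2_def[symmetric])
        (simp add: \<delta>_def z2_def ev_simps peval_const[OF hom])
    ultimately show ?thesis
      using w by (simp add: algebra_simps)
  qed
  have polyYj: "poly \<Phi> Yj = ?c (d ^ Suc e) * poly g (Var m1) + (j0 + Var m1 * (?c (d ^ e) * j1))"
  proof -
    have "poly \<Phi> Yj = poly (pcompose \<Phi> [:y' j, \<delta>:]) (Var m1)"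
      by (simp add: poly_pcompose Yj_def mult.commute)
    then show ?thesis
      by (simp add: comp)
  qed
  have fY1: "peval ?c Y1 (poly F (Var j)) = poly \<Phi> Yj"
    unfolding Y1_def peval_fun_upd_Suc[OF const_poly_hom F(1)] by (simp add: \<Phi>_def \<eta>_def peva_def)
  have evY1: "peval u z2 (Y1 i) = y i" if "i < Suc j" for i
    using that evYj Y(1,2)[of i] ev2 by (cases "i = j") (auto simp: Y1_def)
  have evp: "peval u z2 (peval ?c Y1 p) = peval u y p" if "p \<in> polys (Suc j)" for p
    unfolding peval_peval[OF hom that] by (rule peval_cong[OF that evY1])
  have g1: "g \<in> PQ (polys m1)"
  proof -
    have "g \<in> PQ (polys m)"
      unfolding g_def using a R2
      by (intro is_subringD[OF PQ_subring[OF polys_subring]] PQ_smult[OF polys_subring])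
        (auto simp: PQ_pCons PQ_0[OF polys_subring] R)
    then show "g \<in> PQ (polys m1)"
      using PQ_mono[OF sub1] by blast
  qed
  \<comment> \<open>The lift takes the value \<open>y j\<close>, a root of \<open>F\<close>; the
    discrepancies \<open>j0\<close> and \<open>j1\<close> vanish at the point, and the nonzero
    factor \<open>u (d ^ Suc e)\<close> cancels in the domain \<open>A'\<close>.\<close>
  have "peva (peval u z1) t g = 0"
  proof -
    have "peval u z2 (poly \<Phi> Yj) = peval u y (poly F (Var j))"
      using evp[OF pF] by (simp add: fY1)
    also have "\<dots> = 0"
      using F(2) peval_fun_upd_Suc[OF hom F(1), of y "y j"] by simp
    finally have "peval u z2 (poly \<Phi> Yj) = 0" .
    moreover have "peval u z2 j0 = 0" "peval u z2 j1 = 0"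
      using ev2 evJ j0 j1 is_idealD(1)[OF J] by auto
    ultimately have "u (d ^ Suc e) * peval u z2 (poly g (Var m1)) = 0"
      unfolding polyYj by (simp add: ev_simps peval_const[OF hom])
    then have "peval u z2 (poly g (Var m1)) = 0"
      using d by (auto simp: u_simps u_eq_0_iff)
    then show ?thesis
      unfolding z2_def peval_poly_Var[OF hom g1] .
  qed
  moreover have "peva (peval u z1) t (pderiv g) dvd 1"
  proof -
    have "peva (peval u z1) t (pderiv g) = 1 + u d * peva (peval u z1) t (pderiv R2)"
      by (simp add: g_def pderiv_add pderiv_smult pderiv_pCons peva_add[OF ev_hom] peva_smult[OF ev_hom]
          peva_pCons[OF ev_hom] peva_0[OF ev_hom] ev_simps peval_const[OF hom])
    then show ?thesis
      using one_plus_max_unit[OF noethA' localA' is_idealD(5)[OF M'_ideal UNIV_I ud]] by simp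
  qed
  moreover define L2 where "L2 = L1 @ [(m1, poly g (Var m1))]"
  ultimately have T2: "tower u (Suc m1) L2 z2"
    and nz2: "nonzerodivisor_mod d (Suc m1) (tower_ideal (Suc m1) L2)"
    unfolding z2_def using tower_linear[OF hom T1 nz1 _ _ g_def] a R2 sub1 PQ_mono[OF sub1] by auto
  let ?J2 = "tower_ideal (Suc m1) L2"
  have J2: "is_ideal (polys (Suc m1)) ?J2"
    by (rule tower_ideal_is_ideal[OF hom T2])
  have le: "?J \<subseteq> ?J2" "tower_ideal m1 L1 \<subseteq> ?J2"
    by (rule tower_ideal_mono; auto simp: m1_def L1_def L2_def)+
  have sub: "polys m \<subseteq> (polys (Suc m1) :: 'a mpoly set)"
    using sub1 sub2 by blast
  have gJ: "poly g (Var m1) \<in> ?J2"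
    unfolding tower_ideal_def by (rule gen_ideal_mem[OF polys_subring]) (simp add: L2_def)
  have fJ: "poly \<Phi> Yj \<in> ?J2"
    unfolding polyYj using j0 j1 le
    by (intro is_idealD(3)[OF J2] is_idealD(4)[OF J2] gJ V1 const_in_polys) auto
  have kernel: "peval ?c Y1 p \<in> ?J2" if p: "p \<in> polys (Suc j)" "peval u y p = 0" for p
  proof -
    obtain P where P: "P \<in> PQ (polys j)" "p = poly P (Var j)"
      using p(1) unfolding polys_Suc by auto
    have "peva (peval u y) (y j) P = 0"
      using p(2) peval_fun_upd_Suc[OF hom P(1), of y "y j"] by (simp add: P(2))
    then obtain N q' r where *: "q' \<in> PQ (polys j)" "r \<in> PQ (polys j)"
      "smult (lead_coeff F ^ N) P = F * q' + r" "\<And>i. peval u y (coeff r i) = 0"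
      using divide[OF P(1)] by blast
    define x where "x = peva \<eta> Yj P"
    have x: "peval ?c Y1 p = x"
      unfolding P(2) Y1_def peval_fun_upd_Suc[OF const_poly_hom P(1)] x_def \<eta>_def ..
    have \<eta>Q: "peva \<eta> Yj P' \<in> polys (Suc m1)" if "P' \<in> PQ (polys j)" for P'
      unfolding peva_altdef[OF \<eta>] using that \<eta>m sub Yj
      by (intro is_subring_sum[OF polys_subring] R is_subring_power[OF polys_subring]) (auto simp: PQ_iff)
    have xm: "x \<in> polys (Suc m1)"
      unfolding x_def by (rule \<eta>Q[OF P(1)])
    have "\<eta> (coeff r i) \<in> ?J2" for i
      using ker[of "coeff r i"] *(2,4) le unfolding \<eta>_def by (auto simp: PQ_iff)
    then have "peva \<eta> Yj r \<in> ?J2"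
      by (intro peva_in_ideal[OF \<eta> J2 Yj polys_subring])
    moreover have "peva \<eta> Yj F = poly \<Phi> Yj"
      by (simp add: peva_def \<Phi>_def)
    ultimately have "peva \<eta> Yj F * peva \<eta> Yj q' + peva \<eta> Yj r \<in> ?J2"
      using fJ by (intro is_idealD(3)[OF J2] is_idealD(5)[OF J2] \<eta>Q *) simp_all
    moreover have "l ^ N * x = peva \<eta> Yj F * peva \<eta> Yj q' + peva \<eta> Yj r"
      using arg_cong[OF *(3), of "peva \<eta> Yj"]
      by (simp add: peva_add[OF \<eta>] peva_mult[OF \<eta>] peva_smult[OF \<eta>] ring_hom_simps[OF \<eta>] x_def l_def)
    ultimately have lx: "l ^ N * x \<in> ?J2"
      by simp
    \<comment> \<open>The power of \<open>l\<close> left by pseudo-division becomes a power of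
      \<open>l * A1 * b\<close>, that is, of \<open>d * s\<close>. Regularity of \<open>d\<close>
      and invertibility of \<open>s\<close> then remove it.\<close>
    have "(A1 * b) ^ N * (l ^ N * x) \<in> ?J2"
      by (rule is_idealD(4)[OF J2 is_subring_power[OF polys_subring] lx])
        (rule subsetD[OF sub], intro R A b)
    moreover have "((l * A1 * b) ^ N - (?c d * s) ^ N) * x \<in> ?J2"
    proof (intro is_idealD(5)[OF J2 xm] ideal_power_diff[OF polys_subring J2])
      show "l * A1 * b \<in> polys (Suc m1)" "?c d * s \<in> polys (Suc m1)"
        by (rule subsetD[OF sub], intro R A b s const_in_polys)+
      show "l * A1 * b - ?c d * s \<in> ?J2"
        using j1 le unfolding j1_def by blast
    qed
    ultimately have "(A1 * b) ^ N * (l ^ N * x) - ((l * A1 * b) ^ N - (?c d * s) ^ N) * x \<in> ?J2"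
      by (rule is_ideal_diff[OF polys_subring J2])
    then have dsx: "?c d ^ N * (s ^ N * x) \<in> ?J2"
      by (simp add: power_mult_distrib algebra_simps)
    have strip: "v \<in> ?J2" if "?c d ^ k * v \<in> ?J2" "v \<in> polys (Suc m1)" for k v
      using that
    proof (induction k)
      case (Suc k)
      have "?c d * (?c d ^ k * v) \<in> ?J2"
        using Suc.prems(1) by (simp add: mult.assoc)
      then have "?c d ^ k * v \<in> ?J2"
        using nz2 Suc.prems(2) is_subringD(5)[OF polys_subring is_subring_power[OF polys_subring const_in_polys]]
        unfolding nonzerodivisor_mod_def by blast
      then show ?case
        using Suc by blast
    qed simp
    have "s \<in> polys (Suc m1)" "Var m \<in> (polys (Suc m1) :: 'a mpoly set)" "s * Var m - 1 \<in> ?J2"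
      using s sub le inv by (auto intro: Var_in_polys simp: m1_def)
    note canc = inverse_cancel(2)[OF polys_subring J2 this xm]
    have "s ^ N * x \<in> ?J2"
      by (rule strip[OF dsx]) (intro R is_subring_power[OF polys_subring] xm \<open>s \<in> polys (Suc m1)\<close>)
    then show ?thesis
      unfolding x by (rule canc)
  qed
  have "Y1 i \<in> polys (Suc m1) \<and> (\<exists>x\<in>polys (Suc m1). Y1 i - y' i = ?c (d ^ e) * x)" if "i < Suc j" for i
  proof (cases "i = j")
    case True
    have "q * Var m1 \<in> polys (Suc m1)"
      using q sub V1 by (intro R) auto
    moreover have "Y1 i - y' i = ?c (d ^ e) * (q * Var m1)"
      using True by (simp add: Y1_def Yj_def \<delta>_def mult.assoc)
    ultimately show ?thesis
      using True Yj by (auto simp: Y1_def)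
  next
    case False
    then have i: "i < j"
      using that by simp
    obtain x where x: "x \<in> polys m" "Y i - y' i = ?c (d ^ Suc e) * x"
      using Y(3)[OF i] by blast
    have "?c d * x \<in> polys (Suc m1)"
      using x(1) sub by (intro R const_in_polys) auto
    moreover have "Y1 i - y' i = ?c (d ^ e) * (?c d * x)"
      using False x(2) by (simp add: Y1_def c_simps mult_ac)
    ultimately show ?thesis
      using False i Y(1)[OF i] sub by (auto simp: Y1_def)
  qed
  then have "lift_state d y y' (Suc j) e (Suc m1) L2 z2 Y1"
    unfolding lift_state_def using T2 nz2 kernel evY1 by blast
  moreover have "set L \<subseteq> set L2" "\<forall>i<m. z2 i = z i"
    by (auto simp: L2_def L1_def z2_def z1_def m1_def)
  ultimately show ?thesis
    unfolding m1_def by blast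
qed

end

section \<open>Factorisation through a standard smooth algebra\<close>

context flat_local_extension
begin

text \<open>By dimension one of \<open>A'\<close>, the product of the given elements divides a power
  of \<open>u x\<close> for any nonzero \<open>x\<close> in \<open>M\<close>. The extra factor in
  \<open>x ^ Suc k\<close> keeps the power in \<open>M\<close> even for
  \<open>k = 0\<close>.\<close>

lemma ex_common_multiple:
  assumes "finite S" "\<And>i. i \<in> S \<Longrightarrow> \<nu> i \<noteq> 0"
  shows "\<exists>d\<in>M. d \<noteq> 0 \<and> (\<forall>i\<in>S. \<nu> i dvd u d)"
proof -
  obtain x where x: "x \<in> M" "x \<noteq> 0"
    using max_nonzero[OF noethA localA dimA] by blast
  have "(\<Prod>i\<in>S. \<nu> i) \<noteq> 0"
    using assms by simp
  then obtain k where k: "(\<Prod>i\<in>S. \<nu> i) dvd u x ^ k"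
    using nonzero_dvd_power[OF noethA' localA' dimA' _ u_in_M'[OF x(1)]] by blast
  have "\<nu> i dvd u (x ^ Suc k)" if "i \<in> S" for i
  proof -
    have "\<nu> i dvd (\<Prod>i\<in>S. \<nu> i)"
      using assms(1) that by (rule dvd_prodI)
    then show ?thesis
      using k by (simp add: u_simps) (meson dvd_mult dvd_trans)
  qed
  moreover have "x ^ Suc k \<in> M"
    using is_idealD(5)[OF M_ideal UNIV_I x(1)] by simp
  ultimately show ?thesis
    using x(2) by (intro bexI[of _ "x ^ Suc k"]) auto
qed

text \<open>In place of the ideal of \<open>B\<close> stands the whole kernel of evaluation at
  \<open>y\<close>. So \<open>B\<close> is replaced by its image in \<open>A'\<close>, a domain,
  where minimal relations make sense.\<close>

lemma factorisation:
  fixes n :: nat and y :: "nat \<Rightarrow> 'b"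
  shows "\<exists>m J z g. standard_smooth m J \<and> (\<forall>q\<in>J. peval u z q = 0) \<and> (\<forall>j<n. g j \<in> polys m) \<and>
    (\<forall>p\<in>polys n. peval u y p = 0 \<longrightarrow> peval const_poly g p \<in> J) \<and> (\<forall>j<n. peval u z (g j) = y j)"
proof -
  define trans where "trans j \<longleftrightarrow> (\<forall>P i. P \<in> PQ (polys j) \<longrightarrow> peva (peval u y) (y j) P = 0 \<longrightarrow>
      peval u y (coeff P i) = 0)" for j
  define alg where "alg j F \<longleftrightarrow> F \<in> PQ (polys j) \<and> peva (peval u y) (y j) F = 0 \<and>
      peval u y (lead_coeff F) \<noteq> 0 \<and> peva (peval u y) (y j) (pderiv F) \<noteq> 0 \<and>
      (\<forall>P. P \<in> PQ (polys j) \<longrightarrow> peva (peval u y) (y j) P = 0 \<longrightarrow>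
        (\<exists>N. \<exists>q\<in>PQ (polys j). \<exists>r\<in>PQ (polys j). smult (lead_coeff F ^ N) P = F * q + r \<and>
          (\<forall>i. peval u y (coeff r i) = 0)))" for j F
  have "\<forall>j. \<exists>F. \<not> trans j \<longrightarrow> alg j F"
  proof
    fix j
    show "\<exists>F. \<not> trans j \<longrightarrow> alg j F"
    proof (cases rule: minimal_relation[OF polys_subring ev_hom char0, of j y "y j", case_names trans alg])
      case trans
      then show ?thesis
        unfolding trans_def by blast
    next
      case (alg F)
      then have "alg j F"
        unfolding alg_def by blast
      then show ?thesis
        by blast
    qed
  qed
  then obtain F where F: "\<And>j. \<not> trans j \<Longrightarrow> alg j (F j)"
    by metis
  define G where "G j = lead_coeff (F j) * poly (pderiv (F j)) (Var j)" for j
  define S where "S = {j. j < n \<and> \<not> trans j}"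
  have evG: "peval u y (G j) = peval u y (lead_coeff (F j)) * peva (peval u y) (y j) (pderiv (F j))" for j
    by (simp add: G_def ev_simps hom_poly[OF ev_hom] peval_Var[OF hom])
  have "peval u y (G j) \<noteq> 0" if "j \<in> S" for j
    using F[of j] that unfolding S_def alg_def evG by simp
  then obtain d where d: "d \<in> M" "d \<noteq> 0" "\<And>j. j \<in> S \<Longrightarrow> peval u y (G j) dvd u d"
    using ex_common_multiple[of S "\<lambda>j. peval u y (G j)"] by (auto simp: S_def)
  \<comment> \<open>The cofactors \<open>b j\<close> in \<open>A'\<close> play the part of inverse
    derivatives in the Newton step, so they are approximated together with the
    \<open>y j\<close>.\<close>
  then obtain b where b: "\<And>j. j \<in> S \<Longrightarrow> u d = peval u y (G j) * b j"
    unfolding dvd_def by metis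
  \<comment> \<open>State \<open>j\<close> has precision \<open>d ^ (n + 2 - j)\<close>: every
    variable costs one factor \<open>d\<close>, and the last Newton step still has
    \<open>e = 2\<close>.\<close>
  define D where "D = d ^ (n + 2)"
  have D0: "D \<noteq> 0"
    using d by (simp add: D_def)
  have fin: "finite (y ` {..<n} \<union> b ` S)"
    by (simp add: S_def)
  obtain m0 L0 z0 where T0: "tower u m0 L0 z0"
    "\<And>x D' w. x \<in> polys m0 \<Longrightarrow> peval u z0 x = u D' * w \<Longrightarrow> x \<in> ideal_mod D' m0 (tower_ideal m0 L0)"
    "\<And>x. x \<in> y ` {..<n} \<union> b ` S \<Longrightarrow> \<exists>x'\<in>polys m0. \<exists>w. x - peval u z0 x' = u D * w"
    using approximation_tower[OF fin D0] by metis
  let ?J0 = "tower_ideal m0 L0"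
  have "\<forall>j. \<exists>x. j < n \<longrightarrow> x \<in> polys m0 \<and> (\<exists>w. y j - peval u z0 x = u D * w)"
    using T0(3) by blast
  then obtain y' where y': "\<And>j. j < n \<Longrightarrow> y' j \<in> polys m0"
    "\<And>j. j < n \<Longrightarrow> \<exists>w. y j - peval u z0 (y' j) = u D * w"
    by metis
  have "\<forall>j. \<exists>x. j \<in> S \<longrightarrow> x \<in> polys m0 \<and> (\<exists>w. b j - peval u z0 x = u D * w)"
    using T0(3) by blast
  then obtain b' where b': "\<And>j. j \<in> S \<Longrightarrow> b' j \<in> polys m0"
    "\<And>j. j \<in> S \<Longrightarrow> \<exists>w. b j - peval u z0 (b' j) = u D * w"
    by metis
  have dvdI: "is_ideal UNIV {x. u D dvd x}"
    by (rule is_ideal_UNIVI) auto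
  have approx: "u D dvd peval u y p - peval u z0 (peval const_poly y' p)" if "p \<in> polys k" "k \<le> n" for p k
    using peval_diff_ideal[OF is_subring_UNIV dvdI hom _ _ _ _ that(1), of y "\<lambda>i. peval u z0 (y' i)"]
      y'(2) that(2)
    by (auto simp: peval_peval[OF hom that(1)] dvd_def)
  have y'm: "peval const_poly y' p \<in> polys m0" if "p \<in> polys k" "k \<le> n" for p k
    using y'(1) that by (intro peval_in_subring[OF polys_subring const_poly_hom that(1)]) auto
  have FS: "F j \<in> PQ (polys j)" "poly (F j) (Var j) \<in> polys (Suc j)" "G j \<in> polys (Suc j)"
    "peval u y (poly (F j) (Var j)) = 0" if "j \<in> S" for j
  proof -
    have A: "alg j (F j)"
      using F that by (simp add: S_def)
    then show F1: "F j \<in> PQ (polys j)"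
      by (simp add: alg_def)
    then have "lead_coeff (F j) \<in> polys (Suc j)"
      using polys_mono[of j "Suc j"] by (auto simp: PQ_iff)
    moreover have "poly (pderiv (F j)) (Var j) \<in> polys (Suc j)"
      using PQ_pderiv[OF polys_subring F1] unfolding polys_Suc by blast
    ultimately show "G j \<in> polys (Suc j)"
      unfolding G_def by (rule is_subringD(5)[OF polys_subring])
    show "poly (F j) (Var j) \<in> polys (Suc j)"
      using F1 unfolding polys_Suc by blast
    show "peval u y (poly (F j) (Var j)) = 0"
      using A by (simp add: alg_def hom_poly[OF ev_hom] peval_Var[OF hom])
  qed
  have h2: "peval const_poly y' (poly (F j) (Var j)) \<in> ideal_mod D m0 ?J0" if "j \<in> S" for j
  proof -
    have jn: "Suc j \<le> n"
      using that by (simp add: S_def)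
    have "u D dvd peval u z0 (peval const_poly y' (poly (F j) (Var j)))"
      using approx[OF FS(2)[OF that] jn] FS(4)[OF that] by simp
    then show ?thesis
      using T0(2)[OF y'm[OF FS(2)[OF that] jn]] by (auto elim!: dvdE)
  qed
  have h1: "peval const_poly y' (G j) * b' j - const_poly d \<in> ideal_mod D m0 ?J0" if jS: "j \<in> S" for j
  proof -
    have jn: "Suc j \<le> n"
      using jS by (simp add: S_def)
    have Gm: "peval const_poly y' (G j) \<in> polys m0"
      by (rule y'm[OF FS(3)[OF jS] jn])
    obtain w1 where w1: "peval u y (G j) - peval u z0 (peval const_poly y' (G j)) = u D * w1"
      using approx[OF FS(3)[OF jS] jn] by (auto elim!: dvdE)
    obtain w2 where w2: "b j - peval u z0 (b' j) = u D * w2"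
      using b'(2)[OF jS] by blast
    have "peval u z0 (peval const_poly y' (G j) * b' j - const_poly d) =
        (peval u y (G j) - u D * w1) * (b j - u D * w2) - u d"
      using w1 w2 by (simp add: ev_simps peval_const[OF hom] algebra_simps)
    also have "\<dots> = u D * (u D * w1 * w2 - w1 * b j - peval u y (G j) * w2)"
      unfolding b[OF jS] by (simp add: algebra_simps)
    finally show ?thesis
      using b'(1)[OF jS] Gm by (intro T0(2)) (auto intro!: is_subringD[OF polys_subring])
  qed
  \<comment> \<open>The conditions on \<open>L0\<close> and \<open>z0\<close> keep the
    approximations \<open>y'\<close> and \<open>b'\<close>, and all congruences proved for them,
    valid in every later tower.\<close>
  have main: "\<exists>m L z Y. m0 \<le> m \<and> set L0 \<subseteq> set L \<and> (\<forall>i<m0. z i = z0 i) \<and>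
      lift_state d y y' j (n + 2 - j) m L z Y" if "j \<le> n" for j
    using that
  proof (induction j)
    case 0
    have "nonzerodivisor_mod d m0 ?J0"
      unfolding nonzerodivisor_mod_def
    proof (intro ballI impI)
      fix x assume x: "x \<in> polys m0" "const_poly d * x \<in> ?J0"
      have "u d * peval u z0 x = 0"
        using tower_ideal_zero[OF hom T0(1) x(2)] by (simp add: ev_simps peval_const[OF hom])
      \<comment> \<open>Zero is written as a multiple of \<open>u 0\<close>, so that the modulus
        zero in \<open>T0(2)\<close> gives exact membership in the ideal.\<close>
      then have "peval u z0 x = u 0 * 0"
        using d(2) by (simp add: u_eq_0_iff u_simps)
      then have "x \<in> ideal_mod 0 m0 ?J0"
        by (rule T0(2)[OF x(1)])
      then show "x \<in> ?J0"
        by (auto simp: ideal_mod_def ring_hom_simps[OF const_poly_hom])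
    qed
    moreover have "peval const_poly (\<lambda>_. 0) p \<in> ?J0" if p: "p \<in> polys 0" "peval u y p = 0" for p
    proof -
      obtain c where c: "p = const_poly c"
        using polys_0[OF p(1)] by blast
      then have "c = 0"
        using p(2) by (simp add: peval_const[OF hom] u_eq_0_iff)
      then show ?thesis
        using is_idealD(2)[OF tower_ideal_is_ideal[OF hom T0(1)]]
        by (simp add: c ring_hom_simps(1)[OF const_poly_hom] ring_hom_simps(1)[OF peval_hom[OF const_poly_hom]])
    qed
    ultimately show ?case
      using T0(1)
      by (intro exI[of _ m0] exI[of _ L0] exI[of _ z0] exI[of _ "\<lambda>_. 0"]) (simp add: lift_state_def)
  next
    case (Suc j)
    then obtain m L z Y where IH: "m0 \<le> m" "set L0 \<subseteq> set L" "\<forall>i<m0. z i = z0 i"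
      "lift_state d y y' j (n + 2 - j) m L z Y"
      by auto
    define e where "e = n + 1 - j"
    have e: "n + 2 - j = Suc e" "n + 2 - Suc j = e" "e \<ge> 2" "j < n"
      using Suc.prems by (auto simp: e_def)
    have st: "lift_state d y y' j (Suc e) m L z Y"
      using IH(4) unfolding e(1) .
    have ev: "peval u z x = peval u z0 x" if "x \<in> polys m0" for x
      using IH(3) by (intro peval_cong[OF that]) auto
    have y'm: "y' i \<in> polys m" if "i \<le> j" for i
      using y'(1)[of i] that e(4) polys_mono[OF IH(1)] by auto
    obtain w where "y j - peval u z0 (y' j) = u D * w"
      using y'(2)[OF e(4)] by blast
    moreover have "D = d ^ Suc e * d ^ (n + 2 - Suc e)"
      using e unfolding D_def power_add[symmetric] by simp
    ultimately have w: "y j - peval u z (y' j) = u (d ^ Suc e) * (u (d ^ (n + 2 - Suc e)) * w)"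
      using ev[OF y'(1)[OF e(4)]] by (simp add: u_simps mult.assoc)
    have le: "?J0 \<subseteq> tower_ideal m L"
      by (rule tower_ideal_mono[OF IH(1,2)])
    have dm: "ideal_mod D m0 ?J0 \<subseteq> ideal_mod (d ^ k) m (tower_ideal m L)" if "k \<le> n + 2" for k
    proof -
      have "D = d ^ k * d ^ (n + 2 - k)"
        using that unfolding D_def power_add[symmetric] by simp
      then show ?thesis
        using ideal_mod_mono[OF IH(1) le] by simp
    qed
    show ?case
    proof (cases "trans j")
      case True
      have w': "y j - peval u z (y' j) = u (d ^ e) * (u d * (u (d ^ (n + 2 - Suc e)) * w))"
        using w by (simp add: u_simps mult_ac)
      have "lift_state d y y' (Suc j) e (Suc m) L (z(m := u d * (u (d ^ (n + 2 - Suc e)) * w)))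
          (Y(j := y' j + const_poly (d ^ e) * Var m))"
        by (rule lift_transcendental[OF st _ y'm w']) (use True in \<open>auto simp: trans_def\<close>)
      then show ?thesis
        using IH(1-3) unfolding e(2) by (intro exI conjI) (auto simp: le_Suc_eq)
    next
      case False
      then have jS: "j \<in> S"
        using e(4) by (simp add: S_def)
      have A: "alg j (F j)"
        by (rule F[OF False])
      have "b' j \<in> polys m"
        using b'(1)[OF jS] polys_mono[OF IH(1)] by blast
      moreover have "peval const_poly y' (lead_coeff (F j) * poly (pderiv (F j)) (Var j)) * b' j - const_poly d
          \<in> ideal_mod (d ^ 2) m (tower_ideal m L)"
        using h1[OF jS] dm[of 2] by (auto simp: G_def)
      moreover have "peval const_poly y' (poly (F j) (Var j)) \<in> ideal_mod (d ^ Suc e) m (tower_ideal m L)"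
        by (rule subsetD[OF dm h2[OF jS]]) (simp add: e_def)
      ultimately obtain L' z' Y' where *: "set L \<subseteq> set L'" "\<forall>i<m. z' i = z i"
        "lift_state d y y' (Suc j) e (Suc (Suc m)) L' z' Y'"
        using lift_algebraic[OF st d(1,2) e(3) _ _ _ y'm _ w, of "F j" "b' j"] A unfolding alg_def by blast
      have "m0 \<le> Suc (Suc m)" "set L0 \<subseteq> set L'" "\<forall>i<m0. z' i = z0 i"
        using IH(1-3) *(1,2) by auto
      then show ?thesis
        using *(3) unfolding e(2) by blast
    qed
  qed
  obtain m L z Y where st: "lift_state d y y' n (n + 2 - n) m L z Y"
    using main[of n] by blast
  have T: "tower u m L z"
    using st by (simp add: lift_state_def)
  obtain L' z' where L': "tower u (Suc m) L' z'" "standard_smooth (Suc m) (tower_ideal (Suc m) L')"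
    "tower_ideal m L \<subseteq> tower_ideal (Suc m) L'" "\<And>i. i < m \<Longrightarrow> z' i = z i"
    using tower_standard_smooth[OF hom T] by blast
  have "peval u z' x = peval u z x" if "x \<in> polys m" for x
    using L'(4) by (intro peval_cong[OF that]) auto
  then have "Y j \<in> polys (Suc m)" "peval u z' (Y j) = y j" if "j < n" for j
    using st that polys_mono[of m "Suc m"] by (auto simp: lift_state_def)
  moreover have "peval const_poly Y p \<in> tower_ideal (Suc m) L'" if "p \<in> polys n" "peval u y p = 0" for p
    using st that L'(3) by (auto simp: lift_state_def)
  ultimately show ?thesis
    using L'(2) tower_ideal_zero[OF hom L'(1)] by blast
qed

end

theorem theorem3:
  fixes u :: "'a::idom \<Rightarrow> 'b::idom"
    and M :: "'a set" and M' :: "'b set"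
    and K :: "'a set" and K' :: "'b set"
    and n :: nat and I :: "'a mpoly set" and y :: "nat \<Rightarrow> 'b"
  assumes hom: "ring_hom u" and flat: "flat_hom u"
    and noethA: "noetherian TYPE('a)" and noethA': "noetherian TYPE('b)"
    and localA: "local_ring_max M" and localA': "local_ring_max M'"
    and dimA: "krull_dim TYPE('a) = 1" and dimA': "krull_dim TYPE('b) = 1"
    and rat: "\<forall>k::nat. k > 0 \<longrightarrow> (of_nat k :: 'a) dvd 1"
    and gen: "gen_ideal UNIV (u ` M) = M'"
    and coefK: "coefficient_field K M" and coefK': "coefficient_field K' M'"
    and uK: "u ` K \<subseteq> K'"
    and I: "is_ideal (polys n) I"
    and v: "\<forall>p\<in>I. peval u y p = 0"
  shows "\<exists>(m::nat) (J :: 'a mpoly set) (z :: nat \<Rightarrow> 'b) (g :: nat \<Rightarrow> 'a mpoly).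
           standard_smooth m J \<and>
           (\<forall>q\<in>J. peval u z q = 0) \<and>
           (\<forall>j<n. g j \<in> polys m) \<and>
           (\<forall>p\<in>I. peval const_poly g p \<in> J) \<and>
           (\<forall>j<n. peval u z (g j) = y j)"
proof -
  interpret flat_local_extension u M M' K K'
    by unfold_locales (fact assms)+
  show ?thesis
    using factorisation[of n y] v is_idealD(1)[OF I] by blast
qed

end
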